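(* Consider the equality-constrained linear quadratic optimal control problem described in the context, with linearly independent constraints. The reduced Hessian of (the KKT matrix of) this problem is positive definite if and only if the matrices $\widehat R_k$, for all $k=K-1,\dots,0$, and the matrix $\widehat P_I$ appearing in the backward substitution algorithm described in the context are positive definite.
   Context: Problem. Fix integers $K\ge 1$, $n_x,n_u\ge 1$. For $k=0,\dots,K-1$ let $R_k\in\mathbb R^{n_u\times n_u}$ and $Q_k\in\mathbb R^{n_x\times n_x}$ be symmetric, $S_k\in\mathbb R^{n_x\times n_u}$, $A_k\in\mathbb R^{n_x\times n_x}$, $B_k\in\mathbb R^{n_x\times n_u}$, $\mathbf b_k,\mathbf q_k\in\mathbb R^{n_x}$, $\mathbf r_k\in\mathbb R^{n_u}$, and let $G_{k,u}$, $G_{k,x}$, $\mathbf g_k$ be real with a common (possibly zero) number of rows and with $n_u$, $n_x$, $1$ columns respectively. Let $Q_K\in\mathbb R^{n_x\times n_x}$ be symmetric, $\mathbf q_K\in\mathbb R^{n_x}$, and let $G_K$ (with $n_x$ columns) and $\mathbf g_K$ have a common, possibly zero, number of rows. The problem is to minimize over $\mathbf u_0,\dots,\mathbf u_{K-1}\in\mathbb R^{n_u}$ and $\mathbf x_0,\dots,\mathbf x_K\in\mathbb R^{n_x}$ $$\tfrac12 \mathbf x_K^\top Q_K\mathbf x_K+\mathbf q_K^\top\mathbf x_K+\sum_{k=0}^{K-1}\Big(\tfrac12\begin{bmatrix}\mathbf u_k \\ \mathbf x_k\end{bmatrix}^\top\begin{bmatrix}R_k & S_k^\top \\ S_k & Q_k\end{bmatrix}\begin{bmatrix}\mathbf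 u_k \\ \mathbf x_k\end{bmatrix}+\begin{bmatrix}\mathbf r_k \\ \mathbf q_k\end{bmatrix}^\top\begin{bmatrix}\mathbf u_k \\ \mathbf x_k\end{bmatrix}\Big)$$ subject to $\mathbf x_{k+1}=B_k\mathbf u_k+A_k\mathbf x_k+\mathbf b_k$ and $G_{k,u}\mathbf u_k+G_{k,x}\mathbf x_k=-\mathbf g_k$ for $k=0,\dots,K-1$, and $G_K\mathbf x_K=-\mathbf g_K$. Standing assumption: the constraints are linearly independent, i.e. the matrix $A$ of all these equality constraints in the stacked variable $(\mathbf u_0,\mathbf x_0,\dots,\mathbf u_{K-1},\mathbf x_{K-1},\mathbf x_K)$ has full row rank. Reduced Hessian. Let $H$ be the symmetric matrix of the quadratic part of the objective in the stacked variable. The KKT matrix is $\begin{bmatrix} H & A^\top \\ A & 0 \end{bmatrix}$, and its reduced Hessian is $Z^\top H Z$, where the columns of $Z$ form a basis of the nullspace of $A$. If the nullspace is trivial, the reduced Hessian is an empty matrix. Decompositions. Every real $m\times n$ matrix $M$ ($m,n\ge1$) of rank $\rho$ can be written $M=T_L\begin{bmatrix} -I_\rho & 0 \\ 0 & 0_{(m-\rho)\times(n-\rho)} \end{bmatrix}T_R$ with $T_L,T_R$ invertible (exact decomposition); if $m=0$ or $n=0$ one takes $T_L=I_m$, $T_R=I_n$. For a matrix that is nearly rank-deficient, the algorithm uses, for a fixed small threshold $\epsilon>0$, a decomposition $M=T_L\begin{bmatrix} -I_\rho & 0 \\ 0 & E \end{bmatrix}T_R$ with $T_L,T_R$ invertible,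 where $E\in\mathbb R^{(m-\rho)\times(n-\rho)}$ has only very small entries, of magnitude below $\epsilon$ (thresholded decomposition). For instance, with an SVD, $E$ is the diagonal matrix of the singular values smaller than $\epsilon$; with an LU factorization with complete pivoting, the factorization is stopped when no pivot larger than $\epsilon$ is found. Here $\rho$ is the number of pivots or singular values retained. $E$ may be zero. Backward substitution algorithm (only the matrix part is written; the vector quantities propagated along with it do not enter $\widehat R_k$ or $\widehat P_I$). Set $P_K=Q_K$, $H_K=G_K$. For $k=K-1,\dots,0$: 1. $\overline R=R_k+B_k^\top P_{k+1}B_k$, $\overline S=S_k+A_k^\top P_{k+1}B_k$, $\overline Q=Q_k+A_k^\top P_{k+1}A_k$, $\overline G_u=\begin{bmatrix} G_{k,u} \\ {H_{k+1}B_k} \end{bmatrix}$, $\overline G_x=\begin{bmatrix} G_{k,x} \\ {H_{k+1}A_k} \end{bmatrix}$; $\gamma_k$ is the number of rows of $\overline G_u$. 2. Compute a thresholded decomposition $\overline G_u=T_{k,L}\begin{bmatrix} -I_{\rho_k} & 0 \\ 0 & E_k \end{bmatrix}T_{k,R}$, and set $\widetilde R_k=T_{k,R}^{-\top}\,\overline R\,T_{k,R}^{-1}$, $\widetilde S_k=\overline S\,T_{k,R}^{-1}$, $\widetilde Q_k=\overline Q$, and $\begin{bmatrix} \widetilde G_{k,x} \\ {H_k} \end{bmatrix}=T_{k,L}^{-1}\overline G_x$, where $\widetilde G_{k,x}$ has $\rho_k$ rows and $H_k$ has $\gamma_k-\rho_k$ rows. 3. $\begin{bmatrix} \widehat R_k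 & \widehat S_k^\top \\ \widehat S_k & \widehat Q_k \end{bmatrix}=W_k^\top\begin{bmatrix} \widetilde R_k & \widetilde S_k^\top \\ \widetilde S_k & \widetilde Q_k \end{bmatrix}W_k$ with $W_k=\begin{bmatrix} 0_{\rho_k\times(n_u-\rho_k)} & \widetilde G_{k,x} \\ I_{n_u-\rho_k} & 0 \\ 0 & I_{n_x} \end{bmatrix}$, so $\widehat R_k$ is $(n_u-\rho_k)\times(n_u-\rho_k)$. 4. Let $\Lambda_k$ be the Cholesky factor of $\widehat R_k$ (lower triangular, $\widehat R_k=\Lambda_k\Lambda_k^\top$), and set $L_k=\Lambda_k^{-1}\widehat S_k^\top$, $Z_k=\Lambda_k^{-1}E_k^\top$, $P_k=\widehat Q_k-L_k^\top L_k$, and then update $H_k\gets H_k-Z_k^\top L_k$. (The small term $-E_k\widehat R_k^{-1}E_k^\top$, which elimination would produce in the diagonal block belonging to the remaining constraints, is neglected.) If the Cholesky factorization fails, i.e. $\widehat R_k$ is not positive definite, the algorithm stops. Operations with empty matrices are omitted. Initial stage. Let $\rho_I=\operatorname{rank}H_0$, take an exact decomposition $H_0=T_{I,L}\begin{bmatrix} -I_{\rho_I} & 0 \\ 0 & 0 \end{bmatrix}T_{I,R}$, and let $\widehat P_I$ be the lower-right $(n_x-\rho_I)\times(n_x-\rho_I)$ block of $T_{I,R}^{-\top}P_0T_{I,R}^{-1}$. Empty ($0\times 0$) matrices are regarded as positive definite.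
   Formalization: The claim fails for a fixed threshold with nonzero neglected blocks E_k; it is proved for exact decompositions (E_k = 0), and for thresholded ones when the entries of T_L, T_R are bounded by some c and the threshold is small enough depending on the data and c. *)

theory Defs
  imports
    "Jordan_Normal_Form.Matrix_Kernel"
    "Jordan_Normal_Form.DL_Rank"
    "Jordan_Normal_Form.Gauss_Jordan_Elimination"
begin

section \<open>Matrices\<close>

definition pos_def_mat :: "real mat \<Rightarrow> bool" where
  "pos_def_mat M \<longleftrightarrow> square_mat M \<and> M\<^sup>T = M \<and>
     (\<forall>v \<in> carrier_vec (dim_row M). v \<noteq> 0\<^sub>v (dim_row M) \<longrightarrow> v \<bullet> (M *\<^sub>v v) > 0)"

abbreviation inv_mat :: "real mat \<Rightarrow> real mat" where
  "inv_mat M \<equiv> the (mat_inverse M)"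

definition upper_rows :: "nat \<Rightarrow> real mat \<Rightarrow> real mat" where
  "upper_rows r M = mat r (dim_col M) (\<lambda>(i, j). M $$ (i, j))"

definition lower_rows :: "nat \<Rightarrow> real mat \<Rightarrow> real mat" where
  "lower_rows r M = mat (dim_row M - r) (dim_col M) (\<lambda>(i, j). M $$ (r + i, j))"

definition full_row_rank :: "real mat \<Rightarrow> bool" where
  "full_row_rank M \<longleftrightarrow> vec_space.rank (dim_row M) M = dim_row M"

definition nullspace_basis_mat :: "real mat \<Rightarrow> real mat \<Rightarrow> bool" where
  "nullspace_basis_mat A Z \<longleftrightarrow> dim_row Z = dim_col A \<and> distinct (cols Z) \<and>
     kernel.basis (dim_col A) A (set (cols Z))"

text \<open>The identity factors for matrices without rows or columns are the convention that goes
  with the decomposition, not a consequence of the block equation.\<close>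

definition decomposition ::
  "real mat \<Rightarrow> real mat \<Rightarrow> nat \<Rightarrow> real mat \<Rightarrow> real mat \<Rightarrow> bool" where
  "decomposition M TL \<rho> E TR \<longleftrightarrow>
     TL \<in> carrier_mat (dim_row M) (dim_row M) \<and> invertible_mat TL \<and>
     TR \<in> carrier_mat (dim_col M) (dim_col M) \<and> invertible_mat TR \<and>
     \<rho> \<le> dim_row M \<and> \<rho> \<le> dim_col M \<and>
     E \<in> carrier_mat (dim_row M - \<rho>) (dim_col M - \<rho>) \<and>
     M = TL * four_block_mat (- 1\<^sub>m \<rho>) (0\<^sub>m \<rho> (dim_col M - \<rho>)) (0\<^sub>m (dim_row M - \<rho>) \<rho>) E * TR \<and>
     (dim_row M = 0 \<or> dim_col M = 0 \<longrightarrow> TL = 1\<^sub>m (dim_row M) \<and> TR = 1\<^sub>m (dim_col M))"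

definition thresholded_decomposition ::
  "real \<Rightarrow> real mat \<Rightarrow> real mat \<Rightarrow> nat \<Rightarrow> real mat \<Rightarrow> real mat \<Rightarrow> bool" where
  "thresholded_decomposition \<epsilon> M TL \<rho> E TR \<longleftrightarrow>
     decomposition M TL \<rho> E TR \<and>
     (\<forall>i < dim_row E. \<forall>j < dim_col E. \<bar>E $$ (i, j)\<bar> < \<epsilon>)"

definition exact_decomposition :: "real mat \<Rightarrow> real mat \<Rightarrow> real mat \<Rightarrow> bool" where
  "exact_decomposition M TL TR \<longleftrightarrow>
     (let \<rho> = vec_space.rank (dim_row M) M
      in decomposition M TL \<rho> (0\<^sub>m (dim_row M - \<rho>) (dim_col M - \<rho>)) TR)"

definition cholesky_factor :: "real mat \<Rightarrow> real mat \<Rightarrow> bool" where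
  "cholesky_factor \<Lambda> M \<longleftrightarrow> \<Lambda> \<in> carrier_mat (dim_row M) (dim_row M) \<and>
     (\<forall>i < dim_row M. \<forall>j < dim_row M. i < j \<longrightarrow> \<Lambda> $$ (i, j) = 0) \<and> M = \<Lambda> * \<Lambda>\<^sup>T"

definition entries_bounded :: "real \<Rightarrow> real mat \<Rightarrow> bool" where
  "entries_bounded c M \<longleftrightarrow> (\<forall>i < dim_row M. \<forall>j < dim_col M. \<bar>M $$ (i, j)\<bar> \<le> c)"


section \<open>The optimal control problem\<close>

record lq_data =
  hor :: nat                \<comment> \<open>the horizon \<open>K\<close>\<close>
  nx :: nat
  nu :: nat
  Rm :: "nat \<Rightarrow> real mat"
  Sm :: "nat \<Rightarrow> real mat"
  Qm :: "nat \<Rightarrow> real mat"  \<comment> \<open>\<open>Qm K\<close> and \<open>qv K\<close> are the terminal cost\<close>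
  rv :: "nat \<Rightarrow> real vec"
  qv :: "nat \<Rightarrow> real vec"
  Am :: "nat \<Rightarrow> real mat"
  Bm :: "nat \<Rightarrow> real mat"
  bv :: "nat \<Rightarrow> real vec"
  Gu :: "nat \<Rightarrow> real mat"
  Gx :: "nat \<Rightarrow> real mat"
  gv :: "nat \<Rightarrow> real vec"
  GT :: "real mat"          \<comment> \<open>the terminal constraint \<open>G\<^sub>K x\<^sub>K = - g\<^sub>K\<close>\<close>
  gT :: "real vec"

definition lq_problem :: "lq_data \<Rightarrow> bool" where
  "lq_problem p \<longleftrightarrow> hor p \<ge> 1 \<and> nx p \<ge> 1 \<and> nu p \<ge> 1 \<and>
     (\<forall>k < hor p.
        Rm p k \<in> carrier_mat (nu p) (nu p) \<and> (Rm p k)\<^sup>T = Rm p k \<and>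
        Sm p k \<in> carrier_mat (nx p) (nu p) \<and> rv p k \<in> carrier_vec (nu p) \<and>
        Am p k \<in> carrier_mat (nx p) (nx p) \<and> Bm p k \<in> carrier_mat (nx p) (nu p) \<and>
        bv p k \<in> carrier_vec (nx p) \<and>
        Gu p k \<in> carrier_mat (dim_vec (gv p k)) (nu p) \<and>
        Gx p k \<in> carrier_mat (dim_vec (gv p k)) (nx p)) \<and>
     (\<forall>k \<le> hor p. Qm p k \<in> carrier_mat (nx p) (nx p) \<and> (Qm p k)\<^sup>T = Qm p k \<and>
        qv p k \<in> carrier_vec (nx p)) \<and>
     GT p \<in> carrier_mat (dim_vec (gT p)) (nx p)"

definition stage_hessian :: "lq_data \<Rightarrow> nat \<Rightarrow> real mat" where
  "stage_hessian p k = four_block_mat (Rm p k) (Sm p k)\<^sup>T (Sm p k) (Qm p k)"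

definition lq_objective :: "lq_data \<Rightarrow> (nat \<Rightarrow> real vec) \<Rightarrow> (nat \<Rightarrow> real vec) \<Rightarrow> real" where
  "lq_objective p u x =
     1/2 * (x (hor p) \<bullet> (Qm p (hor p) *\<^sub>v x (hor p))) + qv p (hor p) \<bullet> x (hor p) +
     (\<Sum>k < hor p. 1/2 * ((u k @\<^sub>v x k) \<bullet> (stage_hessian p k *\<^sub>v (u k @\<^sub>v x k))) +
        (rv p k @\<^sub>v qv p k) \<bullet> (u k @\<^sub>v x k))"

definition lq_feasible :: "lq_data \<Rightarrow> (nat \<Rightarrow> real vec) \<Rightarrow> (nat \<Rightarrow> real vec) \<Rightarrow> bool" where
  "lq_feasible p u x \<longleftrightarrow>
     (\<forall>k < hor p. x (Suc k) = Bm p k *\<^sub>v u k + Am p k *\<^sub>v x k + bv p k) \<and>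
     (\<forall>k < hor p. Gu p k *\<^sub>v u k + Gx p k *\<^sub>v x k = - gv p k) \<and>
     GT p *\<^sub>v x (hor p) = - gT p"


subsection \<open>The stacked variable \<open>(u\<^sub>0, x\<^sub>0, \<dots>, u\<^sub>K\<^sub>-\<^sub>1, x\<^sub>K\<^sub>-\<^sub>1, x\<^sub>K)\<close>\<close>

definition stack :: "lq_data \<Rightarrow> (nat \<Rightarrow> real vec) \<Rightarrow> (nat \<Rightarrow> real vec) \<Rightarrow> real vec" where
  "stack p u x = foldr (\<lambda>k z. (u k @\<^sub>v x k) @\<^sub>v z) [0..<hor p] (x (hor p))"

definition stack_dim :: "lq_data \<Rightarrow> nat" where
  "stack_dim p = hor p * (nu p + nx p) + nx p"

definition u_pos :: "lq_data \<Rightarrow> nat \<Rightarrow> nat" where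
  "u_pos p k = k * (nu p + nx p)"

definition x_pos :: "lq_data \<Rightarrow> nat \<Rightarrow> nat" where
  "x_pos p k = (if k < hor p then k * (nu p + nx p) + nu p else hor p * (nu p + nx p))"

text \<open>\<open>u_sel p k\<close> and \<open>x_sel p k\<close> extract \<open>u\<^sub>k\<close> and \<open>x\<^sub>k\<close> from the stacked variable.\<close>

definition u_sel :: "lq_data \<Rightarrow> nat \<Rightarrow> real mat" where
  "u_sel p k = mat (nu p) (stack_dim p) (\<lambda>(i, j). if j = u_pos p k + i then 1 else 0)"

definition x_sel :: "lq_data \<Rightarrow> nat \<Rightarrow> real mat" where
  "x_sel p k = mat (nx p) (stack_dim p) (\<lambda>(i, j). if j = x_pos p k + i then 1 else 0)"

definition dynamics_rows :: "lq_data \<Rightarrow> nat \<Rightarrow> real mat" where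
  "dynamics_rows p k = x_sel p (Suc k) - (Bm p k * u_sel p k + Am p k * x_sel p k)"

definition path_rows :: "lq_data \<Rightarrow> nat \<Rightarrow> real mat" where
  "path_rows p k = Gu p k * u_sel p k + Gx p k * x_sel p k"

definition constraint_mat :: "lq_data \<Rightarrow> real mat" where
  "constraint_mat p =
     foldr (\<lambda>k M. dynamics_rows p k @\<^sub>r path_rows p k @\<^sub>r M) [0..<hor p]
       (GT p * x_sel p (hor p))"

definition constraint_rhs :: "lq_data \<Rightarrow> real vec" where
  "constraint_rhs p = foldr (\<lambda>k v. bv p k @\<^sub>v - gv p k @\<^sub>v v) [0..<hor p] (- gT p)"

definition hessian_mat :: "lq_data \<Rightarrow> real mat" where
  "hessian_mat p = diag_block_mat (map (stage_hessian p) [0..<hor p] @ [Qm p (hor p)])"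

definition reduced_hessian :: "lq_data \<Rightarrow> real mat \<Rightarrow> real mat" where
  "reduced_hessian p Z = Z\<^sup>T * hessian_mat p * Z"


subsection \<open>The two matrices do represent the constraints and the quadratic part of the objective\<close>

lemma foldr_stack_index:
  assumes "\<And>k. k \<in> set ks \<Longrightarrow> w k \<in> carrier_vec n" "y \<in> carrier_vec m"
  shows "foldr (\<lambda>k z. w k @\<^sub>v z) ks y \<in> carrier_vec (length ks * n + m)"
    and "\<And>l i. l < length ks \<Longrightarrow> i < n \<Longrightarrow> foldr (\<lambda>k z. w k @\<^sub>v z) ks y $ (l * n + i) = w (ks ! l) $ i"
    and "\<And>i. i < m \<Longrightarrow> foldr (\<lambda>k z. w k @\<^sub>v z) ks y $ (length ks * n + i) = y $ i"
proof -
  have "foldr (\<lambda>k z. w k @\<^sub>v z) ks y \<in> carrier_vec (length ks * n + m) \<and>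
    (\<forall>l i. l < length ks \<longrightarrow> i < n \<longrightarrow> foldr (\<lambda>k z. w k @\<^sub>v z) ks y $ (l * n + i) = w (ks ! l) $ i) \<and>
    (\<forall>i. i < m \<longrightarrow> foldr (\<lambda>k z. w k @\<^sub>v z) ks y $ (length ks * n + i) = y $ i)"
    using assms
  proof (induction ks)
    case (Cons k ks)
    let ?f = "foldr (\<lambda>k z. w k @\<^sub>v z) ks y"
    have w: "w k \<in> carrier_vec n" using Cons.prems by auto
    have IH: "?f \<in> carrier_vec (length ks * n + m)"
      "\<And>l i. l < length ks \<Longrightarrow> i < n \<Longrightarrow> ?f $ (l * n + i) = w (ks ! l) $ i"
      "\<And>i. i < m \<Longrightarrow> ?f $ (length ks * n + i) = y $ i" using Cons by auto
    have c: "w k @\<^sub>v ?f \<in> carrier_vec (n + (length ks * n + m))" using w IH by auto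
    have b: "l * n + i < length ks * n + m" if "l < length ks" "i < n" for l i
    proof -
      have "Suc l * n \<le> length ks * n" using that by (intro mult_le_mono1) auto
      then show ?thesis using that by simp
    qed
    have "(w k @\<^sub>v ?f) $ (l * n + i) = w ((k # ks) ! l) $ i" if "l < Suc (length ks)" "i < n" for l i
    proof (cases l)
      case 0 then show ?thesis using that w IH(1) by auto
    next
      case (Suc j)
      then have "j < length ks" using that by simp
      from b[OF this that(2)] IH(2)[OF this that(2)] show ?thesis
        using w IH(1) Suc that by (auto simp: index_append_vec)
    qed
    moreover have "(w k @\<^sub>v ?f) $ (Suc (length ks) * n + i) = y $ i" if "i < m" for i
      using w IH(1) IH(3)[OF that] that by (auto simp: index_append_vec)
    ultimately show ?case using c by (auto simp: add.assoc)
  qed auto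
  then show "foldr (\<lambda>k z. w k @\<^sub>v z) ks y \<in> carrier_vec (length ks * n + m)"
    and "\<And>l i. l < length ks \<Longrightarrow> i < n \<Longrightarrow> foldr (\<lambda>k z. w k @\<^sub>v z) ks y $ (l * n + i) = w (ks ! l) $ i"
    and "\<And>i. i < m \<Longrightarrow> foldr (\<lambda>k z. w k @\<^sub>v z) ks y $ (length ks * n + i) = y $ i" by auto
qed

context
  fixes p :: lq_data and u x :: "nat \<Rightarrow> real vec"
  assumes p: "lq_problem p"
    and u: "\<And>k. k < hor p \<Longrightarrow> u k \<in> carrier_vec (nu p)"
    and x: "\<And>k. k \<le> hor p \<Longrightarrow> x k \<in> carrier_vec (nx p)"
begin

lemma stack_carrier: "stack p u x \<in> carrier_vec (stack_dim p)"
  using foldr_stack_index(1)[of "[0..<hor p]" "\<lambda>k. u k @\<^sub>v x k" "nu p + nx p" "x (hor p)" "nx p"] u x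
  unfolding stack_def stack_dim_def by auto

lemma stack_index:
  "k < hor p \<Longrightarrow> i < nu p + nx p \<Longrightarrow> stack p u x $ (k * (nu p + nx p) + i) = (u k @\<^sub>v x k) $ i"
  "i < nx p \<Longrightarrow> stack p u x $ (hor p * (nu p + nx p) + i) = x (hor p) $ i"
  using foldr_stack_index(2,3)[of "[0..<hor p]" "\<lambda>k. u k @\<^sub>v x k" "nu p + nx p" "x (hor p)" "nx p"] u x
  unfolding stack_def by auto

lemma sel_mult:
  fixes z :: "real vec"
  assumes "z \<in> carrier_vec N" "\<And>i. i < n \<Longrightarrow> a + i < N"
  shows "mat n N (\<lambda>(i, j). if j = a + i then 1 else 0) *\<^sub>v z = vec n (\<lambda>i. z $ (a + i))"
proof (rule eq_vecI)
  fix i assume i: "i < dim_vec (vec n (\<lambda>i. z $ (a + i)))"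
  have "(\<Sum>j = 0..<N. (if j = a + i then 1 else 0) * z $ j) = (\<Sum>j = 0..<N. if j = a + i then z $ j else 0)"
    by (intro sum.cong) auto
  also have "\<dots> = z $ (a + i)" using assms(2) i by (simp add: sum.delta)
  finally show "(mat n N (\<lambda>(i, j). if j = a + i then 1 else 0) *\<^sub>v z) $ i = vec n (\<lambda>i. z $ (a + i)) $ i"
    using i assms by (simp add: scalar_prod_def)
qed auto

lemma pos_bound: "k < hor p \<Longrightarrow> i < nu p + nx p \<Longrightarrow> k * (nu p + nx p) + i < stack_dim p"
proof -
  assume k: "k < hor p" and i: "i < nu p + nx p"
  have "Suc k * (nu p + nx p) \<le> hor p * (nu p + nx p)" using k by (intro mult_le_mono1) auto
  then show ?thesis using i unfolding stack_dim_def by simp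
qed

lemma u_sel_stack: assumes k: "k < hor p" shows "u_sel p k *\<^sub>v stack p u x = u k"
proof -
  have "u_sel p k *\<^sub>v stack p u x = vec (nu p) (\<lambda>i. stack p u x $ (u_pos p k + i))"
    unfolding u_sel_def
    by (rule sel_mult[OF stack_carrier]) (use pos_bound[OF k] in \<open>auto simp: u_pos_def\<close>)
  also have "\<dots> = u k"
    using stack_index(1)[OF k] u[OF k] x[of k] k by (intro eq_vecI) (auto simp: u_pos_def)
  finally show ?thesis .
qed

lemma x_sel_stack: assumes k: "k \<le> hor p" shows "x_sel p k *\<^sub>v stack p u x = x k"
proof -
  have "x_sel p k *\<^sub>v stack p u x = vec (nx p) (\<lambda>i. stack p u x $ (x_pos p k + i))"
    unfolding x_sel_def
    by (rule sel_mult[OF stack_carrier])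
      (use pos_bound[of k "nu p + _"] in \<open>auto simp: x_pos_def stack_dim_def add.assoc split: if_splits\<close>)
  also have "\<dots> = x k"
  proof (cases "k < hor p")
    case True
    then show ?thesis using stack_index(1)[OF True, of "nu p + _"] u[OF True] x[of k]
      by (intro eq_vecI) (auto simp: x_pos_def add.assoc)
  next
    case False
    then have "k = hor p" using k by simp
    then show ?thesis using stack_index(2) x[of k] by (intro eq_vecI) (auto simp: x_pos_def)
  qed
  finally show ?thesis .
qed

lemma sel_carrier: "u_sel p k \<in> carrier_mat (nu p) (stack_dim p)"
  "x_sel p k \<in> carrier_mat (nx p) (stack_dim p)"
  by (auto simp: u_sel_def x_sel_def)

lemma rows_carrier:
  assumes k: "k < hor p"
  shows "dynamics_rows p k \<in> carrier_mat (nx p) (stack_dim p)"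
    "path_rows p k \<in> carrier_mat (dim_vec (gv p k)) (stack_dim p)"
proof -
  have c: "Bm p k \<in> carrier_mat (nx p) (nu p)" "Am p k \<in> carrier_mat (nx p) (nx p)"
    "Gu p k \<in> carrier_mat (dim_vec (gv p k)) (nu p)" "Gx p k \<in> carrier_mat (dim_vec (gv p k)) (nx p)"
    using p k unfolding lq_problem_def by auto
  show "dynamics_rows p k \<in> carrier_mat (nx p) (stack_dim p)"
    unfolding dynamics_rows_def
    by (intro minus_carrier_mat add_carrier_mat mult_carrier_mat[OF c(2) sel_carrier(2)])
  show "path_rows p k \<in> carrier_mat (dim_vec (gv p k)) (stack_dim p)"
    unfolding path_rows_def
    by (intro add_carrier_mat mult_carrier_mat[OF c(4) sel_carrier(2)])
qed

lemma dynamics_rows_stack: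
  assumes k: "k < hor p"
  shows "dynamics_rows p k *\<^sub>v stack p u x = bv p k \<longleftrightarrow>
     x (Suc k) = Bm p k *\<^sub>v u k + Am p k *\<^sub>v x k + bv p k"
proof -
  let ?z = "stack p u x" 
  have c: "Bm p k \<in> carrier_mat (nx p) (nu p)" "Am p k \<in> carrier_mat (nx p) (nx p)"
     "bv p k \<in> carrier_vec (nx p)" using p k unfolding lq_problem_def by auto
  note P = mult_carrier_mat[OF c(1) sel_carrier(1)] mult_carrier_mat[OF c(2) sel_carrier(2)]
  have "dynamics_rows p k *\<^sub>v ?z = x (Suc k) - (Bm p k *\<^sub>v u k + Am p k *\<^sub>v x k)"
    unfolding dynamics_rows_def
    using minus_mult_distrib_mat_vec[OF sel_carrier(2) add_carrier_mat[OF P(2)] stack_carrier]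
      add_mult_distrib_mat_vec[OF P stack_carrier]
      assoc_mult_mat_vec[OF c(1) sel_carrier(1) stack_carrier]
      assoc_mult_mat_vec[OF c(2) sel_carrier(2) stack_carrier] k
    by (simp add: u_sel_stack x_sel_stack)
  moreover have "x (Suc k) \<in> carrier_vec (nx p)" "x k \<in> carrier_vec (nx p)" "u k \<in> carrier_vec (nu p)"
    using x u k by auto
  ultimately show ?thesis using c
    by (auto simp: vec_eq_iff algebra_simps)
qed

lemma path_rows_stack:
  assumes k: "k < hor p"
  shows "path_rows p k *\<^sub>v stack p u x = Gu p k *\<^sub>v u k + Gx p k *\<^sub>v x k"
proof -
  have c: "Gu p k \<in> carrier_mat (dim_vec (gv p k)) (nu p)" "Gx p k \<in> carrier_mat (dim_vec (gv p k)) (nx p)"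
    using p k unfolding lq_problem_def by auto
  show ?thesis
    unfolding path_rows_def
    using add_mult_distrib_mat_vec[OF mult_carrier_mat[OF c(1) sel_carrier(1)]
        mult_carrier_mat[OF c(2) sel_carrier(2)] stack_carrier]
      assoc_mult_mat_vec[OF c(1) sel_carrier(1) stack_carrier]
      assoc_mult_mat_vec[OF c(2) sel_carrier(2) stack_carrier] k
    by (simp add: u_sel_stack x_sel_stack)
qed

lemma lq_feasible_iff:
  "lq_feasible p u x \<longleftrightarrow> constraint_mat p *\<^sub>v stack p u x = constraint_rhs p"
proof -
  let ?z = "stack p u x"
  have GT: "GT p \<in> carrier_mat (dim_vec (gT p)) (nx p)" using p by (simp add: lq_problem_def)
  define m where "m ks = sum_list (map (\<lambda>k. nx p + dim_vec (gv p k)) ks) + dim_vec (gT p)" for ks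
  let ?A = "\<lambda>ks. foldr (\<lambda>k M. dynamics_rows p k @\<^sub>r path_rows p k @\<^sub>r M) ks (GT p * x_sel p (hor p))"
  let ?b = "\<lambda>ks. foldr (\<lambda>k v. bv p k @\<^sub>v - gv p k @\<^sub>v v) ks (- gT p)"
  have "?A ks \<in> carrier_mat (m ks) (stack_dim p) \<and> 
     (?A ks *\<^sub>v ?z = ?b ks \<longleftrightarrow> (\<forall>k \<in> set ks. x (Suc k) = Bm p k *\<^sub>v u k + Am p k *\<^sub>v x k + bv p k \<and>
        Gu p k *\<^sub>v u k + Gx p k *\<^sub>v x k = - gv p k) \<and> GT p *\<^sub>v x (hor p) = - gT p)"
    if "set ks \<subseteq> {..<hor p}" for ks using that
  proof (induction ks)
    case Nil
    then show ?case using GT sel_carrier(2)[of "hor p"]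
      by (auto simp: m_def assoc_mult_mat_vec[OF GT sel_carrier(2) stack_carrier] x_sel_stack)
  next
    case (Cons k ks)
    then have k: "k < hor p" and IH: "?A ks \<in> carrier_mat (m ks) (stack_dim p)"
      "?A ks *\<^sub>v ?z = ?b ks \<longleftrightarrow> (\<forall>k \<in> set ks. x (Suc k) = Bm p k *\<^sub>v u k + Am p k *\<^sub>v x k + bv p k \<and>
        Gu p k *\<^sub>v u k + Gx p k *\<^sub>v x k = - gv p k) \<and> GT p *\<^sub>v x (hor p) = - gT p" by auto
    note D = rows_carrier[OF k]
    have b: "bv p k \<in> carrier_vec (nx p)" using p k by (simp add: lq_problem_def)
    have c: "path_rows p k @\<^sub>r ?A ks \<in> carrier_mat (dim_vec (gv p k) + m ks) (stack_dim p)"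
      using D IH(1) by auto
    have A: "?A (k # ks) *\<^sub>v ?z = dynamics_rows p k *\<^sub>v ?z @\<^sub>v path_rows p k *\<^sub>v ?z @\<^sub>v ?A ks *\<^sub>v ?z"
      using mat_mult_append[OF D(1) c stack_carrier] mat_mult_append[OF D(2) IH(1) stack_carrier] by simp
    have "?A (k # ks) *\<^sub>v ?z = ?b (k # ks) \<longleftrightarrow> dynamics_rows p k *\<^sub>v ?z = bv p k \<and>
        path_rows p k *\<^sub>v ?z = - gv p k \<and> ?A ks *\<^sub>v ?z = ?b ks"
      unfolding A
      using append_vec_eq[of "dynamics_rows p k *\<^sub>v ?z" "nx p" "bv p k"]
        append_vec_eq[of "path_rows p k *\<^sub>v ?z" "dim_vec (gv p k)" "- gv p k"] D b
        mult_mat_vec_carrier[OF D(1) stack_carrier] mult_mat_vec_carrier[OF D(2) stack_carrier]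
      by simp
    then have eq: "?A (k # ks) *\<^sub>v ?z = ?b (k # ks) \<longleftrightarrow>
      (\<forall>k \<in> set (k # ks). x (Suc k) = Bm p k *\<^sub>v u k + Am p k *\<^sub>v x k + bv p k \<and>
        Gu p k *\<^sub>v u k + Gx p k *\<^sub>v x k = - gv p k) \<and> GT p *\<^sub>v x (hor p) = - gT p"
      by (simp only: IH(2) dynamics_rows_stack[OF k] path_rows_stack[OF k] list.set ball_simps(7) conj_assoc)
    have "?A (k # ks) \<in> carrier_mat (m (k # ks)) (stack_dim p)"
      using carrier_append_rows[OF D(1) c] by (simp add: m_def add.assoc)
    then show ?case using eq by (rule conjI)
  qed
  note step = this
  have s: "set [0..<hor p] = {..<hor p}" by auto
  show ?thesis
    unfolding lq_feasible_def constraint_mat_def constraint_rhs_def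
    using step[of "[0..<hor p]", unfolded s, OF subset_refl, THEN conjunct2]
    by (simp only: Ball_def lessThan_iff imp_conjR all_conj_distrib conj_assoc)
qed

lemma lq_objective_eq:
  "lq_objective p u x = 1/2 * (stack p u x \<bullet> (hessian_mat p *\<^sub>v stack p u x)) +
     (qv p (hor p) \<bullet> x (hor p) + (\<Sum>k < hor p. (rv p k @\<^sub>v qv p k) \<bullet> (u k @\<^sub>v x k)))"
proof -
  let ?n = "nu p + nx p"
  let ?w = "\<lambda>k. u k @\<^sub>v x k"
  let ?H = "\<lambda>ks. diag_block_mat (map (stage_hessian p) ks @ [Qm p (hor p)])"
  let ?z = "\<lambda>ks. foldr (\<lambda>k z. ?w k @\<^sub>v z) ks (x (hor p))"
  have Q: "Qm p (hor p) \<in> carrier_mat (nx p) (nx p)" using p by (simp add: lq_problem_def)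
  have "?H ks \<in> carrier_mat (length ks * ?n + nx p) (length ks * ?n + nx p) \<and>
    ?z ks \<in> carrier_vec (length ks * ?n + nx p) \<and>
    ?z ks \<bullet> (?H ks *\<^sub>v ?z ks) = sum_list (map (\<lambda>k. ?w k \<bullet> (stage_hessian p k *\<^sub>v ?w k)) ks) +
      x (hor p) \<bullet> (Qm p (hor p) *\<^sub>v x (hor p))"
    if "set ks \<subseteq> {..<hor p}" for ks using that
  proof (induction ks)
    case Nil
    have "four_block_mat (Qm p (hor p)) (0\<^sub>m (nx p) 0) (0\<^sub>m 0 (nx p)) (0\<^sub>m 0 0) = Qm p (hor p)"
      using Q by (intro eq_matI) auto
    then show ?case using Q x[of "hor p"] by simp
  next
    case (Cons k ks)
    let ?N = "length ks * ?n + nx p"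
    have k: "k < hor p" using Cons by auto
    have IH: "?H ks \<in> carrier_mat ?N ?N" "?z ks \<in> carrier_vec ?N"
      "?z ks \<bullet> (?H ks *\<^sub>v ?z ks) = sum_list (map (\<lambda>k. ?w k \<bullet> (stage_hessian p k *\<^sub>v ?w k)) ks) +
      x (hor p) \<bullet> (Qm p (hor p) *\<^sub>v x (hor p))" using Cons by auto
    have M: "stage_hessian p k \<in> carrier_mat ?n ?n"
      using p k unfolding stage_hessian_def lq_problem_def by auto
    have w: "?w k \<in> carrier_vec ?n" using u[OF k] x[of k] k by auto
    have HH: "?H (k # ks) = four_block_mat (stage_hessian p k) (0\<^sub>m ?n ?N) (0\<^sub>m ?N ?n) (?H ks)"
      using M IH(1) by (simp add: Let_def)
    have "?H (k # ks) *\<^sub>v ?z (k # ks) = (stage_hessian p k *\<^sub>v ?w k) @\<^sub>v (?H ks *\<^sub>v ?z ks)"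
      unfolding HH using mult_mat_vec_split[OF M IH(1) w IH(2)] by simp
    then have "?z (k # ks) \<bullet> (?H (k # ks) *\<^sub>v ?z (k # ks)) =
       ?w k \<bullet> (stage_hessian p k *\<^sub>v ?w k) + ?z ks \<bullet> (?H ks *\<^sub>v ?z ks)"
      using scalar_prod_append[OF w IH(2), of "stage_hessian p k *\<^sub>v ?w k" "?H ks *\<^sub>v ?z ks"] M IH w by simp
    moreover have "?H (k # ks) \<in> carrier_mat (?n + ?N) (?n + ?N)" unfolding HH using M IH(1) by simp
    moreover have "?z (k # ks) \<in> carrier_vec (?n + ?N)" using w IH(2) by simp
    ultimately show ?case using IH(3) by (simp add: add.assoc)
  qed
  from this[of "[0..<hor p]"]
  have "stack p u x \<bullet> (hessian_mat p *\<^sub>v stack p u x) =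
    (\<Sum>k<hor p. ?w k \<bullet> (stage_hessian p k *\<^sub>v ?w k)) + x (hor p) \<bullet> (Qm p (hor p) *\<^sub>v x (hor p))"
    unfolding stack_def hessian_mat_def
    by (simp add: interv_sum_list_conv_sum_set_nat lessThan_atLeast0 subset_iff)
  moreover have "lq_objective p u x = 1/2 * (x (hor p) \<bullet> (Qm p (hor p) *\<^sub>v x (hor p))) +
      qv p (hor p) \<bullet> x (hor p) + (1/2 * (\<Sum>k<hor p. ?w k \<bullet> (stage_hessian p k *\<^sub>v ?w k)) +
        (\<Sum>k<hor p. (rv p k @\<^sub>v qv p k) \<bullet> ?w k))"
    unfolding lq_objective_def sum.distrib sum_distrib_left ..
  ultimately show ?thesis by argo
qed

end

section \<open>The backward substitution algorithm\<close>

text \<open>Apart from \<open>P\<close> and \<open>H\<close> (the final, updated \<open>H\<^sub>k\<close>), a run records exactly the factors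
  that the algorithm is free to choose; all other quantities are functions of these.\<close>

record lq_run =
  Pm :: "nat \<Rightarrow> real mat"
  Hm :: "nat \<Rightarrow> real mat"
  TL :: "nat \<Rightarrow> real mat"
  rho :: "nat \<Rightarrow> nat"
  Em :: "nat \<Rightarrow> real mat"
  TR :: "nat \<Rightarrow> real mat"
  Chol :: "nat \<Rightarrow> real mat"
  TIL :: "real mat"
  TIR :: "real mat"

definition R_bar :: "lq_data \<Rightarrow> lq_run \<Rightarrow> nat \<Rightarrow> real mat" where
  "R_bar p d k = Rm p k + (Bm p k)\<^sup>T * Pm d (Suc k) * Bm p k"

definition S_bar :: "lq_data \<Rightarrow> lq_run \<Rightarrow> nat \<Rightarrow> real mat" where
  "S_bar p d k = Sm p k + (Am p k)\<^sup>T * Pm d (Suc k) * Bm p k"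

definition Q_bar :: "lq_data \<Rightarrow> lq_run \<Rightarrow> nat \<Rightarrow> real mat" where
  "Q_bar p d k = Qm p k + (Am p k)\<^sup>T * Pm d (Suc k) * Am p k"

definition Gu_bar :: "lq_data \<Rightarrow> lq_run \<Rightarrow> nat \<Rightarrow> real mat" where
  "Gu_bar p d k = Gu p k @\<^sub>r (Hm d (Suc k) * Bm p k)"

definition Gx_bar :: "lq_data \<Rightarrow> lq_run \<Rightarrow> nat \<Rightarrow> real mat" where
  "Gx_bar p d k = Gx p k @\<^sub>r (Hm d (Suc k) * Am p k)"

definition R_tilde :: "lq_data \<Rightarrow> lq_run \<Rightarrow> nat \<Rightarrow> real mat" where
  "R_tilde p d k = (inv_mat (TR d k))\<^sup>T * R_bar p d k * inv_mat (TR d k)"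

definition S_tilde :: "lq_data \<Rightarrow> lq_run \<Rightarrow> nat \<Rightarrow> real mat" where
  "S_tilde p d k = S_bar p d k * inv_mat (TR d k)"

definition Gx_tilde :: "lq_data \<Rightarrow> lq_run \<Rightarrow> nat \<Rightarrow> real mat" where
  "Gx_tilde p d k = upper_rows (rho d k) (inv_mat (TL d k) * Gx_bar p d k)"

text \<open>\<open>H\<^sub>k\<close> as computed in the decomposition step, before its update.\<close>

definition H_tilde :: "lq_data \<Rightarrow> lq_run \<Rightarrow> nat \<Rightarrow> real mat" where
  "H_tilde p d k = lower_rows (rho d k) (inv_mat (TL d k) * Gx_bar p d k)"

definition W_mat :: "lq_data \<Rightarrow> lq_run \<Rightarrow> nat \<Rightarrow> real mat" where
  "W_mat p d k =
     four_block_mat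
       (0\<^sub>m (rho d k) (nu p - rho d k) @\<^sub>r 1\<^sub>m (nu p - rho d k))
       (Gx_tilde p d k @\<^sub>r 0\<^sub>m (nu p - rho d k) (nx p))
       (0\<^sub>m (nx p) (nu p - rho d k)) (1\<^sub>m (nx p))"

definition hat_mat :: "lq_data \<Rightarrow> lq_run \<Rightarrow> nat \<Rightarrow> real mat" where
  "hat_mat p d k =
     (W_mat p d k)\<^sup>T * four_block_mat (R_tilde p d k) (S_tilde p d k)\<^sup>T (S_tilde p d k) (Q_bar p d k) * W_mat p d k"

definition R_hat :: "lq_data \<Rightarrow> lq_run \<Rightarrow> nat \<Rightarrow> real mat" where
  "R_hat p d k = (case split_block (hat_mat p d k) (nu p - rho d k) (nu p - rho d k) of (M1, _, _, _) \<Rightarrow> M1)"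

definition S_hat :: "lq_data \<Rightarrow> lq_run \<Rightarrow> nat \<Rightarrow> real mat" where
  "S_hat p d k = (case split_block (hat_mat p d k) (nu p - rho d k) (nu p - rho d k) of (_, _, M3, _) \<Rightarrow> M3)"

definition Q_hat :: "lq_data \<Rightarrow> lq_run \<Rightarrow> nat \<Rightarrow> real mat" where
  "Q_hat p d k = (case split_block (hat_mat p d k) (nu p - rho d k) (nu p - rho d k) of (_, _, _, M4) \<Rightarrow> M4)"

definition L_mat :: "lq_data \<Rightarrow> lq_run \<Rightarrow> nat \<Rightarrow> real mat" where
  "L_mat p d k = inv_mat (Chol d k) * (S_hat p d k)\<^sup>T"

definition Z_mat :: "lq_data \<Rightarrow> lq_run \<Rightarrow> nat \<Rightarrow> real mat" where
  "Z_mat p d k = inv_mat (Chol d k) * (Em d k)\<^sup>T"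

definition P_hat_I :: "lq_run \<Rightarrow> real mat" where
  "P_hat_I d =
     (let \<rho> = vec_space.rank (dim_row (Hm d 0)) (Hm d 0)
      in case split_block ((inv_mat (TIR d))\<^sup>T * Pm d 0 * inv_mat (TIR d)) \<rho> \<rho> of (_, _, _, M4) \<Rightarrow> M4)"

definition stage_reached :: "lq_data \<Rightarrow> lq_run \<Rightarrow> nat \<Rightarrow> bool" where
  "stage_reached p d k \<longleftrightarrow> (\<forall>j. k < j \<and> j < hor p \<longrightarrow> pos_def_mat (R_hat p d j))"

text \<open>Nothing is required of the components of a run that belong to stages after the stop; there
  they are arbitrary. The matrix \<open>- E\<^sub>k R\<^sub>k\<^sup>-\<^sup>1 E\<^sub>k\<^sup>T\<close> (with the reduced \<open>R\<^sub>k\<close>) is neglected.\<close>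

definition algorithm_run :: "lq_data \<Rightarrow> real \<Rightarrow> lq_run \<Rightarrow> bool" where
  "algorithm_run p \<epsilon> d \<longleftrightarrow>
     Pm d (hor p) = Qm p (hor p) \<and> Hm d (hor p) = GT p \<and>
     (\<forall>k < hor p. stage_reached p d k \<longrightarrow>
        thresholded_decomposition \<epsilon> (Gu_bar p d k) (TL d k) (rho d k) (Em d k) (TR d k) \<and>
        (pos_def_mat (R_hat p d k) \<longrightarrow>
           cholesky_factor (Chol d k) (R_hat p d k) \<and>
           Pm d k = Q_hat p d k - (L_mat p d k)\<^sup>T * L_mat p d k \<and>
           Hm d k = H_tilde p d k - (Z_mat p d k)\<^sup>T * L_mat p d k)) \<and>
     ((\<forall>k < hor p. pos_def_mat (R_hat p d k)) \<longrightarrow>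
        exact_decomposition (Hm d 0) (TIL d) (TIR d))"

definition exact_factors :: "lq_data \<Rightarrow> lq_run \<Rightarrow> bool" where
  "exact_factors p d \<longleftrightarrow> (\<forall>k < hor p. stage_reached p d k \<longrightarrow>
     Em d k = 0\<^sub>m (dim_row (Em d k)) (dim_col (Em d k)))"

text \<open>A threshold on the entries of \<open>E\<^sub>k\<close> is meaningful only relative to the scale of the other
  two factors and of the data. With arbitrarily large \<open>T\<^sub>L\<close> every matrix has a decomposition with
  \<open>\<rho> = 0\<close> and \<open>E\<close> below any given threshold, and because the algorithm neglects a term in \<open>E\<^sub>k\<close>,
  definiteness is then not decided correctly: for \<open>K = n\<^sub>x = n\<^sub>u = 1\<close>, \<open>R\<^sub>0 = -1\<close>, \<open>Q\<^sub>0 = Q\<^sub>1 = 1\<close>,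
  \<open>S\<^sub>0 = A\<^sub>0 = B\<^sub>0 = 0\<close> and the constraint \<open>u\<^sub>0 = 0\<close>, the reduced Hessian is positive definite, but
  retaining no pivot gives \<open>-1\<close> for the reduced \<open>R\<^sub>0\<close>. The same happens with an SVD and a constraint
  \<open>\<delta> u\<^sub>0 = 0\<close>, \<open>0 < \<delta> < \<epsilon>\<close>.\<close>

definition bounded_factors :: "lq_data \<Rightarrow> real \<Rightarrow> lq_run \<Rightarrow> bool" where
  "bounded_factors p c d \<longleftrightarrow> (\<forall>k < hor p. stage_reached p d k \<longrightarrow>
     entries_bounded c (TL d k) \<and> entries_bounded c (TR d k))"

end

theory Submission
  imports Defs
begin

text \<open>Positive definiteness of the reduced Hessian means that the quadratic part of the cost is positive
on every nonzero solution of the homogeneous constraints (\<open>reduced_hessian_pos_def_iff\<close>), that is, on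
every nonzero trajectory of the dynamics that satisfies the homogeneous path and terminal constraints.
With the offsets \<open>b\<close>, \<open>g\<close> and the linear costs removed, the backward recursion is dynamic programming
for this homogeneous problem.

Suppose first that all residual blocks \<open>E\<^sub>k\<close> vanish. In the coordinates \<open>T\<^sub>R u\<close> the constraints at
stage \<open>k\<close> determine the first \<open>\<rho>\<^sub>k\<close> components of the input from the state, require \<open>H\<^sub>k x = 0\<close>, and
leave the remaining components free (\<open>constraint_iff_lift\<close>). The hatted block matrix is the stage cost
plus the later value \<open>x\<^sub>k\<^sub>+\<^sub>1\<^sup>T P\<^sub>k\<^sub>+\<^sub>1 x\<^sub>k\<^sub>+\<^sub>1\<close>, written in the free components and the state
(\<open>lift_input_cost\<close>). If its block \<open>R\<close> is positive definite, completing the square with the Cholesky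
factor shows that \<open>x\<^sup>T P\<^sub>k x\<close> is the least cost of a feasible tail from \<open>x\<close>, that such tails exist exactly
for the states with \<open>H\<^sub>k x = 0\<close>, and that from the state zero only the zero trajectory has cost zero (\<open>value_function\<close>,
\<open>value_function_step\<close>). If the recursion reaches stage zero, positivity on all trajectories is therefore
positivity of \<open>P\<^sub>0\<close> on the kernel of \<open>H\<^sub>0\<close>, which is what the last block expresses
(\<open>P_hat_I_pos_def_iff\<close>). If instead the reduced \<open>R\<close> of some stage is not positive definite, rest at the
origin up to that stage, apply there an input along a direction on which it is nonpositive, and continue
optimally: this is a nonzero trajectory of nonpositive cost (\<open>not_pos_def_trajectory\<close>).

For thresholded factors of bounded size, a small enough threshold forces every residual block to be
zero, so that the exact case applies (\<open>small_threshold_exact\<close>). If \<open>M N M = M\<close> and \<open>M\<close> has the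
decomposition with factors \<open>T\<^sub>L\<close>, \<open>T\<^sub>R\<close> and residual \<open>E\<close>, then \<open>E = E Y E\<close> for a block \<open>Y\<close> of
\<open>T\<^sub>R N T\<^sub>L\<close>; a nonzero \<open>E\<close> of this kind cannot be small compared with the inverse of the size of \<open>Y\<close>
(\<open>small_residual_vanishes\<close>). What has to be controlled is the size of a generalized inverse \<open>N\<close> of the
constraint matrix of a stage, uniformly over all runs, although that matrix depends on the factors chosen
at later stages, and their inverses may be arbitrarily large. The remaining constraints \<open>H\<^sub>k\<close> of two exact
runs differ by a left factor, and the factor that recovers a fixed reference run from an arbitrary run is
bounded, because it involves \<open>T\<^sub>L\<close> of the arbitrary run and not its inverse (\<open>H_transfer_step\<close>,
\<open>uniform_H_transfer\<close>). A generalized inverse for the reference run thus yields one of bounded size for every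
run (\<open>uniform_generalized_inverse\<close>).\<close>

section \<open>Inverses, quadratic forms and stacked rows\<close>

lemma inv_mat_props:
  assumes A: "A \<in> carrier_mat n n" and inv: "invertible_mat A"
  shows "inv_mat A \<in> carrier_mat n n" "A * inv_mat A = 1\<^sub>m n" "inv_mat A * A = 1\<^sub>m n"
proof -
  obtain B where B: "A * B = 1\<^sub>m (dim_row A)" "B * A = 1\<^sub>m (dim_row B)"
    using inv unfolding invertible_mat_def inverts_mat_def by auto
  have "dim_col B = n" using arg_cong[OF B(1), of dim_col] A by simp
  moreover have "dim_row B = n" using arg_cong[OF B(2), of dim_col] A by simp
  ultimately have Bc: "B \<in> carrier_mat n n" by auto
  then have "A \<in> Units (ring_mat TYPE(real) n ())"
    using A B unfolding Units_def ring_mat_def by auto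
  then obtain C where "mat_inverse A = Some C" using mat_inverse(1)[OF A, of "()"] by (cases "mat_inverse A") auto
  with mat_inverse(2)[OF A this]
  show "inv_mat A \<in> carrier_mat n n" "A * inv_mat A = 1\<^sub>m n" "inv_mat A * A = 1\<^sub>m n" by auto
qed

lemma mult_mat_vec_inv_cancel:
  assumes "A \<in> carrier_mat n n" "B \<in> carrier_mat n n" "A * B = 1\<^sub>m n" "x \<in> carrier_vec n"
  shows "A *\<^sub>v (B *\<^sub>v x) = (x :: real vec)"
  using assms by (metis assoc_mult_mat_vec one_mult_mat_vec)

lemma zero_mult_mat_vec: "v \<in> carrier_vec n \<Longrightarrow> 0\<^sub>m m n *\<^sub>v v = (0\<^sub>v m :: real vec)"
  by (auto intro!: eq_vecI)

lemma mult_mat_zero_vec: "A \<in> carrier_mat m n \<Longrightarrow> A *\<^sub>v 0\<^sub>v n = (0\<^sub>v m :: real vec)"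
  by (auto intro!: eq_vecI)

definition quad :: "real mat \<Rightarrow> real vec \<Rightarrow> real" where
  "quad M v = v \<bullet> (M *\<^sub>v v)"

lemma scalar_prod_mult_mat_vec:
  fixes A :: "real mat"
  assumes "A \<in> carrier_mat nr nc" "x \<in> carrier_vec nc" "y \<in> carrier_vec nr"
  shows "(A *\<^sub>v x) \<bullet> y = x \<bullet> (A\<^sup>T *\<^sub>v y)"
  by (metis assms comm_scalar_prod mult_mat_vec_carrier transpose_carrier_mat transpose_vec_mult_scalar)

lemma quad_congruence:
  assumes M: "M \<in> carrier_mat n n" and W: "W \<in> carrier_mat n m" and v: "v \<in> carrier_vec m"
  shows "quad (W\<^sup>T * M * W) v = quad M (W *\<^sub>v v)"
proof -
  have "(W\<^sup>T * M * W) *\<^sub>v v = W\<^sup>T *\<^sub>v (M *\<^sub>v (W *\<^sub>v v))"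
    using assoc_mult_mat_vec[of "W\<^sup>T * M" m n W m v] assoc_mult_mat_vec[of "W\<^sup>T" m n M n "W *\<^sub>v v"] M W v
    by simp
  then show ?thesis unfolding quad_def
    using scalar_prod_mult_mat_vec[OF W v, of "M *\<^sub>v (W *\<^sub>v v)"] M W v by simp
qed

lemma quad_zero: "M \<in> carrier_mat n n \<Longrightarrow> quad M (0\<^sub>v n) = 0"
  unfolding quad_def by (simp add: mult_mat_zero_vec)

lemma quad_add:
  assumes M: "M \<in> carrier_mat n n" "M\<^sup>T = M" and a: "a \<in> carrier_vec n" and b: "b \<in> carrier_vec n"
  shows "quad M (a + b) = quad M a + 2 * (b \<bullet> (M *\<^sub>v a)) + quad M b"
proof -
  have "a \<bullet> (M *\<^sub>v b) = b \<bullet> (M *\<^sub>v a)"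
    using scalar_prod_mult_mat_vec[OF M(1) a b] M a b comm_scalar_prod[of b n "M *\<^sub>v a"] by auto
  then show ?thesis unfolding quad_def using M a b
    by (simp add: mult_add_distrib_mat_vec[of _ n n] scalar_prod_add_distrib[of _ n] add_scalar_prod_distrib[of _ n])
qed

lemma quad_add_mat:
  assumes "M \<in> carrier_mat n n" "N \<in> carrier_mat n n" "v \<in> carrier_vec n"
  shows "quad (M + N) v = quad M v + quad N v"
  using assms unfolding quad_def by (simp add: add_mult_distrib_mat_vec[of _ n n] scalar_prod_add_distrib[of _ n])

lemma quad_minus_mat:
  assumes "M \<in> carrier_mat n n" "N \<in> carrier_mat n n" "v \<in> carrier_vec n"
  shows "quad (M - N) v = quad M v - quad N v"
  using assms unfolding quad_def by (simp add: minus_mult_distrib_mat_vec[of _ n n] scalar_prod_minus_distrib[of _ n])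

lemma quad_four_block:
  assumes A: "A \<in> carrier_mat n n" and C: "C \<in> carrier_mat m n" and D: "D \<in> carrier_mat m m"
    and a: "a \<in> carrier_vec n" and d: "d \<in> carrier_vec m"
  shows "quad (four_block_mat A C\<^sup>T C D) (a @\<^sub>v d) = quad A a + 2 * (d \<bullet> (C *\<^sub>v a)) + quad D d"
proof -
  have Ct: "C\<^sup>T \<in> carrier_mat n m" using C by simp
  have "a \<bullet> (C\<^sup>T *\<^sub>v d) = d \<bullet> (C *\<^sub>v a)"
    using scalar_prod_mult_mat_vec[OF C a d] C a d comm_scalar_prod[of d m "C *\<^sub>v a"] by simp
  then show ?thesis
    unfolding quad_def four_block_mat_mult_vec[OF A Ct C D a d]
    using A C D a d
    by (subst scalar_prod_append[of _ n _ m]) (auto simp: scalar_prod_add_distrib[of _ n] scalar_prod_add_distrib[of _ m])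
qed

lemma pos_def_mat_iff_quad:
  assumes "M \<in> carrier_mat n n" "M\<^sup>T = M"
  shows "pos_def_mat M \<longleftrightarrow> (\<forall>v \<in> carrier_vec n. v \<noteq> 0\<^sub>v n \<longrightarrow> quad M v > 0)"
  using assms unfolding pos_def_mat_def quad_def by auto

lemma transpose_congruence:
  assumes "M \<in> carrier_mat n n" "(M::real mat)\<^sup>T = M" "W \<in> carrier_mat n m"
  shows "(W\<^sup>T * M * W)\<^sup>T = W\<^sup>T * M * W"
  using assms by (simp add: transpose_mult[of _ m n] transpose_mult[of _ n n] transpose_mult[of _ m n _ m] assoc_mult_mat[of _ m n _ n _ m])

lemma upper_lower_rows_mult_vec:
  assumes M: "M \<in> carrier_mat m n" and r: "r \<le> m" and x: "x \<in> carrier_vec n"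
  shows "M *\<^sub>v x = (upper_rows r M *\<^sub>v x) @\<^sub>v (lower_rows r M *\<^sub>v x)"
  using assms by (intro eq_vecI) (auto simp: upper_rows_def lower_rows_def scalar_prod_def)

lemma upper_lower_rows_carrier:
  assumes "M \<in> carrier_mat m n"
  shows "upper_rows r M \<in> carrier_mat r n" "lower_rows r M \<in> carrier_mat (m - r) n"
  using assms by (auto simp: upper_rows_def lower_rows_def)

lemma append_vec_eq_zero_iff:
  assumes "a \<in> carrier_vec n" "b \<in> carrier_vec m"
  shows "a @\<^sub>v b = 0\<^sub>v (n + m) \<longleftrightarrow> a = 0\<^sub>v n \<and> b = (0\<^sub>v m :: real vec)"
proof -
  have "0\<^sub>v (n + m) = 0\<^sub>v n @\<^sub>v (0\<^sub>v m :: real vec)" by (intro eq_vecI) auto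
  then show ?thesis using append_vec_eq[OF assms(1) zero_carrier_vec[of n]] by simp
qed

lemma scalar_prod_self_nonneg: "(v :: real vec) \<bullet> v \<ge> 0"
  unfolding scalar_prod_def by (simp add: sum_nonneg)

text \<open>After multiplication by \<open>T\<^sub>1\<^sup>-\<^sup>1\<close> the upper rows of the system read \<open>- y\<^sub>1 + (upper part) = 0\<close>, where \<open>y\<^sub>1\<close>
is the leading part of \<open>T\<^sub>2 u\<close>, and the lower rows no longer contain \<open>u\<close> because the residual block is
zero.\<close>

lemma decomposition_constraint_iff:
  assumes M: "M \<in> carrier_mat m n" and N: "N \<in> carrier_mat m k"
    and dec: "decomposition M T1 \<rho> E T2" and E: "E = 0\<^sub>m (m - \<rho>) (n - \<rho>)"
    and u: "u \<in> carrier_vec n" and x: "x \<in> carrier_vec k"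
  shows "M *\<^sub>v u + N *\<^sub>v x = 0\<^sub>v m \<longleftrightarrow>
    lower_rows \<rho> (inv_mat T1 * N) *\<^sub>v x = 0\<^sub>v (m - \<rho>) \<and>
    (\<exists>v \<in> carrier_vec (n - \<rho>). u = inv_mat T2 *\<^sub>v ((upper_rows \<rho> (inv_mat T1 * N) *\<^sub>v x) @\<^sub>v v))"
    (is "?L \<longleftrightarrow> ?R1 \<and> ?R2")
proof -
  let ?D = "four_block_mat (- 1\<^sub>m \<rho>) (0\<^sub>m \<rho> (n - \<rho>)) (0\<^sub>m (m - \<rho>) \<rho>) E"
  let ?l = "lower_rows \<rho> (inv_mat T1 * N) *\<^sub>v x" and ?u = "upper_rows \<rho> (inv_mat T1 * N) *\<^sub>v x"
  from dec M have T1: "T1 \<in> carrier_mat m m" "invertible_mat T1"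
    and T2: "T2 \<in> carrier_mat n n" "invertible_mat T2" and \<rho>: "\<rho> \<le> m" "\<rho> \<le> n"
    and Meq: "M = T1 * ?D * T2" unfolding decomposition_def by auto
  note L = inv_mat_props[OF T1] and R = inv_mat_props[OF T2]
  have D: "?D \<in> carrier_mat m n" using four_block_carrier_mat[of "- 1\<^sub>m \<rho>" \<rho> \<rho> E "m-\<rho>" "n-\<rho>"] E \<rho> by simp
  define y where "y = T2 *\<^sub>v u"
  have y: "y \<in> carrier_vec n" using T2 u by (simp add: y_def)
  have uy: "u = inv_mat T2 *\<^sub>v y" unfolding y_def using mult_mat_vec_inv_cancel[OF R(1) T2(1) R(3) u] by simp
  define y1 where "y1 = vec_first y \<rho>"
  define y2 where "y2 = vec_last y (n - \<rho>)"
  have yc: "y1 \<in> carrier_vec \<rho>" "y2 \<in> carrier_vec (n - \<rho>)" "y = y1 @\<^sub>v y2"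
    using vec_first_last_append[of y \<rho> "n - \<rho>"] y \<rho> unfolding y1_def y2_def by auto
  have Dy: "?D *\<^sub>v y = (- y1) @\<^sub>v 0\<^sub>v (m - \<rho>)"
    unfolding yc(3) using yc E
    by (subst four_block_mat_mult_vec[of _ \<rho> \<rho> _ "n - \<rho>" _ "m - \<rho>"]) (auto simp: uminus_mult_mat_vec)
  have NL: "inv_mat T1 * N \<in> carrier_mat m k" using L N by simp
  note ulc = upper_lower_rows_carrier[OF NL, of \<rho>]
  have uc: "?u \<in> carrier_vec \<rho>" and lc: "?l \<in> carrier_vec (m - \<rho>)" using ulc x by auto
  have Nx: "inv_mat T1 *\<^sub>v (N *\<^sub>v x) = ?u @\<^sub>v ?l"
    using upper_lower_rows_mult_vec[OF NL \<rho>(1) x] L N x by simp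
  have DR: "?D * T2 \<in> carrier_mat m n" using D T2 by simp
  have "M *\<^sub>v u = T1 *\<^sub>v (?D *\<^sub>v y)"
    unfolding Meq y_def using T1(1) D T2(1) u by (simp add: assoc_mult_mat_vec[of _ m n] assoc_mult_mat_vec[of _ m m _ n])
  then have iM: "inv_mat T1 *\<^sub>v (M *\<^sub>v u) = ?D *\<^sub>v y"
    using mult_mat_vec_inv_cancel[OF L(1) T1(1) L(3), of "?D *\<^sub>v y"] D y by simp
  have Mu: "M *\<^sub>v u \<in> carrier_vec m" and Nxc: "N *\<^sub>v x \<in> carrier_vec m" using M u N x by auto
  have "?L \<longleftrightarrow> inv_mat T1 *\<^sub>v (M *\<^sub>v u + N *\<^sub>v x) = 0\<^sub>v m"
  proof
    assume "inv_mat T1 *\<^sub>v (M *\<^sub>v u + N *\<^sub>v x) = 0\<^sub>v m"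
    then have "T1 *\<^sub>v (inv_mat T1 *\<^sub>v (M *\<^sub>v u + N *\<^sub>v x)) = 0\<^sub>v m" using T1 by (auto intro!: eq_vecI)
    then show ?L using mult_mat_vec_inv_cancel[OF T1(1) L(1) L(2), of "M *\<^sub>v u + N *\<^sub>v x"] Mu Nxc by simp
  qed (use L in \<open>auto intro!: eq_vecI\<close>)
  also have "inv_mat T1 *\<^sub>v (M *\<^sub>v u + N *\<^sub>v x) = (- y1 + ?u) @\<^sub>v (0\<^sub>v (m - \<rho>) + ?l)"
    using mult_add_distrib_mat_vec[OF L(1) Mu Nxc] iM Dy Nx append_vec_add[of "- y1" \<rho> ?u "0\<^sub>v (m - \<rho>)" "m - \<rho>" ?l] uc lc yc by simp
  also have "\<dots> = 0\<^sub>v m \<longleftrightarrow> - y1 + ?u = 0\<^sub>v \<rho> \<and> ?l = 0\<^sub>v (m - \<rho>)"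
    using append_vec_eq_zero_iff[of "- y1 + ?u" \<rho> "0\<^sub>v (m - \<rho>) + ?l" "m - \<rho>"] uc lc yc \<rho> by simp
  also have "- y1 + ?u = 0\<^sub>v \<rho> \<longleftrightarrow> y1 = ?u"
    using yc(1) uc by (auto simp: vec_eq_iff)
  also have "y1 = ?u \<longleftrightarrow> ?R2"
  proof
    assume "y1 = ?u" then show ?R2 using uy yc by auto
  next
    assume ?R2
    then obtain v where v: "v \<in> carrier_vec (n - \<rho>)" "u = inv_mat T2 *\<^sub>v (?u @\<^sub>v v)" by auto
    have "?u @\<^sub>v v \<in> carrier_vec n" using append_carrier_vec[OF uc v(1)] \<rho> by simp
    then have "y = ?u @\<^sub>v v" unfolding y_def v(2) using mult_mat_vec_inv_cancel[OF T2(1) R(1) R(2)] by simp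
    then show "y1 = ?u" using yc append_vec_eq[OF yc(1) uc] by simp
  qed
  finally show ?thesis by auto
qed

section \<open>One stage of the elimination\<close>

lemma cholesky_factor_inverse:
  assumes M: "M \<in> carrier_mat n n" "pos_def_mat M" and chol: "cholesky_factor \<Lambda> M"
  shows "\<Lambda> \<in> carrier_mat n n" "inv_mat \<Lambda> \<in> carrier_mat n n"
    "\<Lambda> * inv_mat \<Lambda> = 1\<^sub>m n" "inv_mat \<Lambda> * \<Lambda> = 1\<^sub>m n" "M = \<Lambda> * \<Lambda>\<^sup>T"
proof -
  show L: "\<Lambda> \<in> carrier_mat n n" and eq: "M = \<Lambda> * \<Lambda>\<^sup>T"
    using chol M unfolding cholesky_factor_def by auto
  have "det (\<Lambda>\<^sup>T) \<noteq> 0"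
  proof
    assume "det (\<Lambda>\<^sup>T) = 0"
    then obtain v where v: "v \<in> carrier_vec n" "v \<noteq> 0\<^sub>v n" "\<Lambda>\<^sup>T *\<^sub>v v = 0\<^sub>v n"
      using det_0_iff_vec_prod_zero[of "\<Lambda>\<^sup>T" n] L by auto
    have "M *\<^sub>v v = \<Lambda> *\<^sub>v (\<Lambda>\<^sup>T *\<^sub>v v)" unfolding eq using L v by (simp add: assoc_mult_mat_vec[of _ n n _ n])
    also have "\<dots> = 0\<^sub>v n" unfolding v(3) using L by (auto intro!: eq_vecI)
    finally have "v \<bullet> (M *\<^sub>v v) = 0" using v by simp
    moreover have "v \<bullet> (M *\<^sub>v v) > 0" using M v unfolding pos_def_mat_def by auto
    ultimately show False by simp
  qed
  then have "det \<Lambda> \<noteq> 0" using det_transpose[OF L] by simp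
  then have "\<Lambda> \<in> Units (ring_mat TYPE(real) n ())" using det_non_zero_imp_unit[OF L, of "()"] by simp
  then have "invertible_mat \<Lambda>"
    using L unfolding Units_def ring_mat_def invertible_mat_def inverts_mat_def by auto
  from inv_mat_props[OF L this] show "inv_mat \<Lambda> \<in> carrier_mat n n"
    "\<Lambda> * inv_mat \<Lambda> = 1\<^sub>m n" "inv_mat \<Lambda> * \<Lambda> = 1\<^sub>m n" by auto
qed

lemma split_block_symmetric:
  assumes M: "M \<in> carrier_mat (a + b) (a + b)" "M\<^sup>T = M"
    and s: "split_block M a a = (M1, M2, M3, M4)"
  shows "M1 \<in> carrier_mat a a" "M3 \<in> carrier_mat b a" "M4 \<in> carrier_mat b b"
    "M1\<^sup>T = M1" "M4\<^sup>T = M4" "M = four_block_mat M1 M3\<^sup>T M3 M4"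
proof -
  note sb = split_block[OF s, of b b]
  have d: "dim_row M = a + b" "dim_col M = a + b" using M by auto
  show c: "M1 \<in> carrier_mat a a" "M3 \<in> carrier_mat b a" "M4 \<in> carrier_mat b b" using sb d by auto
  have sym: "M $$ (i, j) = M $$ (j, i)" if "i < a + b" "j < a + b" for i j
    using arg_cong[OF M(2), of "\<lambda>A. A $$ (i, j)"] that d by simp
  have "M1 = mat a a (\<lambda>ij. M $$ ij)" "M2 = mat a b (\<lambda>(i,j). M $$ (i, j + a))"
    "M3 = mat b a (\<lambda>(i,j). M $$ (i + a, j))" "M4 = mat b b (\<lambda>(i,j). M $$ (i + a, j + a))"
    using s d unfolding split_block_def Let_def by auto
  note M_defs = this
  show "M1\<^sup>T = M1" "M4\<^sup>T = M4"
    unfolding M_defs by (rule eq_matI; simp add: sym)+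
  have "M2 = M3\<^sup>T" unfolding M_defs by (rule eq_matI; simp add: sym)
  then show "M = four_block_mat M1 M3\<^sup>T M3 M4" using sb(5)[OF d] by simp
qed

definition stage_cost :: "lq_data \<Rightarrow> nat \<Rightarrow> real vec \<Rightarrow> real vec \<Rightarrow> real" where
  "stage_cost p k u x = quad (stage_hessian p k) (u @\<^sub>v x)"

text \<open>The input with prescribed free components \<open>v\<close>: in the coordinates \<open>T\<^sub>R u\<close> the leading components are
dictated by the state through the retained pivots.\<close>

definition lift_input :: "lq_data \<Rightarrow> lq_run \<Rightarrow> nat \<Rightarrow> real vec \<Rightarrow> real vec \<Rightarrow> real vec" where
  "lift_input p d k v x = inv_mat (TR d k) *\<^sub>v ((Gx_tilde p d k *\<^sub>v x) @\<^sub>v v)"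

text \<open>A stage that the recursion reaches. Positive definiteness of the reduced \<open>R\<close> belongs to
\<open>completed_stage\<close> below, since the cost identity and the constraint elimination are also used at the stage
where the Cholesky factorization fails.\<close>

locale stage =
  fixes p :: lq_data and d :: lq_run and k :: nat
  assumes prob: "lq_problem p" and k: "k < hor p"
    and P: "Pm d (Suc k) \<in> carrier_mat (nx p) (nx p)" "(Pm d (Suc k))\<^sup>T = Pm d (Suc k)"
    and H: "dim_col (Hm d (Suc k)) = nx p"
    and dec: "decomposition (Gu_bar p d k) (TL d k) (rho d k) (Em d k) (TR d k)"
begin

abbreviation (input) "n \<equiv> nx p"
abbreviation (input) "m \<equiv> nu p"
abbreviation (input) "q \<equiv> nu p - rho d k"
abbreviation (input) "\<gamma> \<equiv> dim_vec (gv p k) + dim_row (Hm d (Suc k))"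
abbreviation (input) "A \<equiv> Am p k"
abbreviation (input) "B \<equiv> Bm p k"
abbreviation (input) "P' \<equiv> Pm d (Suc k)"
abbreviation (input) "H' \<equiv> Hm d (Suc k)"
abbreviation (input) "T \<equiv> inv_mat (TR d k)"

lemma data_carrier:
  "Rm p k \<in> carrier_mat m m" "(Rm p k)\<^sup>T = Rm p k" "Sm p k \<in> carrier_mat n m"
  "Qm p k \<in> carrier_mat n n" "(Qm p k)\<^sup>T = Qm p k" "A \<in> carrier_mat n n" "B \<in> carrier_mat n m"
  "Gu p k \<in> carrier_mat (dim_vec (gv p k)) m" "Gx p k \<in> carrier_mat (dim_vec (gv p k)) n"
  using prob k unfolding lq_problem_def by auto

lemma H'_carrier: "H' \<in> carrier_mat (dim_row H') n"
  using H by auto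

lemma bar_carrier:
  "R_bar p d k \<in> carrier_mat m m" "S_bar p d k \<in> carrier_mat n m" "Q_bar p d k \<in> carrier_mat n n"
  "Gu_bar p d k \<in> carrier_mat \<gamma> m" "Gx_bar p d k \<in> carrier_mat \<gamma> n"
proof -
  note D = data_carrier and t = transpose_carrier_mat[THEN iffD2]
  note AP = mult_carrier_mat[OF t[OF D(6)] P(1)] and BP = mult_carrier_mat[OF t[OF D(7)] P(1)]
  show "R_bar p d k \<in> carrier_mat m m" "S_bar p d k \<in> carrier_mat n m" "Q_bar p d k \<in> carrier_mat n n"
    unfolding R_bar_def S_bar_def Q_bar_def
    using mult_carrier_mat[OF BP D(7)] mult_carrier_mat[OF AP D(7)] mult_carrier_mat[OF AP D(6)]
    by (blast intro: add_carrier_mat)+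
  show "Gu_bar p d k \<in> carrier_mat \<gamma> m" "Gx_bar p d k \<in> carrier_mat \<gamma> n"
    unfolding Gu_bar_def Gx_bar_def
    using carrier_append_rows[OF D(8) mult_carrier_mat[OF H'_carrier D(7)]]
      carrier_append_rows[OF D(9) mult_carrier_mat[OF H'_carrier D(6)]] by blast+
qed

lemma bar_symmetric: "(R_bar p d k)\<^sup>T = R_bar p d k" "(Q_bar p d k)\<^sup>T = Q_bar p d k"
proof -
  have c: "B\<^sup>T * P' * B \<in> carrier_mat m m" "A\<^sup>T * P' * A \<in> carrier_mat n n"
    using data_carrier(6,7) P(1) by auto
  show "(R_bar p d k)\<^sup>T = R_bar p d k" unfolding R_bar_def
    using transpose_add[OF data_carrier(1) c(1)] transpose_congruence[OF P data_carrier(7)] data_carrier by simp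
  show "(Q_bar p d k)\<^sup>T = Q_bar p d k" unfolding Q_bar_def
    using transpose_add[OF data_carrier(4) c(2)] transpose_congruence[OF P data_carrier(6)] data_carrier by simp
qed

lemma factors:
  "TR d k \<in> carrier_mat m m" "T \<in> carrier_mat m m" "TR d k * T = 1\<^sub>m m" "T * TR d k = 1\<^sub>m m"
  "TL d k \<in> carrier_mat \<gamma> \<gamma>" "inv_mat (TL d k) \<in> carrier_mat \<gamma> \<gamma>"
  "inv_mat (TL d k) * TL d k = 1\<^sub>m \<gamma>" "TL d k * inv_mat (TL d k) = 1\<^sub>m \<gamma>"
  "rho d k \<le> m" "rho d k \<le> \<gamma>" "Em d k \<in> carrier_mat (\<gamma> - rho d k) q"
proof -
  from dec bar_carrier(4) have *: "TL d k \<in> carrier_mat \<gamma> \<gamma>" "invertible_mat (TL d k)"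
    "TR d k \<in> carrier_mat m m" "invertible_mat (TR d k)" "rho d k \<le> m" "rho d k \<le> \<gamma>"
    "Em d k \<in> carrier_mat (\<gamma> - rho d k) q"
    unfolding decomposition_def by auto
  show "TR d k \<in> carrier_mat m m" "T \<in> carrier_mat m m" "TR d k * T = 1\<^sub>m m" "T * TR d k = 1\<^sub>m m"
  "TL d k \<in> carrier_mat \<gamma> \<gamma>" "inv_mat (TL d k) \<in> carrier_mat \<gamma> \<gamma>"
  "inv_mat (TL d k) * TL d k = 1\<^sub>m \<gamma>" "TL d k * inv_mat (TL d k) = 1\<^sub>m \<gamma>"
  "rho d k \<le> m" "rho d k \<le> \<gamma>" "Em d k \<in> carrier_mat (\<gamma> - rho d k) q"
    using * inv_mat_props[OF *(1,2)] inv_mat_props[OF *(3,4)] by auto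
qed

lemma tilde_carrier:
  "R_tilde p d k \<in> carrier_mat m m" "(R_tilde p d k)\<^sup>T = R_tilde p d k" "S_tilde p d k \<in> carrier_mat n m"
  "Gx_tilde p d k \<in> carrier_mat (rho d k) n" "H_tilde p d k \<in> carrier_mat (\<gamma> - rho d k) n"
proof -
  show "R_tilde p d k \<in> carrier_mat m m" "S_tilde p d k \<in> carrier_mat n m"
    using bar_carrier factors unfolding R_tilde_def S_tilde_def by auto
  show "(R_tilde p d k)\<^sup>T = R_tilde p d k"
    unfolding R_tilde_def using transpose_congruence[OF bar_carrier(1) bar_symmetric(1) factors(2)] .
  have "inv_mat (TL d k) * Gx_bar p d k \<in> carrier_mat \<gamma> n" using factors bar_carrier by simp
  from upper_lower_rows_carrier[OF this] show "Gx_tilde p d k \<in> carrier_mat (rho d k) n"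
    "H_tilde p d k \<in> carrier_mat (\<gamma> - rho d k) n" unfolding Gx_tilde_def H_tilde_def by auto
qed

lemma W_carrier: "W_mat p d k \<in> carrier_mat (m + n) (q + n)"
proof -
  have "0\<^sub>m (rho d k) q @\<^sub>r 1\<^sub>m q \<in> carrier_mat (rho d k + q) q" by (rule carrier_append_rows) auto
  then have "0\<^sub>m (rho d k) q @\<^sub>r 1\<^sub>m q \<in> carrier_mat m q" using factors by simp
  then show ?thesis unfolding W_mat_def by (rule four_block_carrier_mat[OF _ one_carrier_mat])
qed

lemma W_mult_vec:
  assumes v: "v \<in> carrier_vec q" and x: "x \<in> carrier_vec n"
  shows "W_mat p d k *\<^sub>v (v @\<^sub>v x) = ((Gx_tilde p d k *\<^sub>v x) @\<^sub>v v) @\<^sub>v x"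
proof -
  have z: "0\<^sub>m (rho d k) q \<in> carrier_mat (rho d k) q" "1\<^sub>m q \<in> carrier_mat q q" "0\<^sub>m q n \<in> carrier_mat q n" by auto
  have c: "0\<^sub>m (rho d k) q @\<^sub>r 1\<^sub>m q \<in> carrier_mat m q" "Gx_tilde p d k @\<^sub>r 0\<^sub>m q n \<in> carrier_mat m n"
    using carrier_append_rows[OF z(1,2)] carrier_append_rows[OF tilde_carrier(4) z(3)] factors by auto
  have g: "Gx_tilde p d k *\<^sub>v x \<in> carrier_vec (rho d k)" using tilde_carrier x by auto
  have "W_mat p d k *\<^sub>v (v @\<^sub>v x) =
      ((0\<^sub>v (rho d k) @\<^sub>v v) + ((Gx_tilde p d k *\<^sub>v x) @\<^sub>v 0\<^sub>v q)) @\<^sub>v (0\<^sub>v n + x)"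
    unfolding W_mat_def
    using four_block_mat_mult_vec[OF c zero_carrier_mat[of n q] one_carrier_mat v x]
      mat_mult_append[OF z(1,2) v] mat_mult_append[OF tilde_carrier(4) z(3) x] v x
    by (simp add: zero_mult_mat_vec)
  then show ?thesis using append_vec_add[of "0\<^sub>v (rho d k)" "rho d k" "Gx_tilde p d k *\<^sub>v x" v q "0\<^sub>v q"] g v x by simp
qed

lemma hat_mat_carrier: "hat_mat p d k \<in> carrier_mat (q + n) (q + n)" "(hat_mat p d k)\<^sup>T = hat_mat p d k"
proof -
  let ?M = "four_block_mat (R_tilde p d k) (S_tilde p d k)\<^sup>T (S_tilde p d k) (Q_bar p d k)"
  have M: "?M \<in> carrier_mat (m + n) (m + n)" using four_block_carrier_mat tilde_carrier bar_carrier by blast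
  have Mt: "?M\<^sup>T = ?M"
    using transpose_four_block_mat[of "R_tilde p d k" m m "(S_tilde p d k)\<^sup>T" n "S_tilde p d k" n "Q_bar p d k"]
      tilde_carrier bar_carrier bar_symmetric by simp
  show "hat_mat p d k \<in> carrier_mat (q + n) (q + n)" unfolding hat_mat_def using M W_carrier by auto
  show "(hat_mat p d k)\<^sup>T = hat_mat p d k" unfolding hat_mat_def by (rule transpose_congruence[OF M Mt W_carrier])
qed

lemma hat_blocks:
  "R_hat p d k \<in> carrier_mat q q" "(R_hat p d k)\<^sup>T = R_hat p d k" "S_hat p d k \<in> carrier_mat n q"
  "Q_hat p d k \<in> carrier_mat n n" "(Q_hat p d k)\<^sup>T = Q_hat p d k"
  "hat_mat p d k = four_block_mat (R_hat p d k) (S_hat p d k)\<^sup>T (S_hat p d k) (Q_hat p d k)"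
proof -
  obtain M1 M2 M3 M4 where s: "split_block (hat_mat p d k) q q = (M1, M2, M3, M4)" by (metis prod_cases4)
  have "R_hat p d k = M1" "S_hat p d k = M3" "Q_hat p d k = M4"
    unfolding R_hat_def S_hat_def Q_hat_def s by auto
  with split_block_symmetric[OF hat_mat_carrier s] show 
  "R_hat p d k \<in> carrier_mat q q" "(R_hat p d k)\<^sup>T = R_hat p d k" "S_hat p d k \<in> carrier_mat n q"
  "Q_hat p d k \<in> carrier_mat n n" "(Q_hat p d k)\<^sup>T = Q_hat p d k"
  "hat_mat p d k = four_block_mat (R_hat p d k) (S_hat p d k)\<^sup>T (S_hat p d k) (Q_hat p d k)" by auto
qed

lemma hat_mat_zero_state:
  assumes v: "v \<in> carrier_vec q"
  shows "quad (hat_mat p d k) (v @\<^sub>v 0\<^sub>v n) = quad (R_hat p d k) v"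
  unfolding hat_blocks(6) using quad_four_block[OF hat_blocks(1,3,4) v zero_carrier_vec] hat_blocks v
  by (simp add: quad_zero mult_mat_vec_carrier[OF hat_blocks(3) v])

lemma lift_input_carrier:
  assumes "v \<in> carrier_vec q" "x \<in> carrier_vec n"
  shows "(Gx_tilde p d k *\<^sub>v x) @\<^sub>v v \<in> carrier_vec m" "lift_input p d k v x \<in> carrier_vec m"
proof -
  have "(Gx_tilde p d k *\<^sub>v x) @\<^sub>v v \<in> carrier_vec (rho d k + q)" using assms tilde_carrier by auto
  then show "(Gx_tilde p d k *\<^sub>v x) @\<^sub>v v \<in> carrier_vec m" using factors by simp
  then show "lift_input p d k v x \<in> carrier_vec m" unfolding lift_input_def using factors by auto
qed

lemma lift_input_eq_0:
  assumes v: "v \<in> carrier_vec q" and l: "lift_input p d k v (0\<^sub>v n) = 0\<^sub>v m"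
  shows "v = 0\<^sub>v q"
proof -
  let ?w = "(Gx_tilde p d k *\<^sub>v 0\<^sub>v n) @\<^sub>v v"
  have w: "?w \<in> carrier_vec m" using lift_input_carrier[OF v] by simp
  have "?w = TR d k *\<^sub>v lift_input p d k v (0\<^sub>v n)" unfolding lift_input_def
    using mult_mat_vec_inv_cancel[OF factors(1,2,3) w] by simp
  also have "\<dots> = 0\<^sub>v m" unfolding l using factors by (auto intro!: eq_vecI)
  finally have "?w = 0\<^sub>v (rho d k + q)" using factors by simp
  then show ?thesis using append_vec_eq_zero_iff[of "Gx_tilde p d k *\<^sub>v 0\<^sub>v n" "rho d k" v q] tilde_carrier v by auto
qed

text \<open>The hatted matrix arises by two congruences, the change of coordinates \<open>T\<^sub>R\<close> and the substitution \<open>W\<close>,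
which together turn \<open>(v, x)\<close> into \<open>(u, x)\<close>.\<close>

lemma lift_input_cost:
  assumes v: "v \<in> carrier_vec q" and x: "x \<in> carrier_vec n" and u: "u = lift_input p d k v x"
  shows "stage_cost p k u x + quad P' (B *\<^sub>v u + A *\<^sub>v x) = quad (hat_mat p d k) (v @\<^sub>v x)"
proof -
  let ?w = "(Gx_tilde p d k *\<^sub>v x) @\<^sub>v v"
  let ?M = "four_block_mat (R_tilde p d k) (S_tilde p d k)\<^sup>T (S_tilde p d k) (Q_bar p d k)"
  have w: "?w \<in> carrier_vec m" and uc: "u \<in> carrier_vec m" using lift_input_carrier[OF v x] u by auto
  have uw: "T *\<^sub>v ?w = u" unfolding u lift_input_def ..
  have M: "?M \<in> carrier_mat (m + n) (m + n)" using four_block_carrier_mat tilde_carrier bar_carrier by blast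
  have "quad (hat_mat p d k) (v @\<^sub>v x) = quad ?M (?w @\<^sub>v x)"
    unfolding hat_mat_def using quad_congruence[OF M W_carrier append_carrier_vec[OF v x]] W_mult_vec[OF v x] by simp
  also have "\<dots> = quad (R_tilde p d k) ?w + 2 * (x \<bullet> (S_tilde p d k *\<^sub>v ?w)) + quad (Q_bar p d k) x"
    by (rule quad_four_block[OF tilde_carrier(1,3) bar_carrier(3) w x])
  also have "quad (R_tilde p d k) ?w = quad (R_bar p d k) u"
    unfolding R_tilde_def using quad_congruence[OF bar_carrier(1) factors(2) w] uw by simp
  also have "\<dots> = quad (Rm p k) u + quad P' (B *\<^sub>v u)"
    unfolding R_bar_def using quad_add_mat[of "Rm p k" m "B\<^sup>T * P' * B" u] quad_congruence[OF P(1) data_carrier(7) uc]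
      data_carrier P uc by simp
  also have "S_tilde p d k *\<^sub>v ?w = S_bar p d k *\<^sub>v u"
    unfolding S_tilde_def using assoc_mult_mat_vec[OF bar_carrier(2) factors(2) w] uw by simp
  also have "S_bar p d k *\<^sub>v u = Sm p k *\<^sub>v u + A\<^sup>T *\<^sub>v (P' *\<^sub>v (B *\<^sub>v u))"
    unfolding S_bar_def using add_mult_distrib_mat_vec[of "Sm p k" n m "A\<^sup>T * P' * B" u]
      assoc_mult_mat_vec[of "A\<^sup>T * P'" n n B m u] assoc_mult_mat_vec[of "A\<^sup>T" n n P' n "B *\<^sub>v u"]
      data_carrier P uc by simp
  also have "x \<bullet> \<dots> = x \<bullet> (Sm p k *\<^sub>v u) + (A *\<^sub>v x) \<bullet> (P' *\<^sub>v (B *\<^sub>v u))"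
    using scalar_prod_add_distrib[of x n "Sm p k *\<^sub>v u" "A\<^sup>T *\<^sub>v (P' *\<^sub>v (B *\<^sub>v u))"]
      scalar_prod_mult_mat_vec[OF data_carrier(6) x, of "P' *\<^sub>v (B *\<^sub>v u)"] data_carrier P uc x by simp
  also have "quad (Q_bar p d k) x = quad (Qm p k) x + quad P' (A *\<^sub>v x)"
    unfolding Q_bar_def using quad_add_mat[of "Qm p k" n "A\<^sup>T * P' * A" x] quad_congruence[OF P(1) data_carrier(6) x]
      data_carrier P x by simp
  also have "quad (Rm p k) u + quad P' (B *\<^sub>v u) + 2 * (x \<bullet> (Sm p k *\<^sub>v u) + (A *\<^sub>v x) \<bullet> (P' *\<^sub>v (B *\<^sub>v u))) +
      (quad (Qm p k) x + quad P' (A *\<^sub>v x)) = stage_cost p k u x + quad P' (B *\<^sub>v u + A *\<^sub>v x)"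
    unfolding stage_cost_def stage_hessian_def
    using quad_four_block[OF data_carrier(1,3,4) uc x] quad_add[OF P, of "B *\<^sub>v u" "A *\<^sub>v x"] data_carrier uc x by simp
  finally show ?thesis by simp
qed

text \<open>The path constraint at stage \<open>k\<close> together with the constraint handed down from the successor state is
one linear system, and its elimination separates what it says about the state from what it says about
the input.\<close>

lemma constraint_iff_lift:
  assumes E: "Em d k = 0\<^sub>m (dim_row (Em d k)) (dim_col (Em d k))"
    and u: "u \<in> carrier_vec m" and x: "x \<in> carrier_vec n"
  shows "Gu p k *\<^sub>v u + Gx p k *\<^sub>v x = 0\<^sub>v (dim_vec (gv p k)) \<and> H' *\<^sub>v (B *\<^sub>v u + A *\<^sub>v x) = 0\<^sub>v (dim_row H') \<longleftrightarrow>
    H_tilde p d k *\<^sub>v x = 0\<^sub>v (\<gamma> - rho d k) \<and> (\<exists>v \<in> carrier_vec q. u = lift_input p d k v x)"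
proof -
  let ?g = "dim_vec (gv p k)"
  define h where "h = dim_row H'"
  have H': "H' \<in> carrier_mat h n" using H'_carrier unfolding h_def .
  have E': "Em d k = 0\<^sub>m (\<gamma> - rho d k) q" using E factors by auto
  have c: "Gu p k *\<^sub>v u + Gx p k *\<^sub>v x \<in> carrier_vec ?g" "H' *\<^sub>v (B *\<^sub>v u + A *\<^sub>v x) \<in> carrier_vec h"
    using data_carrier H' u x by auto
  have "Gu_bar p d k *\<^sub>v u + Gx_bar p d k *\<^sub>v x =
    ((Gu p k *\<^sub>v u) @\<^sub>v ((H' * B) *\<^sub>v u)) + ((Gx p k *\<^sub>v x) @\<^sub>v ((H' * A) *\<^sub>v x))"
    unfolding Gu_bar_def Gx_bar_def
    using mat_mult_append[of "Gu p k" ?g m "H' * B" h u] mat_mult_append[of "Gx p k" ?g n "H' * A" h x]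
      data_carrier H' u x by simp
  also have "\<dots> = (Gu p k *\<^sub>v u + Gx p k *\<^sub>v x) @\<^sub>v (H' *\<^sub>v (B *\<^sub>v u) + H' *\<^sub>v (A *\<^sub>v x))"
    using append_vec_add[of "Gu p k *\<^sub>v u" ?g "Gx p k *\<^sub>v x" "(H' * B) *\<^sub>v u" h "(H' * A) *\<^sub>v x"]
      assoc_mult_mat_vec[of H' h n B m u] assoc_mult_mat_vec[of H' h n A n x] data_carrier H' u x by simp
  also have "H' *\<^sub>v (B *\<^sub>v u) + H' *\<^sub>v (A *\<^sub>v x) = H' *\<^sub>v (B *\<^sub>v u + A *\<^sub>v x)"
    using mult_add_distrib_mat_vec[of H' h n "B *\<^sub>v u" "A *\<^sub>v x"] data_carrier H' u x by simp
  finally have "Gu_bar p d k *\<^sub>v u + Gx_bar p d k *\<^sub>v x = 0\<^sub>v (?g + h) \<longleftrightarrow>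
     Gu p k *\<^sub>v u + Gx p k *\<^sub>v x = 0\<^sub>v ?g \<and> H' *\<^sub>v (B *\<^sub>v u + A *\<^sub>v x) = 0\<^sub>v h"
    using append_vec_eq_zero_iff[OF c] by simp
  then show ?thesis
    using decomposition_constraint_iff[OF bar_carrier(4,5) dec E' u x]
    unfolding h_def H_tilde_def Gx_tilde_def lift_input_def by auto
qed

end

locale completed_stage = stage +
  assumes pd: "pos_def_mat (R_hat p d k)" and chol: "cholesky_factor (Chol d k) (R_hat p d k)"
    and P_eq: "Pm d k = Q_hat p d k - (L_mat p d k)\<^sup>T * L_mat p d k"
    and H_eq: "Hm d k = H_tilde p d k - (Z_mat p d k)\<^sup>T * L_mat p d k"
begin

lemmas chol_factor = cholesky_factor_inverse[OF hat_blocks(1) pd chol]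

lemma L_carrier: "L_mat p d k \<in> carrier_mat q n"
  unfolding L_mat_def using chol_factor hat_blocks by auto

lemma P_symmetric: "Pm d k \<in> carrier_mat n n" "(Pm d k)\<^sup>T = Pm d k"
proof -
  have c: "(L_mat p d k)\<^sup>T * L_mat p d k \<in> carrier_mat n n" using L_carrier by auto
  show "Pm d k \<in> carrier_mat n n" unfolding P_eq by (rule minus_carrier_mat[OF c])
  show "(Pm d k)\<^sup>T = Pm d k" unfolding P_eq
    using transpose_minus[OF hat_blocks(4) c] transpose_mult[of "(L_mat p d k)\<^sup>T" n q "L_mat p d k" n] L_carrier hat_blocks by simp
qed

lemma H_carrier: "Hm d k \<in> carrier_mat (\<gamma> - rho d k) n"
  unfolding H_eq Z_mat_def using L_carrier chol_factor factors by (auto intro!: carrier_matI)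

lemma H_exact:
  assumes E: "Em d k = 0\<^sub>m (dim_row (Em d k)) (dim_col (Em d k))"
  shows "Hm d k = H_tilde p d k"
proof -
  have "Em d k = 0\<^sub>m (\<gamma> - rho d k) q" using E factors by auto
  then have "Z_mat p d k = 0\<^sub>m q (\<gamma> - rho d k)"
    unfolding Z_mat_def using chol_factor by (simp add: zero_transpose_mat)
  moreover have "H_tilde p d k - 0\<^sub>m (\<gamma> - rho d k) n = H_tilde p d k"
    using tilde_carrier(5) by (intro eq_matI) auto
  ultimately show ?thesis unfolding H_eq using L_carrier by (simp add: zero_transpose_mat)
qed

text \<open>Since \<open>\<Lambda> L = S\<^sup>T\<close> for the hatted \<open>S\<close>, the mixed term is twice the product of \<open>\<Lambda>\<^sup>T v\<close> with \<open>L x\<close>, and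
subtracting \<open>L\<^sup>T L\<close> in the definition of \<open>P\<^sub>k\<close> accounts for the square of \<open>L x\<close>.\<close>

lemma complete_square:
  assumes v: "v \<in> carrier_vec q" and x: "x \<in> carrier_vec n"
  defines "s \<equiv> (Chol d k)\<^sup>T *\<^sub>v v + L_mat p d k *\<^sub>v x"
  shows "quad (hat_mat p d k) (v @\<^sub>v x) = s \<bullet> s + quad (Pm d k) x"
proof -
  let ?C = "Chol d k" and ?L = "L_mat p d k"
  define a where "a = ?C\<^sup>T *\<^sub>v v"
  define b where "b = ?L *\<^sub>v x"
  have a: "a \<in> carrier_vec q" and b: "b \<in> carrier_vec q" using chol_factor L_carrier v x by (auto simp: a_def b_def)
  have "quad (hat_mat p d k) (v @\<^sub>v x) = quad (R_hat p d k) v + 2 * (x \<bullet> (S_hat p d k *\<^sub>v v)) + quad (Q_hat p d k) x"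
    unfolding hat_blocks(6) by (rule quad_four_block[OF hat_blocks(1,3,4) v x])
  also have "quad (R_hat p d k) v = a \<bullet> a"
    unfolding quad_def chol_factor(5) a_def
    using scalar_prod_mult_mat_vec[of "?C\<^sup>T" q q v "?C\<^sup>T *\<^sub>v v"] chol_factor v
    by (simp add: assoc_mult_mat_vec[of ?C q q "?C\<^sup>T" q v])
  also have "x \<bullet> (S_hat p d k *\<^sub>v v) = a \<bullet> b"
  proof -
    have S: "?C * ?L = (S_hat p d k)\<^sup>T" unfolding L_mat_def
      using chol_factor hat_blocks by (simp add: assoc_mult_mat[of ?C q q "inv_mat ?C" q "(S_hat p d k)\<^sup>T" n, symmetric])
    have "x \<bullet> (S_hat p d k *\<^sub>v v) = ((S_hat p d k)\<^sup>T *\<^sub>v x) \<bullet> v"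
      using transpose_vec_mult_scalar[OF hat_blocks(3) v x] by simp
    also have "\<dots> = (?C *\<^sub>v b) \<bullet> v" unfolding S[symmetric] b_def using chol_factor L_carrier x
      by (simp add: assoc_mult_mat_vec[of ?C q q ?L n x])
    also have "\<dots> = b \<bullet> a" unfolding a_def by (rule scalar_prod_mult_mat_vec[OF chol_factor(1) b v])
    finally show ?thesis using comm_scalar_prod[OF a b] by simp
  qed
  also have "quad (Q_hat p d k) x = b \<bullet> b + quad (Pm d k) x"
  proof -
    have "quad (?L\<^sup>T * ?L) x = b \<bullet> b"
      unfolding quad_def b_def
      using scalar_prod_mult_mat_vec[of ?L q n x "?L *\<^sub>v x"] L_carrier x by (simp add: assoc_mult_mat_vec[of "?L\<^sup>T" n q ?L n x])
    then show ?thesis unfolding P_eq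
      using quad_minus_mat[OF hat_blocks(4), of "?L\<^sup>T * ?L" x] L_carrier x by simp
  qed
  also have "a \<bullet> a + 2 * (a \<bullet> b) + (b \<bullet> b + quad (Pm d k) x) = s \<bullet> s + quad (Pm d k) x"
    unfolding s_def a_def[symmetric] b_def[symmetric]
    using a b comm_scalar_prod[OF a b] by (simp add: scalar_prod_add_distrib[of _ q] add_scalar_prod_distrib[of _ q])
  finally show ?thesis .
qed

lemma minimizing_input:
  assumes x: "x \<in> carrier_vec n"
  obtains v where "v \<in> carrier_vec q" "quad (hat_mat p d k) (v @\<^sub>v x) = quad (Pm d k) x"
proof
  let ?C = "Chol d k" and ?b = "L_mat p d k *\<^sub>v x"
  let ?v = "(inv_mat ?C)\<^sup>T *\<^sub>v (- ?b)"
  have b: "?b \<in> carrier_vec q" using L_carrier x by auto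
  show v: "?v \<in> carrier_vec q" using chol_factor b by auto
  have "?C\<^sup>T * (inv_mat ?C)\<^sup>T = 1\<^sub>m q"
    using transpose_mult[OF chol_factor(2,1)] chol_factor(4) by simp
  then have "?C\<^sup>T *\<^sub>v ?v = - ?b"
    using mult_mat_vec_inv_cancel[of "?C\<^sup>T" q "(inv_mat ?C)\<^sup>T" "- ?b"] chol_factor b by simp
  then show "quad (hat_mat p d k) (?v @\<^sub>v x) = quad (Pm d k) x"
    using complete_square[OF v x] b by simp
qed

lemma hat_mat_strict:
  assumes v: "v \<in> carrier_vec q" and z: "quad (hat_mat p d k) (v @\<^sub>v 0\<^sub>v n) = 0"
  shows "v = 0\<^sub>v q"
  using z pd v hat_mat_zero_state[OF v] unfolding pos_def_mat_iff_quad[OF hat_blocks(1,2)] by fastforce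

end

section \<open>Dynamic programming on the homogeneous problem\<close>

definition tail_feasible :: "lq_data \<Rightarrow> nat \<Rightarrow> (nat \<Rightarrow> real vec) \<Rightarrow> (nat \<Rightarrow> real vec) \<Rightarrow> bool" where
  "tail_feasible p k u x \<longleftrightarrow>
     (\<forall>j. k \<le> j \<and> j \<le> hor p \<longrightarrow> x j \<in> carrier_vec (nx p)) \<and>
     (\<forall>j. k \<le> j \<and> j < hor p \<longrightarrow> u j \<in> carrier_vec (nu p) \<and>
        x (Suc j) = Bm p j *\<^sub>v u j + Am p j *\<^sub>v x j \<and>
        Gu p j *\<^sub>v u j + Gx p j *\<^sub>v x j = 0\<^sub>v (dim_vec (gv p j))) \<and>
     GT p *\<^sub>v x (hor p) = 0\<^sub>v (dim_row (GT p))"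

definition tail_cost :: "lq_data \<Rightarrow> nat \<Rightarrow> (nat \<Rightarrow> real vec) \<Rightarrow> (nat \<Rightarrow> real vec) \<Rightarrow> real" where
  "tail_cost p k u x = (\<Sum>j = k..<hor p. stage_cost p j (u j) (x j)) + quad (Qm p (hor p)) (x (hor p))"

definition tail_zero :: "lq_data \<Rightarrow> nat \<Rightarrow> (nat \<Rightarrow> real vec) \<Rightarrow> (nat \<Rightarrow> real vec) \<Rightarrow> bool" where
  "tail_zero p k u x \<longleftrightarrow> (\<forall>j. k \<le> j \<and> j < hor p \<longrightarrow> u j = 0\<^sub>v (nu p)) \<and>
     (\<forall>j. k \<le> j \<and> j \<le> hor p \<longrightarrow> x j = 0\<^sub>v (nx p))"

text \<open>The quadratic form of \<open>P\<^sub>k\<close> on the kernel of \<open>H\<^sub>k\<close> is the optimal cost of the homogeneous problem from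
stage \<open>k\<close> on. Uniqueness at the origin, the last clause but one, is what turns nonnegative cost into positive
cost for trajectories that start at the origin.\<close>

definition value_function :: "lq_data \<Rightarrow> lq_run \<Rightarrow> nat \<Rightarrow> bool" where
  "value_function p d k \<longleftrightarrow>
     Pm d k \<in> carrier_mat (nx p) (nx p) \<and> (Pm d k)\<^sup>T = Pm d k \<and> dim_col (Hm d k) = nx p \<and>
     (\<forall>u x. tail_feasible p k u x \<longrightarrow>
        Hm d k *\<^sub>v x k = 0\<^sub>v (dim_row (Hm d k)) \<and> quad (Pm d k) (x k) \<le> tail_cost p k u x) \<and>
     (\<forall>u x. tail_feasible p k u x \<and> x k = 0\<^sub>v (nx p) \<and> tail_cost p k u x = 0 \<longrightarrow> tail_zero p k u x) \<and>
     (\<forall>\<xi> \<in> carrier_vec (nx p). Hm d k *\<^sub>v \<xi> = 0\<^sub>v (dim_row (Hm d k)) \<longrightarrow>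
        (\<exists>u x. tail_feasible p k u x \<and> x k = \<xi> \<and> tail_cost p k u x = quad (Pm d k) \<xi>))"

lemma value_functionD:
  assumes "value_function p d k"
  shows "Pm d k \<in> carrier_mat (nx p) (nx p)" "(Pm d k)\<^sup>T = Pm d k" "dim_col (Hm d k) = nx p"
    "\<And>u x. tail_feasible p k u x \<Longrightarrow> Hm d k *\<^sub>v x k = 0\<^sub>v (dim_row (Hm d k))"
    "\<And>u x. tail_feasible p k u x \<Longrightarrow> quad (Pm d k) (x k) \<le> tail_cost p k u x"
    "\<And>u x. tail_feasible p k u x \<Longrightarrow> x k = 0\<^sub>v (nx p) \<Longrightarrow> tail_cost p k u x = 0 \<Longrightarrow> tail_zero p k u x"
    "\<And>\<xi>. \<xi> \<in> carrier_vec (nx p) \<Longrightarrow> Hm d k *\<^sub>v \<xi> = 0\<^sub>v (dim_row (Hm d k)) \<Longrightarrow>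
       \<exists>u x. tail_feasible p k u x \<and> x k = \<xi> \<and> tail_cost p k u x = quad (Pm d k) \<xi>"
  using assms unfolding value_function_def by blast+

lemma all_tail_Suc:
  assumes "k < h"
  shows "(\<forall>j. k \<le> j \<and> j < h \<longrightarrow> Q j) \<longleftrightarrow> Q k \<and> (\<forall>j. Suc k \<le> j \<and> j < h \<longrightarrow> Q j)"
    "(\<forall>j. k \<le> j \<and> j \<le> h \<longrightarrow> Q j) \<longleftrightarrow> Q k \<and> (\<forall>j. Suc k \<le> j \<and> j \<le> h \<longrightarrow> Q j)"
  using assms by (metis Suc_leD le_refl le_neq_implies_less less_imp_le Suc_leI)+

lemma tail_feasible_Suc:
  assumes "k < hor p"
  shows "tail_feasible p k u x \<longleftrightarrow> u k \<in> carrier_vec (nu p) \<and> x k \<in> carrier_vec (nx p) \<and>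
    x (Suc k) = Bm p k *\<^sub>v u k + Am p k *\<^sub>v x k \<and> Gu p k *\<^sub>v u k + Gx p k *\<^sub>v x k = 0\<^sub>v (dim_vec (gv p k)) \<and>
    tail_feasible p (Suc k) u x"
  unfolding tail_feasible_def all_tail_Suc[OF assms] by blast

lemma tail_cost_Suc:
  "k < hor p \<Longrightarrow> tail_cost p k u x = stage_cost p k (u k) (x k) + tail_cost p (Suc k) u x"
  unfolding tail_cost_def by (simp add: sum.atLeast_Suc_lessThan)

lemma tail_zero_Suc:
  "k < hor p \<Longrightarrow> tail_zero p k u x \<longleftrightarrow> u k = 0\<^sub>v (nu p) \<and> x k = 0\<^sub>v (nx p) \<and> tail_zero p (Suc k) u x"
  unfolding tail_zero_def by (simp only: all_tail_Suc conj_ac)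

lemma tail_fun_upd:
  assumes "k < hor p"
  shows "tail_feasible p (Suc k) (u(k := a)) (x(k := b)) \<longleftrightarrow> tail_feasible p (Suc k) u x"
    "tail_cost p (Suc k) (u(k := a)) (x(k := b)) = tail_cost p (Suc k) u x"
  using assms unfolding tail_feasible_def tail_cost_def by (auto intro!: sum.cong)

lemma value_function_terminal:
  assumes p: "lq_problem p" and P: "Pm d (hor p) = Qm p (hor p)" and H: "Hm d (hor p) = GT p"
  shows "value_function p d (hor p)"
proof -
  have "Qm p (hor p) \<in> carrier_mat (nx p) (nx p)" "(Qm p (hor p))\<^sup>T = Qm p (hor p)" "dim_col (GT p) = nx p"
    using p unfolding lq_problem_def by auto
  moreover have "\<exists>u x. tail_feasible p (hor p) u x \<and> x (hor p) = \<xi> \<and> tail_cost p (hor p) u x = quad (Qm p (hor p)) \<xi>"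
    if "\<xi> \<in> carrier_vec (nx p)" "GT p *\<^sub>v \<xi> = 0\<^sub>v (dim_row (GT p))" for \<xi>
    using that by (intro exI[of _ "\<lambda>_. \<xi>"]) (auto simp: tail_feasible_def tail_cost_def)
  ultimately show ?thesis unfolding value_function_def P H
    by (auto simp: tail_feasible_def tail_cost_def tail_zero_def)
qed

context stage
begin

lemma feasible_lift:
  assumes V: "value_function p d (Suc k)"
    and E: "Em d k = 0\<^sub>m (dim_row (Em d k)) (dim_col (Em d k))"
    and f: "tail_feasible p k u x"
  obtains v where "v \<in> carrier_vec q" "u k = lift_input p d k v (x k)"
    "H_tilde p d k *\<^sub>v x k = 0\<^sub>v (\<gamma> - rho d k)"
    "stage_cost p k (u k) (x k) + quad P' (x (Suc k)) = quad (hat_mat p d k) (v @\<^sub>v x k)"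
proof -
  have f': "u k \<in> carrier_vec m" "x k \<in> carrier_vec n" "x (Suc k) = B *\<^sub>v u k + A *\<^sub>v x k"
    "Gu p k *\<^sub>v u k + Gx p k *\<^sub>v x k = 0\<^sub>v (dim_vec (gv p k))" "tail_feasible p (Suc k) u x"
    using f tail_feasible_Suc[OF k] by auto
  have "H' *\<^sub>v (B *\<^sub>v u k + A *\<^sub>v x k) = 0\<^sub>v (dim_row H')"
    using value_functionD(4)[OF V f'(5)] f'(3) by simp
  then obtain v where v: "v \<in> carrier_vec q" "u k = lift_input p d k v (x k)"
    and "H_tilde p d k *\<^sub>v x k = 0\<^sub>v (\<gamma> - rho d k)"
    using constraint_iff_lift[OF E f'(1,2)] f'(4) by auto
  then show ?thesis using that lift_input_cost[OF v(1) f'(2) v(2)] f'(3) by metis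
qed

lemma lift_feasible:
  assumes V: "value_function p d (Suc k)"
    and E: "Em d k = 0\<^sub>m (dim_row (Em d k)) (dim_col (Em d k))"
    and v: "v \<in> carrier_vec q" and \<xi>: "\<xi> \<in> carrier_vec n"
    and h: "H_tilde p d k *\<^sub>v \<xi> = 0\<^sub>v (\<gamma> - rho d k)"
  obtains u x where "tail_feasible p k u x" "x k = \<xi>" "u k = lift_input p d k v \<xi>"
    "tail_cost p k u x = quad (hat_mat p d k) (v @\<^sub>v \<xi>)"
proof -
  define w where "w = lift_input p d k v \<xi>"
  have w: "w \<in> carrier_vec m" using lift_input_carrier[OF v \<xi>] w_def by simp
  have c: "Gu p k *\<^sub>v w + Gx p k *\<^sub>v \<xi> = 0\<^sub>v (dim_vec (gv p k))" "H' *\<^sub>v (B *\<^sub>v w + A *\<^sub>v \<xi>) = 0\<^sub>v (dim_row H')"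
    using constraint_iff_lift[OF E w \<xi>] h v w_def by auto
  have "B *\<^sub>v w + A *\<^sub>v \<xi> \<in> carrier_vec n" using data_carrier(6,7) w \<xi> by auto
  from value_functionD(7)[OF V this c(2)] obtain u x where f: "tail_feasible p (Suc k) u x"
    "x (Suc k) = B *\<^sub>v w + A *\<^sub>v \<xi>" "tail_cost p (Suc k) u x = quad P' (B *\<^sub>v w + A *\<^sub>v \<xi>)" by auto
  show ?thesis
  proof (rule that)
    show "tail_feasible p k (u(k := w)) (x(k := \<xi>))"
      unfolding tail_feasible_Suc[OF k] tail_fun_upd(1)[OF k] using f w \<xi> c by simp
    show "tail_cost p k (u(k := w)) (x(k := \<xi>)) = quad (hat_mat p d k) (v @\<^sub>v \<xi>)"
      unfolding tail_cost_Suc[OF k] tail_fun_upd(2)[OF k] using lift_input_cost[OF v \<xi> w_def] f by simp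
  qed (auto simp: w_def)
qed

text \<open>With state zero at stage \<open>k\<close> the hatted cost reduces to the quadratic form of the reduced \<open>R\<close>, so a
direction on which the latter is nonpositive gives a tail of nonpositive cost. The input is nonzero
because \<open>lift_input\<close> is injective in the free components.\<close>

lemma not_pos_def_trajectory:
  assumes V: "value_function p d (Suc k)"
    and E: "Em d k = 0\<^sub>m (dim_row (Em d k)) (dim_col (Em d k))"
    and npd: "\<not> pos_def_mat (R_hat p d k)"
  obtains u x where "tail_feasible p k u x" "x k = 0\<^sub>v n" "u k \<noteq> 0\<^sub>v m" "tail_cost p k u x \<le> 0"
proof -
  obtain v where v: "v \<in> carrier_vec q" "v \<noteq> 0\<^sub>v q" "quad (R_hat p d k) v \<le> 0"
    using npd unfolding pos_def_mat_iff_quad[OF hat_blocks(1,2)] by force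
  have "H_tilde p d k *\<^sub>v 0\<^sub>v n = 0\<^sub>v (\<gamma> - rho d k)" using tilde_carrier(5) by (rule mult_mat_zero_vec)
  from lift_feasible[OF V E v(1) zero_carrier_vec this] obtain u x where
    "tail_feasible p k u x" "x k = 0\<^sub>v n" "u k = lift_input p d k v (0\<^sub>v n)"
    "tail_cost p k u x = quad (hat_mat p d k) (v @\<^sub>v 0\<^sub>v n)" .
  then show ?thesis using that lift_input_eq_0[OF v(1)] v hat_mat_zero_state[OF v(1)] by metis
qed

end

text \<open>Bellman's recursion: a tail from stage \<open>k\<close> costs at least the stage cost plus the value of its
successor state, which is the hatted quadratic form, and that form is minimized over the free components
by making the completed square vanish.\<close>

lemma (in completed_stage) value_function_step:
  assumes V: "value_function p d (Suc k)"
    and E: "Em d k = 0\<^sub>m (dim_row (Em d k)) (dim_col (Em d k))"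
  shows "value_function p d k"
  unfolding value_function_def
proof (intro conjI allI impI ballI)
  have Hk: "Hm d k = H_tilde p d k" "dim_row (Hm d k) = \<gamma> - rho d k" using H_exact[OF E] H_carrier by auto
  show "Pm d k \<in> carrier_mat n n" "(Pm d k)\<^sup>T = Pm d k" "dim_col (Hm d k) = n"
    using P_symmetric H_carrier by auto
  have main: "Hm d k *\<^sub>v x k = 0\<^sub>v (dim_row (Hm d k)) \<and> quad (Pm d k) (x k) \<le> tail_cost p k u x \<and>
      (x k = 0\<^sub>v n \<and> tail_cost p k u x = 0 \<longrightarrow> tail_zero p k u x)"
    if f: "tail_feasible p k u x" for u x
  proof -
    have x: "x k \<in> carrier_vec n" and f': "tail_feasible p (Suc k) u x" using f tail_feasible_Suc[OF k] by auto
    from feasible_lift[OF V E f] obtain v where v: "v \<in> carrier_vec q" "u k = lift_input p d k v (x k)"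
      "H_tilde p d k *\<^sub>v x k = 0\<^sub>v (\<gamma> - rho d k)"
      "stage_cost p k (u k) (x k) + quad P' (x (Suc k)) = quad (hat_mat p d k) (v @\<^sub>v x k)" .
    have hx: "Hm d k *\<^sub>v x k = 0\<^sub>v (dim_row (Hm d k))" using Hk v(3) by simp
    have le1: "quad (hat_mat p d k) (v @\<^sub>v x k) \<le> tail_cost p k u x"
      using value_functionD(5)[OF V f'] v(4) tail_cost_Suc[OF k, of u x] by simp
    have le2: "quad (Pm d k) (x k) \<le> quad (hat_mat p d k) (v @\<^sub>v x k)"
      using complete_square[OF v(1) x] scalar_prod_self_nonneg by simp
    from le1 le2 have lb: "quad (Pm d k) (x k) \<le> tail_cost p k u x" by simp
    have "tail_zero p k u x" if "x k = 0\<^sub>v n" "tail_cost p k u x = 0"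
    proof -
      have "quad (hat_mat p d k) (v @\<^sub>v 0\<^sub>v n) = 0"
        using le1 le2 that quad_zero[OF P_symmetric(1)] by simp
      from hat_mat_strict[OF v(1) this] have v0: "v = 0\<^sub>v q" .
      have u0: "u k = 0\<^sub>v m" unfolding v(2) v0 that(1) lift_input_def
        using mult_mat_zero_vec[OF tilde_carrier(4)] mult_mat_zero_vec[OF factors(2)] factors(9)
          append_vec_eq_zero_iff[of "0\<^sub>v (rho d k)" "rho d k" "0\<^sub>v q" q] by simp
      have x0: "x (Suc k) = 0\<^sub>v n" using f tail_feasible_Suc[OF k] u0 that(1)
          mult_mat_zero_vec[OF data_carrier(6)] mult_mat_zero_vec[OF data_carrier(7)] by simp
      have "stage_cost p k (u k) (x k) = 0"
        using v(4) \<open>quad (hat_mat p d k) (v @\<^sub>v 0\<^sub>v n) = 0\<close> that x0 quad_zero[OF P(1)] by simp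
      then have "tail_cost p (Suc k) u x = 0" using tail_cost_Suc[OF k, of u x] that by simp
      then show ?thesis using value_functionD(6)[OF V f' x0] u0 that tail_zero_Suc[OF k] by simp
    qed
    with hx lb show ?thesis by blast
  qed
  show "Hm d k *\<^sub>v x k = 0\<^sub>v (dim_row (Hm d k))" "quad (Pm d k) (x k) \<le> tail_cost p k u x"
    if "tail_feasible p k u x" for u x using main[OF that] by auto
  show "tail_zero p k u x" if "tail_feasible p k u x \<and> x k = 0\<^sub>v n \<and> tail_cost p k u x = 0" for u x
    using main[of u x] that by auto
  fix \<xi> assume \<xi>: "\<xi> \<in> carrier_vec n" "Hm d k *\<^sub>v \<xi> = 0\<^sub>v (dim_row (Hm d k))"
  obtain v where v: "v \<in> carrier_vec q" "quad (hat_mat p d k) (v @\<^sub>v \<xi>) = quad (Pm d k) \<xi>"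
    using minimizing_input[OF \<xi>(1)] .
  have "H_tilde p d k *\<^sub>v \<xi> = 0\<^sub>v (\<gamma> - rho d k)" using \<xi> Hk by simp
  from lift_feasible[OF V E v(1) \<xi>(1) this] obtain u x where
    "tail_feasible p k u x" "x k = \<xi>" "tail_cost p k u x = quad (hat_mat p d k) (v @\<^sub>v \<xi>)" .
  then show "\<exists>u x. tail_feasible p k u x \<and> x k = \<xi> \<and> tail_cost p k u x = quad (Pm d k) \<xi>"
    using v by auto
qed

lemma run_stage:
  assumes p: "lq_problem p" and run: "algorithm_run p \<epsilon> d" and k: "k < hor p"
    and reached: "stage_reached p d k"
    and P: "Pm d (Suc k) \<in> carrier_mat (nx p) (nx p)" "(Pm d (Suc k))\<^sup>T = Pm d (Suc k)"
    and H: "dim_col (Hm d (Suc k)) = nx p"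
  shows "stage p d k" "pos_def_mat (R_hat p d k) \<Longrightarrow> completed_stage p d k"
proof -
  from run k reached show s: "stage p d k"
    by unfold_locales (use p P H in \<open>auto simp: algorithm_run_def thresholded_decomposition_def\<close>)
  assume pd: "pos_def_mat (R_hat p d k)"
  with run k reached show "completed_stage p d k"
    by (intro completed_stage.intro completed_stage_axioms.intro s) (auto simp: algorithm_run_def)
qed

text \<open>In the thresholded case exactness is established stage by stage, backwards, and the value function is
already used on the way; hence exactness enters here for the stages from \<open>k\<close> on.\<close>

lemma exact_run_value_function:
  assumes p: "lq_problem p" and run: "algorithm_run p \<epsilon> d"
    and k: "k \<le> hor p" and pd: "\<And>j. k \<le> j \<Longrightarrow> j < hor p \<Longrightarrow> pos_def_mat (R_hat p d j)"
    and E: "\<And>j. k \<le> j \<Longrightarrow> j < hor p \<Longrightarrow> Em d j = 0\<^sub>m (dim_row (Em d j)) (dim_col (Em d j))"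
  shows "value_function p d k"
  using k pd E
proof (induction k rule: inc_induct)
  case base
  show ?case using run by (intro value_function_terminal[OF p]) (auto simp: algorithm_run_def)
next
  case (step k)
  then have V: "value_function p d (Suc k)" by simp
  have reached: "stage_reached p d k" unfolding stage_reached_def using step.prems by simp
  have "completed_stage p d k"
    by (rule run_stage(2)[OF p run _ reached value_functionD(1-3)[OF V]]) (use step in auto)
  then show ?case by (rule completed_stage.value_function_step[OF _ V]) (use step in auto)
qed

definition trajectories_positive :: "lq_data \<Rightarrow> bool" where
  "trajectories_positive p \<longleftrightarrow>
     (\<forall>u x. tail_feasible p 0 u x \<and> \<not> tail_zero p 0 u x \<longrightarrow> tail_cost p 0 u x > 0)"

lemma stage_cost_zero:
  assumes p: "lq_problem p" and k: "k < hor p"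
  shows "stage_cost p k (0\<^sub>v (nu p)) (0\<^sub>v (nx p)) = 0"
proof -
  have "stage_hessian p k \<in> carrier_mat (nu p + nx p) (nu p + nx p)"
    using p k unfolding stage_hessian_def lq_problem_def by auto
  moreover have "0\<^sub>v (nu p) @\<^sub>v 0\<^sub>v (nx p) = (0\<^sub>v (nu p + nx p) :: real vec)" by (intro eq_vecI) auto
  ultimately show ?thesis unfolding stage_cost_def by (simp add: quad_zero)
qed

text \<open>A tail that starts at the origin may be preceded by rest at the origin, which is feasible for the
homogeneous constraints and costs nothing.\<close>

lemma extend_by_zero:
  assumes p: "lq_problem p" and f: "tail_feasible p k u x" and x0: "x k = 0\<^sub>v (nx p)" and k: "k \<le> hor p"
  defines "u' \<equiv> \<lambda>j. if j < k then 0\<^sub>v (nu p) else u j" and "x' \<equiv> \<lambda>j. if j < k then 0\<^sub>v (nx p) else x j"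
  shows "tail_feasible p 0 u' x'" "tail_cost p 0 u' x' = tail_cost p k u x"
proof -
  have x': "x' (Suc j) = 0\<^sub>v (nx p)" if "j < k" for j
    using that x0 by (cases "Suc j = k") (auto simp: x'_def)
  have z: "Bm p j *\<^sub>v 0\<^sub>v (nu p) + Am p j *\<^sub>v 0\<^sub>v (nx p) = 0\<^sub>v (nx p)"
    "Gu p j *\<^sub>v 0\<^sub>v (nu p) + Gx p j *\<^sub>v 0\<^sub>v (nx p) = 0\<^sub>v (dim_vec (gv p j))" if "j < hor p" for j
    using p that mult_mat_zero_vec[of "Bm p j" "nx p" "nu p"] mult_mat_zero_vec[of "Am p j" "nx p" "nx p"]
      mult_mat_zero_vec[of "Gu p j" "dim_vec (gv p j)" "nu p"] mult_mat_zero_vec[of "Gx p j" "dim_vec (gv p j)" "nx p"]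
    unfolding lq_problem_def by auto
  show "tail_feasible p 0 u' x'"
    unfolding tail_feasible_def
  proof (intro conjI allI impI)
    fix j assume j: "0 \<le> j \<and> j < hor p"
    show "u' j \<in> carrier_vec (nu p)" using f j by (auto simp: tail_feasible_def u'_def)
    show "x' (Suc j) = Bm p j *\<^sub>v u' j + Am p j *\<^sub>v x' j"
      using f j z(1)[of j] x'[of j] by (cases "j < k") (auto simp: tail_feasible_def u'_def x'_def)
    show "Gu p j *\<^sub>v u' j + Gx p j *\<^sub>v x' j = 0\<^sub>v (dim_vec (gv p j))"
      using f j z(2)[of j] by (cases "j < k") (auto simp: tail_feasible_def u'_def x'_def)
  qed (use f k in \<open>auto simp: tail_feasible_def x'_def\<close>)
  have "(\<Sum>j = 0..<hor p. stage_cost p j (u' j) (x' j)) =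
     (\<Sum>j = 0..<k. stage_cost p j (u' j) (x' j)) + (\<Sum>j = k..<hor p. stage_cost p j (u' j) (x' j))"
    using sum.atLeastLessThan_concat[of 0 k "hor p" "\<lambda>j. stage_cost p j (u' j) (x' j)"] k by simp
  also have "(\<Sum>j = 0..<k. stage_cost p j (u' j) (x' j)) = 0"
    using stage_cost_zero[OF p] k by (intro sum.neutral) (auto simp: u'_def x'_def)
  also have "(\<Sum>j = k..<hor p. stage_cost p j (u' j) (x' j)) = (\<Sum>j = k..<hor p. stage_cost p j (u j) (x j))"
    by (intro sum.cong) (auto simp: u'_def x'_def)
  finally show "tail_cost p 0 u' x' = tail_cost p k u x"
    unfolding tail_cost_def using k by (simp add: x'_def)
qed

text \<open>A trajectory that starts outside the origin costs at least the value of its initial state; one that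
starts at the origin has nonnegative cost, which vanishes only for the zero trajectory.\<close>

lemma value_function_positive_iff:
  assumes V: "value_function p d 0"
  shows "trajectories_positive p \<longleftrightarrow>
    (\<forall>\<xi> \<in> carrier_vec (nx p). Hm d 0 *\<^sub>v \<xi> = 0\<^sub>v (dim_row (Hm d 0)) \<longrightarrow> \<xi> \<noteq> 0\<^sub>v (nx p) \<longrightarrow> quad (Pm d 0) \<xi> > 0)"
    (is "_ \<longleftrightarrow> ?R")
proof
  assume pos: "trajectories_positive p"
  show ?R
  proof (intro ballI impI)
    fix \<xi> assume \<xi>: "\<xi> \<in> carrier_vec (nx p)" "Hm d 0 *\<^sub>v \<xi> = 0\<^sub>v (dim_row (Hm d 0))" "\<xi> \<noteq> 0\<^sub>v (nx p)"
    from value_functionD(7)[OF V \<xi>(1,2)] obtain u x where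
      "tail_feasible p 0 u x" "x 0 = \<xi>" "tail_cost p 0 u x = quad (Pm d 0) \<xi>" by auto
    then show "quad (Pm d 0) \<xi> > 0" using pos \<xi>(3) unfolding trajectories_positive_def tail_zero_def by fastforce
  qed
next
  assume R: ?R
  show "trajectories_positive p" unfolding trajectories_positive_def
  proof (intro allI impI, elim conjE)
    fix u x assume f: "tail_feasible p 0 u x" and nz: "\<not> tail_zero p 0 u x"
    have x0: "x 0 \<in> carrier_vec (nx p)" using f unfolding tail_feasible_def by auto
    show "0 < tail_cost p 0 u x"
    proof (cases "x 0 = 0\<^sub>v (nx p)")
      case True
      then show ?thesis using value_functionD(5)[OF V f] value_functionD(6)[OF V f] nz
          quad_zero[OF value_functionD(1)[OF V]] by fastforce
    next
      case False
      then show ?thesis using R x0 value_functionD(4,5)[OF V f] by fastforce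
    qed
  qed
qed

text \<open>The kernel of \<open>H\<^sub>0\<close> consists of the vectors \<open>T\<^sup>-\<^sup>1 (0, y)\<close> for the right factor \<open>T\<close>, and on them the
quadratic form of \<open>P\<^sub>0\<close> is the lower right block of its congruence transform, evaluated at \<open>y\<close>.\<close>

lemma P_hat_I_pos_def_iff:
  assumes P: "Pm d 0 \<in> carrier_mat n n" "(Pm d 0)\<^sup>T = Pm d 0" and H: "dim_col (Hm d 0) = n"
    and dec: "exact_decomposition (Hm d 0) (TIL d) (TIR d)"
  shows "pos_def_mat (P_hat_I d) \<longleftrightarrow>
    (\<forall>\<xi> \<in> carrier_vec n. Hm d 0 *\<^sub>v \<xi> = 0\<^sub>v (dim_row (Hm d 0)) \<longrightarrow> \<xi> \<noteq> 0\<^sub>v n \<longrightarrow> quad (Pm d 0) \<xi> > 0)"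
proof -
  define h where "h = dim_row (Hm d 0)"
  define \<rho> where "\<rho> = vec_space.rank h (Hm d 0)"
  define T where "T = inv_mat (TIR d)"
  have Hc: "Hm d 0 \<in> carrier_mat h n" using H h_def by auto
  have dec': "decomposition (Hm d 0) (TIL d) \<rho> (0\<^sub>m (h - \<rho>) (n - \<rho>)) (TIR d)"
    using dec H unfolding exact_decomposition_def Let_def \<rho>_def h_def by simp
  then have TR: "TIR d \<in> carrier_mat n n" "invertible_mat (TIR d)" and \<rho>: "\<rho> \<le> n" "\<rho> \<le> h"
    and TL: "TIL d \<in> carrier_mat h h" "invertible_mat (TIL d)"
    using Hc unfolding decomposition_def by auto
  note T = inv_mat_props[OF TR, folded T_def]
  let ?M = "T\<^sup>T * Pm d 0 * T"
  have M: "?M \<in> carrier_mat (\<rho> + (n - \<rho>)) (\<rho> + (n - \<rho>))" using T P(1) \<rho> by auto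
  have Mt: "?M\<^sup>T = ?M" using transpose_congruence[OF P T(1)] .
  obtain M1 M2 M3 M4 where s: "split_block ?M \<rho> \<rho> = (M1, M2, M3, M4)" by (metis prod_cases4)
  note S = split_block_symmetric[OF M Mt s]
  have PI: "P_hat_I d = M4" unfolding P_hat_I_def Let_def using s unfolding T_def \<rho>_def h_def by simp
  have app: "0\<^sub>v \<rho> @\<^sub>v y \<in> carrier_vec n" if "y \<in> carrier_vec (n - \<rho>)" for y :: "real vec"
    using append_carrier_vec[OF zero_carrier_vec[of \<rho>] that] \<rho> by simp
  have qd: "quad (Pm d 0) (T *\<^sub>v (0\<^sub>v \<rho> @\<^sub>v y)) = quad M4 y" if y: "y \<in> carrier_vec (n - \<rho>)" for y
    using quad_congruence[OF P(1) T(1) app[OF y]]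
      quad_four_block[OF S(1,2,3) zero_carrier_vec y, folded S(6)] S y
    by (simp add: quad_zero[of _ \<rho>] mult_mat_zero_vec[of _ "n - \<rho>" \<rho>])
  have ker: "Hm d 0 *\<^sub>v \<xi> = 0\<^sub>v h \<longleftrightarrow> (\<exists>y \<in> carrier_vec (n - \<rho>). \<xi> = T *\<^sub>v (0\<^sub>v \<rho> @\<^sub>v y))" if \<xi>: "\<xi> \<in> carrier_vec n" for \<xi>
  proof -
    have N: "0\<^sub>m h 0 \<in> carrier_mat h 0" "inv_mat (TIL d) * 0\<^sub>m h 0 \<in> carrier_mat h 0"
      using inv_mat_props[OF TL] by auto
    have c: "upper_rows \<rho> (inv_mat (TIL d) * 0\<^sub>m h 0) *\<^sub>v 0\<^sub>v 0 = 0\<^sub>v \<rho>"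
      "lower_rows \<rho> (inv_mat (TIL d) * 0\<^sub>m h 0) *\<^sub>v 0\<^sub>v 0 = 0\<^sub>v (h - \<rho>)"
      using upper_lower_rows_carrier[OF N(2)] by (blast intro: mult_mat_zero_vec)+
    have "Hm d 0 *\<^sub>v \<xi> + 0\<^sub>m h 0 *\<^sub>v 0\<^sub>v 0 = Hm d 0 *\<^sub>v \<xi>"
      using Hc \<xi> zero_mult_mat_vec[of "0\<^sub>v 0" 0 h] by simp
    then show ?thesis
      using decomposition_constraint_iff[OF Hc N(1) dec' refl \<xi> zero_carrier_vec[of 0]] c T_def by simp
  qed
  have inj: "T *\<^sub>v (0\<^sub>v \<rho> @\<^sub>v y) = 0\<^sub>v n \<longleftrightarrow> y = 0\<^sub>v (n - \<rho>)" if y: "y \<in> carrier_vec (n - \<rho>)" for y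
  proof -
    have "T *\<^sub>v (0\<^sub>v \<rho> @\<^sub>v y) = 0\<^sub>v n \<longleftrightarrow> 0\<^sub>v \<rho> @\<^sub>v y = 0\<^sub>v n"
      using mult_mat_vec_inv_cancel[OF TR(1) T(1,2) app[OF y]] mult_mat_zero_vec[OF TR(1)] mult_mat_zero_vec[OF T(1)] by metis
    then show ?thesis using append_vec_eq_zero_iff[of "0\<^sub>v \<rho>" \<rho> y "n - \<rho>"] y \<rho> by simp
  qed
  have "pos_def_mat (P_hat_I d) \<longleftrightarrow> (\<forall>y \<in> carrier_vec (n - \<rho>). y \<noteq> 0\<^sub>v (n - \<rho>) \<longrightarrow> quad M4 y > 0)"
    unfolding PI by (rule pos_def_mat_iff_quad[OF S(3,5)])
  also have "\<dots> \<longleftrightarrow> (\<forall>\<xi> \<in> carrier_vec n. Hm d 0 *\<^sub>v \<xi> = 0\<^sub>v h \<longrightarrow> \<xi> \<noteq> 0\<^sub>v n \<longrightarrow> quad (Pm d 0) \<xi> > 0)"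
  proof
    assume L: "\<forall>y \<in> carrier_vec (n - \<rho>). y \<noteq> 0\<^sub>v (n - \<rho>) \<longrightarrow> quad M4 y > 0"
    show "\<forall>\<xi> \<in> carrier_vec n. Hm d 0 *\<^sub>v \<xi> = 0\<^sub>v h \<longrightarrow> \<xi> \<noteq> 0\<^sub>v n \<longrightarrow> quad (Pm d 0) \<xi> > 0"
      using L ker inj qd by metis
  next
    assume R: "\<forall>\<xi> \<in> carrier_vec n. Hm d 0 *\<^sub>v \<xi> = 0\<^sub>v h \<longrightarrow> \<xi> \<noteq> 0\<^sub>v n \<longrightarrow> quad (Pm d 0) \<xi> > 0"
    show "\<forall>y \<in> carrier_vec (n - \<rho>). y \<noteq> 0\<^sub>v (n - \<rho>) \<longrightarrow> quad M4 y > 0"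
    proof (intro ballI impI)
      fix y :: "real vec" assume y: "y \<in> carrier_vec (n - \<rho>)" "y \<noteq> 0\<^sub>v (n - \<rho>)"
      have "T *\<^sub>v (0\<^sub>v \<rho> @\<^sub>v y) \<in> carrier_vec n" using T(1) app[OF y(1)] by auto
      then show "quad M4 y > 0" using R ker inj[OF y(1)] qd[OF y(1)] y by metis
    qed
  qed
  finally show ?thesis unfolding h_def .
qed

lemma exact_run_correct:
  assumes p: "lq_problem p" and run: "algorithm_run p \<epsilon> d" and exact: "exact_factors p d"
  shows "trajectories_positive p \<longleftrightarrow>
    (\<forall>k < hor p. pos_def_mat (R_hat p d k)) \<and> pos_def_mat (P_hat_I d)"
proof (cases "\<forall>k < hor p. pos_def_mat (R_hat p d k)")
  case True
  have V: "value_function p d 0"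
    by (rule exact_run_value_function[OF p run])
      (use True exact in \<open>auto simp: exact_factors_def stage_reached_def\<close>)
  have "exact_decomposition (Hm d 0) (TIL d) (TIR d)" using run True unfolding algorithm_run_def by simp
  then show ?thesis using True value_function_positive_iff[OF V] P_hat_I_pos_def_iff[OF value_functionD(1-3)[OF V]] by simp
next
  case False
  \<comment> \<open>Stages are processed backwards, so the failing stage met first is the one of largest index.\<close>
  define k where "k = Max {k. k < hor p \<and> \<not> pos_def_mat (R_hat p d k)}"
  let ?S = "{k. k < hor p \<and> \<not> pos_def_mat (R_hat p d k)}"
  have "k \<in> ?S" unfolding k_def by (rule Max_in) (use False in auto)
  then have fail: "k < hor p" "\<not> pos_def_mat (R_hat p d k)" by auto
  have later: "pos_def_mat (R_hat p d j)" if "k < j" "j < hor p" for j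
    proof (rule ccontr)
    assume "\<not> pos_def_mat (R_hat p d j)"
    then have "j \<le> k" unfolding k_def using that by (intro Max_ge) auto
    then show False using that by simp
  qed
  have V: "value_function p d (Suc k)"
    by (rule exact_run_value_function[OF p run])
      (use fail later exact in \<open>auto simp: exact_factors_def stage_reached_def\<close>)
  have reached: "stage_reached p d k" using later unfolding stage_reached_def by simp
  interpret stage p d k by (rule run_stage(1)[OF p run fail(1) reached value_functionD(1-3)[OF V]])
  have "Em d k = 0\<^sub>m (dim_row (Em d k)) (dim_col (Em d k))" using exact fail reached unfolding exact_factors_def by simp
  from not_pos_def_trajectory[OF V this fail(2)] obtain u x where
    f: "tail_feasible p k u x" "x k = 0\<^sub>v (nx p)" "u k \<noteq> 0\<^sub>v (nu p)" "tail_cost p k u x \<le> 0" .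
  from extend_by_zero[OF p f(1,2)] fail(1) f(3,4) have "\<not> trajectories_positive p"
    unfolding trajectories_positive_def tail_zero_def by (force simp: not_less)
  then show ?thesis using False by blast
qed

section \<open>The reduced Hessian and homogeneous trajectories\<close>

text \<open>Removing offsets and linear costs turns the affine description of feasibility and the cost function into
the kernel of the constraint matrix and its quadratic form, so the correspondence between trajectories and
stacked vectors can be reused.\<close>

definition homogeneous :: "lq_data \<Rightarrow> lq_data" where
  "homogeneous p = p\<lparr>bv := \<lambda>_. 0\<^sub>v (nx p), gv := \<lambda>k. 0\<^sub>v (dim_vec (gv p k)), gT := 0\<^sub>v (dim_vec (gT p)),
     rv := \<lambda>_. 0\<^sub>v (nu p), qv := \<lambda>_. 0\<^sub>v (nx p)\<rparr>"

lemma homogeneous_simps: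
  "hor (homogeneous p) = hor p" "nx (homogeneous p) = nx p" "nu (homogeneous p) = nu p"
  "lq_problem p \<Longrightarrow> lq_problem (homogeneous p)" "stack (homogeneous p) = stack p"
  "constraint_mat (homogeneous p) = constraint_mat p" "hessian_mat (homogeneous p) = hessian_mat p"
proof -
  show s: "hor (homogeneous p) = hor p" "nx (homogeneous p) = nx p" "nu (homogeneous p) = nu p"
    by (auto simp: homogeneous_def)
  show "lq_problem p \<Longrightarrow> lq_problem (homogeneous p)"
    unfolding lq_problem_def by (auto simp: homogeneous_def)
  show "stack (homogeneous p) = stack p" unfolding stack_def by (auto simp: homogeneous_def fun_eq_iff)
  have st: "stack_dim (homogeneous p) = stack_dim p" unfolding stack_dim_def s ..
  have x: "x_sel (homogeneous p) = x_sel p" "u_sel (homogeneous p) = u_sel p"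
    unfolding x_sel_def u_sel_def st s x_pos_def u_pos_def by (auto simp: fun_eq_iff)
  have r: "dynamics_rows (homogeneous p) = dynamics_rows p" "path_rows (homogeneous p) = path_rows p"
    unfolding dynamics_rows_def path_rows_def x by (auto simp: homogeneous_def fun_eq_iff)
  show "constraint_mat (homogeneous p) = constraint_mat p"
    unfolding constraint_mat_def r x s by (simp add: homogeneous_def)
  have "stage_hessian (homogeneous p) = stage_hessian p"
    unfolding stage_hessian_def by (auto simp: homogeneous_def fun_eq_iff)
  then show "hessian_mat (homogeneous p) = hessian_mat p"
    unfolding hessian_mat_def s by (simp add: homogeneous_def)
qed

definition trajectory_dims :: "lq_data \<Rightarrow> (nat \<Rightarrow> real vec) \<Rightarrow> (nat \<Rightarrow> real vec) \<Rightarrow> bool" where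
  "trajectory_dims p u x \<longleftrightarrow> (\<forall>k < hor p. u k \<in> carrier_vec (nu p)) \<and> (\<forall>k \<le> hor p. x k \<in> carrier_vec (nx p))"

lemma stack_unstack:
  assumes p: "lq_problem p" and z: "z \<in> carrier_vec (stack_dim p)"
  obtains u x where "trajectory_dims p u x" "stack p u x = z"
proof -
  define N where "N = nu p + nx p"
  define u where "u k = vec (nu p) (\<lambda>i. z $ (u_pos p k + i))" for k
  define x where "x k = vec (nx p) (\<lambda>i. z $ (x_pos p k + i))" for k
  have c: "\<And>k. k < hor p \<Longrightarrow> u k \<in> carrier_vec (nu p)" "\<And>k. k \<le> hor p \<Longrightarrow> x k \<in> carrier_vec (nx p)"
    by (auto simp: u_def x_def)
  have N0: "N > 0" using p unfolding N_def lq_problem_def by auto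
  have S: "stack p u x \<in> carrier_vec (stack_dim p)" using stack_carrier[of p u x] p c by blast
  have I: "\<And>k i. k < hor p \<Longrightarrow> i < N \<Longrightarrow> stack p u x $ (k * N + i) = (u k @\<^sub>v x k) $ i"
    "\<And>i. i < nx p \<Longrightarrow> stack p u x $ (hor p * N + i) = x (hor p) $ i"
    using stack_index[of p u x] p c unfolding N_def by blast+
  have "stack p u x = z"
  proof (rule eq_vecI)
    show "dim_vec (stack p u x) = dim_vec z" using S z by auto
    fix i assume "i < dim_vec z"
    then have i: "i < hor p * N + nx p" using z unfolding stack_dim_def N_def by auto
    show "stack p u x $ i = z $ i"
    proof (cases "i < hor p * N")
      case True
      define k where "k = i div N"
      define r where "r = i mod N"
      have ik: "i = k * N + r" and r: "r < N" using N0 by (auto simp: k_def r_def)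
      have k: "k < hor p" unfolding k_def using True by (simp add: less_mult_imp_div_less)
      show ?thesis
        using I(1)[OF k r] r unfolding ik u_def x_def
        by (cases "r < nu p") (auto simp: u_pos_def x_pos_def k N_def add.assoc)
    next
      case False
      then obtain r where r: "i = hor p * N + r" "r < nx p" using i by (metis add_less_cancel_left le_Suc_ex not_less)
      show ?thesis using I(2)[OF r(2)] r unfolding x_def by (simp add: x_pos_def N_def)
    qed
  qed
  then show ?thesis using that c unfolding trajectory_dims_def by blast
qed

lemma stack_eq_0_iff:
  assumes p: "lq_problem p" and t: "trajectory_dims p u x"
  shows "stack p u x = 0\<^sub>v (stack_dim p) \<longleftrightarrow> tail_zero p 0 u x"
proof
  have c: "\<And>k. k < hor p \<Longrightarrow> u k \<in> carrier_vec (nu p)" "\<And>k. k \<le> hor p \<Longrightarrow> x k \<in> carrier_vec (nx p)"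
    using t unfolding trajectory_dims_def by auto
  {
    assume z: "stack p u x = 0\<^sub>v (stack_dim p)"
    have "u k = 0\<^sub>v (nu p)" if "k < hor p" for k
      using u_sel_stack[of p u x, OF p c that] mult_mat_zero_vec[OF sel_carrier(1)[of p u x, OF p c]] unfolding z by simp
    moreover have "x k = 0\<^sub>v (nx p)" if "k \<le> hor p" for k
      using x_sel_stack[of p u x, OF p c that] mult_mat_zero_vec[OF sel_carrier(2)[of p u x, OF p c]] unfolding z by simp
    ultimately show "tail_zero p 0 u x" unfolding tail_zero_def by simp
  }
  assume z: "tail_zero p 0 u x"
  have "foldr (\<lambda>k z. (u k @\<^sub>v x k) @\<^sub>v z) ks (x (hor p)) = 0\<^sub>v (length ks * (nu p + nx p) + nx p)"
    if "set ks \<subseteq> {..<hor p}" for ks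
    using that
  proof (induction ks)
    case (Cons k ks)
    then have k: "u k = 0\<^sub>v (nu p)" "x k = 0\<^sub>v (nx p)"
      and IH: "foldr (\<lambda>k z. (u k @\<^sub>v x k) @\<^sub>v z) ks (x (hor p)) = 0\<^sub>v (length ks * (nu p + nx p) + nx p)"
      using z unfolding tail_zero_def by auto
    show ?case by (simp add: IH k) (auto intro!: eq_vecI)
  qed (use z in \<open>auto simp: tail_zero_def\<close>)
  from this[of "[0..<hor p]"] show "stack p u x = 0\<^sub>v (stack_dim p)"
    unfolding stack_def stack_dim_def by (simp add: subset_iff)
qed

lemma constraint_mat_carrier:
  assumes p: "lq_problem p"
  shows "constraint_mat p \<in> carrier_mat (dim_row (constraint_mat p)) (stack_dim p)"
proof -
  have "[0..<hor p] = 0 # [1..<hor p]" using p unfolding lq_problem_def by (simp add: upt_conv_Cons)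
  moreover have "dim_col (dynamics_rows p 0) = stack_dim p" unfolding dynamics_rows_def by (simp add: x_sel_def)
  ultimately have "dim_col (constraint_mat p) = stack_dim p" unfolding constraint_mat_def append_rows_def by simp
  then show ?thesis by auto
qed

lemma diag_block_mat_symmetric:
  assumes "\<forall>M \<in> set Ms. square_mat M \<and> M\<^sup>T = M"
  shows "square_mat (diag_block_mat Ms) \<and> (diag_block_mat Ms)\<^sup>T = diag_block_mat Ms"
  using assms
proof (induction Ms)
  case (Cons M Ms)
  define D where "D = diag_block_mat Ms"
  define a where "a = dim_row M"
  define b where "b = dim_row D"
  have M: "M \<in> carrier_mat a a" "M\<^sup>T = M" using Cons.prems by (auto simp: a_def)
  have D: "D \<in> carrier_mat b b" "D\<^sup>T = D" using Cons by (auto simp: b_def D_def)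
  have eq: "diag_block_mat (M # Ms) = four_block_mat M (0\<^sub>m a b) (0\<^sub>m b a) D"
    using M(1) D(1) unfolding D_def[symmetric] diag_block_mat.simps Let_def by simp
  have "(four_block_mat M (0\<^sub>m a b) (0\<^sub>m b a) D)\<^sup>T = four_block_mat M (0\<^sub>m a b) (0\<^sub>m b a) D"
    using transpose_four_block_mat[OF M(1) zero_carrier_mat zero_carrier_mat D(1)] M(2) D(2)
    by (simp add: zero_transpose_mat)
  then show ?case unfolding eq using M(1) D(1) by simp
qed auto

lemma hessian_mat_carrier:
  assumes p: "lq_problem p"
  shows "hessian_mat p \<in> carrier_mat (stack_dim p) (stack_dim p)" "(hessian_mat p)\<^sup>T = hessian_mat p"
proof -
  have c: "stage_hessian p k \<in> carrier_mat (nu p + nx p) (nu p + nx p)" "(stage_hessian p k)\<^sup>T = stage_hessian p k"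
    if "k < hor p" for k
    using p that transpose_four_block_mat[of "Rm p k" "nu p" "nu p" "(Sm p k)\<^sup>T" "nx p" "Sm p k" "nx p" "Qm p k"]
    unfolding stage_hessian_def lq_problem_def by auto
  have Q: "Qm p (hor p) \<in> carrier_mat (nx p) (nx p)" "(Qm p (hor p))\<^sup>T = Qm p (hor p)"
    using p unfolding lq_problem_def by auto
  have "square_mat (hessian_mat p) \<and> (hessian_mat p)\<^sup>T = hessian_mat p"
    unfolding hessian_mat_def by (rule diag_block_mat_symmetric) (use c(2) c(1)[THEN carrier_matD(1)] c(1)[THEN carrier_matD(2)] Q in auto)
  moreover have "map dim_row (map (stage_hessian p) [0..<hor p]) = replicate (hor p) (nu p + nx p)"
    using c by (intro nth_equalityI) auto
  then have "dim_row (hessian_mat p) = stack_dim p"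
    unfolding hessian_mat_def dim_diag_block_mat stack_dim_def using Q by (simp add: sum_list_replicate)
  ultimately show "hessian_mat p \<in> carrier_mat (stack_dim p) (stack_dim p)" "(hessian_mat p)\<^sup>T = hessian_mat p" by auto
qed

lemma stack_kernel_iff:
  assumes p: "lq_problem p" and t: "trajectory_dims p u x"
  shows "stack p u x \<in> mat_kernel (constraint_mat p) \<longleftrightarrow> tail_feasible p 0 u x"
proof -
  let ?h = "homogeneous p" and ?A = "constraint_mat p"
  have feas: "lq_feasible ?h u x \<longleftrightarrow> tail_feasible p 0 u x" if t: "trajectory_dims p u x" for u x
  proof -
    have bu: "Bm p k *\<^sub>v u k + Am p k *\<^sub>v x k + 0\<^sub>v (nx p) = Bm p k *\<^sub>v u k + Am p k *\<^sub>v x k" if "k < hor p" for k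
      using p t that unfolding lq_problem_def trajectory_dims_def
      by (intro right_zero_vec add_carrier_vec mult_mat_vec_carrier[of _ _ "nu p"] mult_mat_vec_carrier[of _ _ "nx p"]) auto
    have g: "dim_row (GT p) = dim_vec (gT p)" using p unfolding lq_problem_def by auto
    show ?thesis
      using t unfolding lq_feasible_def tail_feasible_def trajectory_dims_def g
      by (auto simp: homogeneous_def bu)
  qed
  have iff: "tail_feasible p 0 u x \<longleftrightarrow> ?A *\<^sub>v stack p u x = constraint_rhs ?h" if t: "trajectory_dims p u x" for u x
    using lq_feasible_iff[of ?h u x] t feas[OF t] p unfolding trajectory_dims_def homogeneous_simps(1-3,5,6)
    by (simp add: homogeneous_simps(4))
  \<comment> \<open>The right-hand side is zero because the zero trajectory is feasible and is stacked to the zero vector.\<close>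
  have z: "trajectory_dims p (\<lambda>_. 0\<^sub>v (nu p)) (\<lambda>_. 0\<^sub>v (nx p))" unfolding trajectory_dims_def by auto
  have "tail_feasible p (hor p) (\<lambda>_. 0\<^sub>v (nu p)) (\<lambda>_. 0\<^sub>v (nx p))"
    using p unfolding tail_feasible_def lq_problem_def by (auto simp: mult_mat_zero_vec)
  from extend_by_zero(1)[OF p this] have "tail_feasible p 0 (\<lambda>_. 0\<^sub>v (nu p)) (\<lambda>_. 0\<^sub>v (nx p))" by simp
  then have "constraint_rhs ?h = ?A *\<^sub>v 0\<^sub>v (stack_dim p)"
    using iff[OF z] stack_eq_0_iff[OF p z] by (simp add: tail_zero_def)
  also have "\<dots> = 0\<^sub>v (dim_row ?A)" by (rule mult_mat_zero_vec[OF constraint_mat_carrier[OF p]])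
  finally have rhs: "constraint_rhs ?h = 0\<^sub>v (dim_row ?A)" .
  have "stack p u x \<in> carrier_vec (stack_dim p)"
    using stack_carrier[OF p] t unfolding trajectory_dims_def by blast
  then show ?thesis unfolding iff[OF t] rhs mat_kernel[OF constraint_mat_carrier[OF p]] by simp
qed

lemma stack_hessian_cost:
  assumes p: "lq_problem p" and t: "trajectory_dims p u x"
  shows "quad (hessian_mat p) (stack p u x) = tail_cost p 0 u x"
proof -
  let ?h = "homogeneous p"
  have c: "\<And>k. k < hor p \<Longrightarrow> u k \<in> carrier_vec (nu p)" "\<And>k. k \<le> hor p \<Longrightarrow> x k \<in> carrier_vec (nx p)"
    using t unfolding trajectory_dims_def by auto
  have z: "(0\<^sub>v (nu p) @\<^sub>v 0\<^sub>v (nx p)) = (0\<^sub>v (nu p + nx p) :: real vec)" by (intro eq_vecI) auto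
  have "(\<Sum>k<hor p. (rv ?h k @\<^sub>v qv ?h k) \<bullet> (u k @\<^sub>v x k)) = 0"
    using c append_carrier_vec by (intro sum.neutral) (auto simp: homogeneous_def z)
  moreover have "qv ?h (hor p) \<bullet> x (hor p) = 0" using c(2)[of "hor p"] by (simp add: homogeneous_def)
  ultimately have "lq_objective ?h u x = 1/2 * quad (hessian_mat p) (stack p u x)"
    using lq_objective_eq[of ?h u x] c p unfolding quad_def homogeneous_simps(1-3,5,7) by (simp add: homogeneous_simps(4))
  moreover have "lq_objective ?h u x = 1/2 * tail_cost p 0 u x"
  proof -
    have "stage_hessian ?h = stage_hessian p" unfolding stage_hessian_def by (auto simp: homogeneous_def fun_eq_iff)
    moreover have "(0\<^sub>v (nu p) @\<^sub>v 0\<^sub>v (nx p)) \<bullet> (u k @\<^sub>v x k) = 0" if "k < hor p" for k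
      unfolding z using that c(1)[of k] c(2)[of k] by simp
    ultimately show ?thesis
      unfolding lq_objective_def tail_cost_def stage_cost_def quad_def homogeneous_simps(1)
      using c(2)[of "hor p"] by (simp add: homogeneous_def sum_distrib_left lessThan_atLeast0 distrib_left)
  qed
  ultimately show ?thesis by simp
qed

lemma trajectories_positive_iff:
  assumes p: "lq_problem p"
  shows "trajectories_positive p \<longleftrightarrow>
    (\<forall>z \<in> mat_kernel (constraint_mat p). z \<noteq> 0\<^sub>v (stack_dim p) \<longrightarrow> quad (hessian_mat p) z > 0)"
proof
  assume pos: "trajectories_positive p"
  show "\<forall>z \<in> mat_kernel (constraint_mat p). z \<noteq> 0\<^sub>v (stack_dim p) \<longrightarrow> quad (hessian_mat p) z > 0"
  proof (intro ballI impI)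
    fix z assume z: "z \<in> mat_kernel (constraint_mat p)" "z \<noteq> 0\<^sub>v (stack_dim p)"
    then have "z \<in> carrier_vec (stack_dim p)" using mat_kernel[OF constraint_mat_carrier[OF p]] by auto
    from stack_unstack[OF p this] obtain u x where t: "trajectory_dims p u x" "stack p u x = z" .
    then show "quad (hessian_mat p) z > 0"
      using pos z stack_kernel_iff[OF p t(1)] stack_hessian_cost[OF p t(1)] stack_eq_0_iff[OF p t(1)]
      unfolding trajectories_positive_def by auto
  qed
next
  assume R: "\<forall>z \<in> mat_kernel (constraint_mat p). z \<noteq> 0\<^sub>v (stack_dim p) \<longrightarrow> quad (hessian_mat p) z > 0"
  show "trajectories_positive p" unfolding trajectories_positive_def
  proof (intro allI impI, elim conjE)
    fix u x assume f: "tail_feasible p 0 u x" "\<not> tail_zero p 0 u x"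
    then have t: "trajectory_dims p u x" unfolding trajectory_dims_def tail_feasible_def by auto
    show "tail_cost p 0 u x > 0"
      using R f stack_kernel_iff[OF p t] stack_hessian_cost[OF p t] stack_eq_0_iff[OF p t] by metis
  qed
qed

lemma nullspace_basis_mat_image:
  assumes A: "A \<in> carrier_mat nr n" and Z: "nullspace_basis_mat A Z" and c: "dim_col Z = c"
  shows "Z \<in> carrier_mat n c"
    "mat_kernel A = (\<lambda>w. Z *\<^sub>v w) ` carrier_vec c"
    "\<And>w. w \<in> carrier_vec c \<Longrightarrow> Z *\<^sub>v w = 0\<^sub>v n \<Longrightarrow> w = 0\<^sub>v c"
proof -
  interpret kernel nr n A by unfold_locales (rule A)
  have Zc: "Z \<in> carrier_mat n c" and dist: "distinct (cols Z)" and b: "basis (set (cols Z))"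
    using Z A c unfolding nullspace_basis_mat_def by auto
  show "Z \<in> carrier_mat n c" by (rule Zc)
  from b have ind: "\<not> lin_dep (set (cols Z))" and gen: "span (set (cols Z)) = mat_kernel A"
    and sub: "set (cols Z) \<subseteq> mat_kernel A" unfolding Ker.basis_def by auto
  have ind': "\<not> NC.lin_dep (set (cols Z))" using ind lindep_same[OF sub] by simp
  show "w = 0\<^sub>v c" if "w \<in> carrier_vec c" "Z *\<^sub>v w = 0\<^sub>v n" for w
    using NC.lin_depI[OF Zc that(1) _ that(2) dist] ind' by auto
  have subc: "set (cols Z) \<subseteq> carrier_vec n" using Zc cols_dim by blast
  have "mat_kernel A = NC.span (set (cols Z))" using gen span_same[OF sub] by simp
  also have "\<dots> = {NC.lincomb a (set (cols Z)) | a. a \<in> set (cols Z) \<rightarrow> UNIV}"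
    using NC.finite_span[OF _ subc[folded module_vec_simps(3)]] by (simp add: class_ring_simps)
  also have "\<dots> = (\<lambda>w. Z *\<^sub>v w) ` carrier_vec c"
  proof (intro equalityI subsetI)
    fix z assume "z \<in> {NC.lincomb a (set (cols Z)) | a. a \<in> set (cols Z) \<rightarrow> UNIV}"
    then obtain a where z: "z = NC.lincomb a (set (cols Z))" by auto
    show "z \<in> (\<lambda>w. Z *\<^sub>v w) ` carrier_vec c"
      unfolding z using NC.mat_mult_eq_lincomb[OF Zc dist, of a] by (metis imageI vec_carrier)
  next
    fix z assume "z \<in> (\<lambda>w. Z *\<^sub>v w) ` carrier_vec c"
    then obtain w where w: "w \<in> carrier_vec c" "z = Z *\<^sub>v w" by auto
    show "z \<in> {NC.lincomb a (set (cols Z)) | a. a \<in> set (cols Z) \<rightarrow> UNIV}"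
      unfolding w(2) NC.lincomb_eq_mat_mult[OF Zc w(1) dist, symmetric] by blast
  qed
  finally show "mat_kernel A = (\<lambda>w. Z *\<^sub>v w) ` carrier_vec c" .
qed

lemma reduced_hessian_pos_def_iff:
  assumes p: "lq_problem p" and Z: "nullspace_basis_mat (constraint_mat p) Z"
  shows "pos_def_mat (reduced_hessian p Z) \<longleftrightarrow> trajectories_positive p"
proof -
  define c where "c = dim_col Z"
  note B = nullspace_basis_mat_image[OF constraint_mat_carrier[OF p] Z c_def[symmetric]]
  note H = hessian_mat_carrier[OF p]
  have "reduced_hessian p Z \<in> carrier_mat c c" unfolding reduced_hessian_def using B(1) H by auto
  moreover have "(reduced_hessian p Z)\<^sup>T = reduced_hessian p Z"
    unfolding reduced_hessian_def by (rule transpose_congruence[OF H B(1)])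
  ultimately have "pos_def_mat (reduced_hessian p Z) \<longleftrightarrow>
    (\<forall>w \<in> carrier_vec c. w \<noteq> 0\<^sub>v c \<longrightarrow> quad (reduced_hessian p Z) w > 0)"
    by (rule pos_def_mat_iff_quad)
  also have "\<dots> \<longleftrightarrow> (\<forall>w \<in> carrier_vec c. Z *\<^sub>v w \<noteq> 0\<^sub>v (stack_dim p) \<longrightarrow> quad (hessian_mat p) (Z *\<^sub>v w) > 0)"
    unfolding reduced_hessian_def using quad_congruence[OF H(1) B(1)] B(3) mult_mat_zero_vec[OF B(1)] by metis
  also have "\<dots> \<longleftrightarrow> trajectories_positive p" unfolding trajectories_positive_iff[OF p] B(2) by blast
  finally show ?thesis .
qed

section \<open>The entrywise sum norm\<close>

text \<open>This norm is submultiplicative with constant one and does not grow when passing to a submatrix, so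
products can be bounded without reference to the dimensions, which vary from run to run.\<close>

definition msum :: "real mat \<Rightarrow> real" where
  "msum M = (\<Sum>i<dim_row M. \<Sum>j<dim_col M. \<bar>M $$ (i, j)\<bar>)"

lemma msum_nonneg: "msum M \<ge> 0"
  unfolding msum_def by (intro sum_nonneg) auto

lemma msum_mult:
  assumes A: "A \<in> carrier_mat m n" and B: "B \<in> carrier_mat n k"
  shows "msum (A * B) \<le> msum A * msum B"
proof -
  let ?b = "\<lambda>l. \<Sum>j<k. \<bar>B $$ (l, j)\<bar>"
  have b: "?b l \<le> msum B" if "l < n" for l
    using member_le_sum[of l "{..<n}" ?b] B that unfolding msum_def by (simp add: sum_nonneg)
  have "msum (A * B) = (\<Sum>i<m. \<Sum>j<k. \<bar>\<Sum>l<n. A $$ (i, l) * B $$ (l, j)\<bar>)"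
    unfolding msum_def using A B by (auto simp: scalar_prod_def lessThan_atLeast0 intro!: sum.cong)
  also have "\<dots> \<le> (\<Sum>i<m. \<Sum>j<k. \<Sum>l<n. \<bar>A $$ (i, l)\<bar> * \<bar>B $$ (l, j)\<bar>)"
    by (intro sum_mono order.trans[OF sum_abs]) (simp add: abs_mult)
  also have "\<dots> = (\<Sum>i<m. \<Sum>l<n. \<bar>A $$ (i, l)\<bar> * ?b l)"
    by (simp add: sum_distrib_left sum.swap[of _ "{..<k}"])
  also have "\<dots> \<le> (\<Sum>i<m. \<Sum>l<n. \<bar>A $$ (i, l)\<bar> * msum B)"
    using b by (intro sum_mono mult_left_mono) auto
  also have "\<dots> = msum A * msum B"
    unfolding msum_def using A by (simp add: sum_distrib_right)
  finally show ?thesis .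
qed

lemma msum_eq_0: "M \<in> carrier_mat m n \<Longrightarrow> msum M = 0 \<Longrightarrow> M = 0\<^sub>m m n"
  unfolding msum_def by (intro eq_matI) (auto simp: sum_nonneg_eq_0_iff sum_nonneg)

lemma msum_le_entries:
  assumes "M \<in> carrier_mat m n" "\<And>i j. i < m \<Longrightarrow> j < n \<Longrightarrow> \<bar>M $$ (i, j)\<bar> \<le> c"
  shows "msum M \<le> real m * real n * c"
proof -
  have "msum M \<le> (\<Sum>i<m. \<Sum>j<n. c)" unfolding msum_def carrier_matD[OF assms(1)] by (intro sum_mono) (use assms(2) in auto)
  then show ?thesis by simp
qed

lemma msum_submatrix:
  assumes M: "M \<in> carrier_mat (a + m) (b + n)"
  shows "msum (mat m n (\<lambda>(i, j). M $$ (a + i, b + j))) \<le> msum M"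
proof -
  have "msum (mat m n (\<lambda>(i, j). M $$ (a + i, b + j))) = (\<Sum>i<m. \<Sum>j<n. \<bar>M $$ (a + i, b + j)\<bar>)"
    unfolding msum_def by simp
  also have "\<dots> = (\<Sum>i\<in>(+) a ` {..<m}. \<Sum>j\<in>(+) b ` {..<n}. \<bar>M $$ (i, j)\<bar>)"
    by (simp add: sum.reindex)
  also have "\<dots> \<le> (\<Sum>i\<in>(+) a ` {..<m}. \<Sum>j<b + n. \<bar>M $$ (i, j)\<bar>)"
    by (intro sum_mono sum_mono2) auto
  also have "\<dots> \<le> (\<Sum>i<a + m. \<Sum>j<b + n. \<bar>M $$ (i, j)\<bar>)"
    by (intro sum_mono2) (auto intro: sum_nonneg)
  finally show ?thesis unfolding msum_def using M by simp
qed

section \<open>Nearly singular blocks vanish\<close>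

lemma assoc_mult_mat_dim:
  "dim_col A = dim_row B \<Longrightarrow> dim_col B = dim_row C \<Longrightarrow> (A * B) * C = A * (B * (C :: real mat))"
  by (rule assoc_mult_mat[of A "dim_row A" "dim_row B" B "dim_row C" C "dim_col C"]) auto

text \<open>If \<open>R = P M\<close> is the reduced row echelon form, let \<open>R'\<close> have a one at \<open>(f i, i)\<close> for every row \<open>i\<close> with
pivot column \<open>f i\<close>. The pivot columns are unit vectors, hence \<open>R R'\<close> is the projection onto the nonzero
rows and \<open>R R' R = R\<close>; then \<open>R' P\<close> is a generalized inverse of \<open>M\<close>.\<close>

lemma generalized_inverse_exists:
  fixes M :: "real mat"
  assumes M: "M \<in> carrier_mat m n"
  obtains N where "N \<in> carrier_mat n m" "M * N * M = M"
proof -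
  obtain R B where g: "gauss_jordan M (1\<^sub>m m) = (R, B)" by (cases "gauss_jordan M (1\<^sub>m m)")
  from gauss_jordan_transform[OF M one_carrier_mat g, of "()"] obtain P where
    PU: "P \<in> Units (ring_mat TYPE(real) m ())" and R: "R = P * M" by auto
  then obtain P' where P: "P \<in> carrier_mat m m" "P' \<in> carrier_mat m m" "P' * P = 1\<^sub>m m"
    unfolding Units_def ring_mat_def by auto
  have Rc: "R \<in> carrier_mat m n" using R P M by simp
  have "row_echelon_form R" by (rule gauss_jordan_row_echelon[OF M g])
  then obtain f where f: "pivot_fun R f n" unfolding row_echelon_form_def using Rc by auto
  have dR: "dim_row R = m" using Rc by simp
  note piv = pivot_funD[OF dR f]
  \<comment> \<open>For a zero row \<open>f i = n\<close>, which is no column index, so the corresponding column of \<open>R'\<close> is zero.\<close>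
  define R' where "R' = mat n m (\<lambda>(j, i). if j = f i then 1 else 0 :: real)"
  have R': "R' \<in> carrier_mat n m" unfolding R'_def by simp
  have RR': "R * R' = mat m m (\<lambda>(i, l). if i = l \<and> f l < n then 1 else 0)"
  proof (rule eq_matI)
    fix i l assume "i < dim_row (mat m m (\<lambda>(i, l). if i = l \<and> f l < n then 1 else 0))"
      "l < dim_col (mat m m (\<lambda>(i, l). if i = l \<and> f l < n then 1 else 0))"
    then have il: "i < m" "l < m" by auto
    have "(R * R') $$ (i, l) = (\<Sum>j = 0..<n. if j = f l then R $$ (i, j) else 0)"
      using il Rc R' by (simp add: scalar_prod_def R'_def if_distrib[of "\<lambda>t. _ * t"] cong: if_cong)
    also have "\<dots> = (if f l < n then R $$ (i, f l) else 0)" by simp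
    also have "\<dots> = (if i = l \<and> f l < n then 1 else 0)" using piv(4)[OF il(2)] piv(5)[OF il(2) _ il(1)] by auto
    finally show "(R * R') $$ (i, l) = mat m m (\<lambda>(i, l). if i = l \<and> f l < n then 1 else 0) $$ (i, l)" using il by simp
  qed (use Rc R' in auto)
  have RRR: "R * R' * R = R"
  proof (rule eq_matI)
    fix i j assume "i < dim_row R" "j < dim_col R"
    then have ij: "i < m" "j < n" using Rc by auto
    have "(R * R' * R) $$ (i, j) = (\<Sum>l = 0..<m. (if i = l \<and> f l < n then 1 else 0) * R $$ (l, j))"
      unfolding RR' using ij Rc by (simp add: scalar_prod_def)
    also have "\<dots> = (\<Sum>l = 0..<m. if l = i then (if f i < n then R $$ (i, j) else 0) else 0)"
      by (intro sum.cong) auto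
    also have "\<dots> = R $$ (i, j)" using ij piv(1)[OF ij(1)] piv(2)[OF ij(1)] by auto
    finally show "(R * R' * R) $$ (i, j) = R $$ (i, j)" .
  qed (use Rc R' in auto)
  have PM: "P' * R = M" unfolding R using P M assoc_mult_mat_dim[of P' P M] by simp
  have "M * (R' * P) * M = P' * R * (R' * P) * M" using PM by simp
  also have "\<dots> = P' * (R * R' * R)"
    using P M Rc R' R by (simp add: assoc_mult_mat_dim)
  also have "\<dots> = M" unfolding RRR PM ..
  finally show ?thesis using that[of "R' * P"] R' P by auto
qed

text \<open>With \<open>D\<close> the middle factor and \<open>X = T\<^sub>2 N T\<^sub>1\<close>, cancelling the outer factors in \<open>M N M = M\<close> gives
\<open>D X D = D\<close>. As \<open>D\<close> is block diagonal, its lower right block satisfies \<open>E = E Y E\<close>, so that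
\<open>|E| \<le> |E| |Y| |E|\<close>, which forces \<open>E = 0\<close> once \<open>|E| |Y| < 1\<close>. This is the elementary form of the
statement that the nonzero singular values of \<open>M\<close> are bounded away from zero.\<close>

lemma small_residual_vanishes:
  assumes M: "M \<in> carrier_mat m n" and dec: "decomposition M T1 \<rho> E T2"
    and N: "N \<in> carrier_mat n m" "M * N * M = M"
    and small: "msum E * (msum T2 * msum N * msum T1) < 1"
  shows "E = 0\<^sub>m (m - \<rho>) (n - \<rho>)"
proof -
  let ?r = "m - \<rho>" and ?s = "n - \<rho>"
  define D where "D = four_block_mat (- 1\<^sub>m \<rho>) (0\<^sub>m \<rho> ?s) (0\<^sub>m ?r \<rho>) E"
  from dec M have T1: "T1 \<in> carrier_mat m m" "invertible_mat T1"
    and T2: "T2 \<in> carrier_mat n n" "invertible_mat T2" and \<rho>: "\<rho> \<le> m" "\<rho> \<le> n"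
    and E: "E \<in> carrier_mat ?r ?s" and Meq: "M = T1 * D * T2" unfolding decomposition_def D_def by auto
  note I1 = inv_mat_props[OF T1] and I2 = inv_mat_props[OF T2]
  have D: "D \<in> carrier_mat m n" unfolding D_def using four_block_carrier_mat[of "- 1\<^sub>m \<rho>" \<rho> \<rho> E ?r ?s] E \<rho> by simp
  define X where "X = T2 * N * T1"
  have X: "X \<in> carrier_mat n m" unfolding X_def using T1 T2 N by auto
  have "D = inv_mat T1 * M * inv_mat T2"
    unfolding Meq using T1 T2 D I1 I2 assoc_mult_mat_dim[of "inv_mat T1" T1 D]
    by (simp add: assoc_mult_mat_dim)
  also have "\<dots> = inv_mat T1 * (M * N * M) * inv_mat T2" unfolding N(2) ..
  also have "\<dots> = inv_mat T1 * ((T1 * D * T2) * N * (T1 * D * T2)) * inv_mat T2" unfolding Meq ..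
  also have "\<dots> = (inv_mat T1 * T1) * D * X * D * (T2 * inv_mat T2)"
    unfolding X_def using T1 T2 D I1(1) I2(1) N(1)
    by (simp add: assoc_mult_mat_dim)
  also have "\<dots> = D * X * D" using I1 I2 D X by simp
  finally have DXD: "D = D * X * D" .
  define Y where "Y = mat ?s ?r (\<lambda>(i, j). X $$ (\<rho> + i, \<rho> + j))"
  have Y: "Y \<in> carrier_mat ?s ?r" unfolding Y_def by simp
  have Dlow: "D $$ (\<rho> + i, j) = (if j < \<rho> then 0 else E $$ (i, j - \<rho>))" if "i < ?r" "j < n" for i j
    using that E \<rho> unfolding D_def by (auto simp: four_block_mat_def)
  have Dright: "D $$ (i, \<rho> + j) = (if i < \<rho> then 0 else E $$ (i - \<rho>, j))" if "i < m" "j < ?s" for i j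
    using that E \<rho> unfolding D_def by (auto simp: four_block_mat_def)
  have split: "(\<Sum>k = 0..<a. g k) = (\<Sum>k = 0..<\<rho>. g k) + (\<Sum>k = 0..<a - \<rho>. g (\<rho> + k))" if "\<rho> \<le> a" for a and g :: "nat \<Rightarrow> real"
    using that sum.atLeastLessThan_concat[of 0 \<rho> a g] sum.shift_bounds_nat_ivl[of g 0 \<rho> "a - \<rho>"] by (simp add: add.commute)
  have "E = E * Y * E"
  proof (rule eq_matI)
    fix i j assume "i < dim_row (E * Y * E)" "j < dim_col (E * Y * E)"
    then have ij: "i < ?r" "j < ?s" using E by auto
    have "E $$ (i, j) = D $$ (\<rho> + i, \<rho> + j)" using Dlow[OF ij(1), of "\<rho> + j"] ij by simp
    also have "\<dots> = (\<Sum>l = 0..<m. (\<Sum>k = 0..<n. D $$ (\<rho> + i, k) * X $$ (k, l)) * D $$ (l, \<rho> + j))"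
      using D X ij by (subst DXD) (simp add: scalar_prod_def del: assoc_mult_mat)
    also have "\<dots> = (\<Sum>l = 0..<?r. (\<Sum>k = 0..<n. D $$ (\<rho> + i, k) * X $$ (k, \<rho> + l)) * E $$ (l, j))"
      unfolding split[OF \<rho>(1)] using Dright[OF _ ij(2)] \<rho> by simp
    also have "\<dots> = (\<Sum>l = 0..<?r. (\<Sum>k = 0..<?s. E $$ (i, k) * X $$ (\<rho> + k, \<rho> + l)) * E $$ (l, j))"
      unfolding split[OF \<rho>(2)] using Dlow[OF ij(1)] \<rho> by simp
    also have "\<dots> = (E * Y * E) $$ (i, j)" using E ij unfolding Y_def by (simp add: scalar_prod_def)
    finally show "E $$ (i, j) = (E * Y * E) $$ (i, j)" .
  qed (use E Y in auto)
  then have "msum E \<le> msum (E * Y) * msum E" using msum_mult[of "E * Y" ?r ?r E ?s] E Y by simp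
  also have "\<dots> \<le> msum E * msum Y * msum E"
    by (intro mult_right_mono msum_mult[OF E Y] msum_nonneg)
  also have "\<dots> \<le> msum E * (msum T2 * msum N * msum T1) * msum E"
  proof -
    have "msum Y \<le> msum X" unfolding Y_def by (rule msum_submatrix) (use X \<rho> in simp)
    also have "msum X \<le> msum (T2 * N) * msum T1" unfolding X_def by (rule msum_mult[of _ n m _ m]) (use T1 T2 N in auto)
    also have "\<dots> \<le> msum T2 * msum N * msum T1"
      by (intro mult_right_mono msum_mult[OF T2(1) N(1)] msum_nonneg)
    finally show ?thesis by (intro mult_right_mono mult_left_mono msum_nonneg)
  qed
  finally have "(1 - msum E * (msum T2 * msum N * msum T1)) * msum E \<le> 0" by (simp add: algebra_simps)
  with small have "msum E \<le> 0" by (simp add: mult_le_0_iff)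
  then have "msum E = 0" using msum_nonneg[of E] by simp
  then show ?thesis using msum_eq_0[OF E] by simp
qed

text \<open>As the residual is zero, the lower rows of \<open>T\<^sub>1\<^sup>-\<^sup>1\<close> form a basis of the left null space of \<open>M\<close>.
The coefficients of \<open>F\<close> in this basis are the last columns of \<open>F T\<^sub>1\<close>; their size is controlled by
\<open>F\<close> and \<open>T\<^sub>1\<close>, however large the inverse of \<open>T\<^sub>1\<close> is.\<close>

lemma left_annihilator_factor:
  assumes M: "M \<in> carrier_mat m n" and dec: "decomposition M T1 \<rho> E T2" and E: "E = 0\<^sub>m (m - \<rho>) (n - \<rho>)"
    and F: "F \<in> carrier_mat k m" "F * M = 0\<^sub>m k n"
  obtains Y where "Y \<in> carrier_mat k (m - \<rho>)" "F = Y * lower_rows \<rho> (inv_mat T1)" "msum Y \<le> msum F * msum T1"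
proof
  let ?r = "m - \<rho>" and ?s = "n - \<rho>"
  define D where "D = four_block_mat (- 1\<^sub>m \<rho>) (0\<^sub>m \<rho> ?s) (0\<^sub>m ?r \<rho>) E"
  from dec M have T1: "T1 \<in> carrier_mat m m" "invertible_mat T1"
    and T2: "T2 \<in> carrier_mat n n" "invertible_mat T2" and \<rho>: "\<rho> \<le> m" "\<rho> \<le> n"
    and Meq: "M = T1 * D * T2" unfolding decomposition_def D_def by auto
  note I1 = inv_mat_props[OF T1] and I2 = inv_mat_props[OF T2]
  have D: "D \<in> carrier_mat m n" unfolding D_def using four_block_carrier_mat[of "- 1\<^sub>m \<rho>" \<rho> \<rho> E ?r ?s] E \<rho> by simp
  define G where "G = F * T1"
  have G: "G \<in> carrier_mat k m" unfolding G_def using F T1 by simp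
  let ?Y = "mat k ?r (\<lambda>(i, j). G $$ (0 + i, \<rho> + j))"
  show "?Y \<in> carrier_mat k ?r" by simp
  have "msum ?Y \<le> msum G" by (rule msum_submatrix) (use G \<rho> in simp)
  also have "\<dots> \<le> msum F * msum T1" unfolding G_def by (rule msum_mult[OF F(1) T1(1)])
  finally show "msum ?Y \<le> msum F * msum T1" .
  have "G * D = F * M * inv_mat T2"
    unfolding G_def Meq using F(1) T1(1) T2(1) D I2
    by (simp add: assoc_mult_mat_dim)
  also have "\<dots> = 0\<^sub>m k n" unfolding F(2) using I2 by simp
  finally have GD: "G * D = 0\<^sub>m k n" .
  have G0: "G $$ (i, j) = 0" if "i < k" "j < \<rho>" for i j
  proof -
    have col: "D $$ (l, j) = (if l = j then -1 else 0)" if "l < m" for l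
      using that \<open>j < \<rho>\<close> \<rho> unfolding D_def E by (auto simp: four_block_mat_def)
    have "(G * D) $$ (i, j) = (\<Sum>l = 0..<m. G $$ (i, l) * D $$ (l, j))"
      using G D that \<rho> by (simp add: scalar_prod_def)
    also have "\<dots> = (\<Sum>l = 0..<m. if l = j then - G $$ (i, j) else 0)"
      using col by (intro sum.cong) auto
    also have "\<dots> = - G $$ (i, j)" using that \<rho> by simp
    finally show ?thesis unfolding GD using that \<rho> by simp
  qed
  have F_eq: "F = G * inv_mat T1" unfolding G_def using F(1) T1(1) I1 by (simp add: assoc_mult_mat_dim)
  show "F = ?Y * lower_rows \<rho> (inv_mat T1)"
  proof (rule eq_matI)
    fix i j assume "i < dim_row (?Y * lower_rows \<rho> (inv_mat T1))" "j < dim_col (?Y * lower_rows \<rho> (inv_mat T1))"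
    then have ij: "i < k" "j < m" using I1 by (auto simp: lower_rows_def)
    have "F $$ (i, j) = (\<Sum>l = 0..<m. G $$ (i, l) * inv_mat T1 $$ (l, j))"
      unfolding F_eq using G I1 ij by (simp add: scalar_prod_def)
    also have "\<dots> = (\<Sum>l = 0..<\<rho>. G $$ (i, l) * inv_mat T1 $$ (l, j)) + (\<Sum>l = \<rho>..<m. G $$ (i, l) * inv_mat T1 $$ (l, j))"
      using \<rho> by (simp add: sum.atLeastLessThan_concat)
    also have "\<dots> = (\<Sum>l = 0..<?r. G $$ (i, \<rho> + l) * inv_mat T1 $$ (\<rho> + l, j))"
      using G0[OF ij(1)] sum.shift_bounds_nat_ivl[of "\<lambda>l. G $$ (i, l) * inv_mat T1 $$ (l, j)" 0 \<rho> ?r] \<rho>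
      by (simp add: add.commute)
    also have "\<dots> = (?Y * lower_rows \<rho> (inv_mat T1)) $$ (i, j)"
      using ij I1 by (simp add: scalar_prod_def lower_rows_def)
    finally show "F $$ (i, j) = (?Y * lower_rows \<rho> (inv_mat T1)) $$ (i, j)" .
  qed (use F I1 in \<open>auto simp: lower_rows_def\<close>)
qed

lemma lower_rows_mult:
  assumes "A \<in> carrier_mat m n" "B \<in> carrier_mat n k"
  shows "lower_rows r (A * B) = lower_rows r A * B"
  using assms by (intro eq_matI) (auto simp: lower_rows_def scalar_prod_def)

lemma lower_rows_annihilates:
  assumes M: "M \<in> carrier_mat m n" and dec: "decomposition M T1 \<rho> E T2" and E: "E = 0\<^sub>m (m - \<rho>) (n - \<rho>)"
  shows "lower_rows \<rho> (inv_mat T1) * M = 0\<^sub>m (m - \<rho>) n"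
proof -
  let ?r = "m - \<rho>" and ?s = "n - \<rho>"
  define D where "D = four_block_mat (- 1\<^sub>m \<rho>) (0\<^sub>m \<rho> ?s) (0\<^sub>m ?r \<rho>) E"
  from dec M have T1: "T1 \<in> carrier_mat m m" "invertible_mat T1"
    and T2: "T2 \<in> carrier_mat n n" and \<rho>: "\<rho> \<le> m" "\<rho> \<le> n"
    and Meq: "M = T1 * D * T2" unfolding decomposition_def D_def by auto
  note I1 = inv_mat_props[OF T1]
  have D: "D \<in> carrier_mat m n" unfolding D_def using four_block_carrier_mat[of "- 1\<^sub>m \<rho>" \<rho> \<rho> E ?r ?s] E \<rho> by simp
  have "inv_mat T1 * M = (inv_mat T1 * T1) * (D * T2)"
    unfolding Meq using T1(1) T2 D I1(1) 
    by (simp add: assoc_mult_mat_dim)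
  then have "inv_mat T1 * M = D * T2" using I1 D T2 by simp
  then have "lower_rows \<rho> (inv_mat T1) * M = lower_rows \<rho> D * T2"
    using lower_rows_mult[OF I1(1) M] lower_rows_mult[OF D T2] by simp
  also have "lower_rows \<rho> D = 0\<^sub>m ?r n"
    using D E \<rho> unfolding lower_rows_def D_def by (intro eq_matI) (auto simp: four_block_mat_def)
  finally show ?thesis using T2 by simp
qed

section \<open>Uniformity over the runs\<close>

lemma sum_lessThan_add:
  "(\<Sum>i<a + b. f i) = (\<Sum>i<a. f i) + (\<Sum>i<(b::nat). f (a + i :: nat) :: real)"
  by (induction b) (auto simp: add.assoc)

text \<open>The constraints of a stage in two runs share their path constraints, and the ones inherited from the
successor differ by a left factor \<open>Y\<close>; this is the resulting left factor for the stacked constraints.\<close>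

definition keep_above :: "nat \<Rightarrow> real mat \<Rightarrow> real mat" where
  "keep_above g Y = four_block_mat (1\<^sub>m g) (0\<^sub>m g (dim_col Y)) (0\<^sub>m (dim_row Y) g) Y"

lemma keep_above_carrier: "Y \<in> carrier_mat r s \<Longrightarrow> keep_above g Y \<in> carrier_mat (g + r) (g + s)"
  unfolding keep_above_def by auto

lemma keep_above_mult_append_rows:
  assumes A: "A \<in> carrier_mat g n" and Y: "Y \<in> carrier_mat r s" and B: "B \<in> carrier_mat s n"
  shows "keep_above g Y * (A @\<^sub>r B) = A @\<^sub>r (Y * B)"
proof -
  have z: "1\<^sub>m g \<in> carrier_mat g g" "0\<^sub>m g s \<in> carrier_mat g s" "0\<^sub>m r g \<in> carrier_mat r g"
    "0\<^sub>m g 0 \<in> carrier_mat g 0" "0\<^sub>m s 0 \<in> carrier_mat s 0" by auto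
  show ?thesis
    unfolding keep_above_def append_rows_def
    using mult_four_block_mat[OF z(1,2,3) Y A z(4) B z(5)] A B Y by simp
qed

lemma msum_keep_above: "msum (keep_above g Y) = real g + msum Y"
proof -
  have "msum (keep_above g Y) = (\<Sum>i<g. \<Sum>j<g. if i = j then 1 else 0) + (\<Sum>i<dim_row Y. \<Sum>j<dim_col Y. \<bar>Y $$ (i, j)\<bar>)"
    unfolding msum_def keep_above_def by (simp add: sum_lessThan_add four_block_mat_def) 
  then show ?thesis unfolding msum_def by simp
qed

text \<open>The runs over which the bounds at stage \<open>k\<close> are uniform. The threshold of the run is left open: once the
residuals vanish, the bounds depend on the size of the factors only.\<close>

definition bounded_exact_tail :: "lq_data \<Rightarrow> real \<Rightarrow> nat \<Rightarrow> lq_run \<Rightarrow> bool" where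
  "bounded_exact_tail p c k d \<longleftrightarrow> (\<exists>\<epsilon>. algorithm_run p \<epsilon> d) \<and> bounded_factors p c d \<and>
     (\<forall>j. k \<le> j \<and> j < hor p \<longrightarrow> pos_def_mat (R_hat p d j) \<and> Em d j = 0\<^sub>m (dim_row (Em d j)) (dim_col (Em d j)))"

text \<open>An upper bound for the number of remaining constraints that holds for every run, whatever ranks it
retains.\<close>

definition constraint_count :: "lq_data \<Rightarrow> nat \<Rightarrow> nat" where
  "constraint_count p k = dim_row (GT p) + (\<Sum>j = k..<hor p. dim_vec (gv p j))"

lemma bounded_exact_tail_value_function:
  assumes p: "lq_problem p" and d: "bounded_exact_tail p c k d" and k: "k \<le> hor p"
  shows "value_function p d k"
proof -
  from d obtain \<epsilon> where run: "algorithm_run p \<epsilon> d" unfolding bounded_exact_tail_def by auto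
  show ?thesis by (rule exact_run_value_function[OF p run k]) (use d in \<open>auto simp: bounded_exact_tail_def\<close>)
qed

lemma bounded_exact_tail_Suc: "bounded_exact_tail p c k d \<Longrightarrow> bounded_exact_tail p c (Suc k) d"
  unfolding bounded_exact_tail_def by auto

lemma bounded_exact_tail_stage:
  assumes p: "lq_problem p" and d: "bounded_exact_tail p c (Suc k) d" and k: "k < hor p"
  shows "stage p d k" "stage_reached p d k" "bounded_exact_tail p c k d \<Longrightarrow> completed_stage p d k"
proof -
  from d obtain \<epsilon> where run: "algorithm_run p \<epsilon> d" unfolding bounded_exact_tail_def by auto
  have V: "value_function p d (Suc k)" by (rule bounded_exact_tail_value_function[OF p d]) (use k in simp)
  show r: "stage_reached p d k" using d unfolding bounded_exact_tail_def stage_reached_def by simp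
  note S = run_stage[OF p run k r value_functionD(1-3)[OF V]]
  show "stage p d k" by (rule S(1))
  show "bounded_exact_tail p c k d \<Longrightarrow> completed_stage p d k"
    by (rule S(2)) (use k in \<open>auto simp: bounded_exact_tail_def\<close>)
qed

lemma H_rows_bound:
  assumes p: "lq_problem p" and k: "k \<le> hor p" and d: "bounded_exact_tail p c k d"
  shows "dim_row (Hm d k) \<le> constraint_count p k"
  using k d
proof (induction k rule: inc_induct)
  case base
  then show ?case unfolding bounded_exact_tail_def algorithm_run_def constraint_count_def by auto
next
  case (step k)
  have d': "bounded_exact_tail p c (Suc k) d" using step.prems by (rule bounded_exact_tail_Suc)
  interpret completed_stage p d k by (rule bounded_exact_tail_stage(3)[OF p d' step.hyps(2) step.prems])
  have "dim_row (Hm d k) \<le> dim_vec (gv p k) + dim_row (Hm d (Suc k))" using H_carrier by auto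
  also have "\<dots> \<le> constraint_count p k"
    using step.IH[OF d'] step.hyps unfolding constraint_count_def by (simp add: sum.atLeast_Suc_lessThan)
  finally show ?case .
qed

lemma stage_factor_bounds:
  assumes p: "lq_problem p" and d: "bounded_exact_tail p c (Suc k) d" and k: "k < hor p"
  shows "msum (TL d k) \<le> real (constraint_count p k) * real (constraint_count p k) * max 0 c"
    "msum (TR d k) \<le> real (nu p) * real (nu p) * max 0 c"
    "dim_vec (gv p k) + dim_row (Hm d (Suc k)) \<le> constraint_count p k"
proof -
  interpret stage p d k by (rule bounded_exact_tail_stage(1)[OF p d k])
  have bf: "entries_bounded c (TL d k)" "entries_bounded c (TR d k)"
    using d bounded_exact_tail_stage(2)[OF p d k] k unfolding bounded_exact_tail_def bounded_factors_def by auto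
  show le: "dim_vec (gv p k) + dim_row (Hm d (Suc k)) \<le> constraint_count p k"
    using H_rows_bound[OF p _ d] k unfolding constraint_count_def by (simp add: sum.atLeast_Suc_lessThan)
  have "msum (TL d k) \<le> real \<gamma> * real \<gamma> * max 0 c"
    by (rule msum_le_entries[OF factors(5)]) (use bf(1) factors(5) in \<open>force simp: entries_bounded_def\<close>)
  also have "\<dots> \<le> real (constraint_count p k) * real (constraint_count p k) * max 0 c"
    using le by (intro mult_right_mono mult_mono) auto
  finally show "msum (TL d k) \<le> real (constraint_count p k) * real (constraint_count p k) * max 0 c" .
  show "msum (TR d k) \<le> real (nu p) * real (nu p) * max 0 c"
    by (rule msum_le_entries[OF factors(1)]) (use bf(2) factors(1) in \<open>force simp: entries_bounded_def\<close>)
qed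

lemma bar_transfer:
  assumes s0: "stage p d0 k" and s: "stage p d k"
    and Y: "Y \<in> carrier_mat (dim_row (Hm d0 (Suc k))) (dim_row (Hm d (Suc k)))"
    and H: "Hm d0 (Suc k) = Y * Hm d (Suc k)"
  shows "Gu_bar p d0 k = keep_above (dim_vec (gv p k)) Y * Gu_bar p d k"
    "Gx_bar p d0 k = keep_above (dim_vec (gv p k)) Y * Gx_bar p d k"
proof -
  define r where "r = dim_row (Hm d0 (Suc k))"
  define s where "s = dim_row (Hm d (Suc k))"
  have Yc: "Y \<in> carrier_mat r s" using Y unfolding r_def s_def .
  have Hc: "Hm d (Suc k) \<in> carrier_mat s (nx p)" using stage.H'_carrier[OF \<open>stage p d k\<close>] unfolding s_def .
  note D = stage.data_carrier[OF \<open>stage p d k\<close>]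
  have HB: "Hm d (Suc k) * Bm p k \<in> carrier_mat s (nu p)" "Hm d (Suc k) * Am p k \<in> carrier_mat s (nx p)"
    using Hc D(6,7) by auto
  show "Gu_bar p d0 k = keep_above (dim_vec (gv p k)) Y * Gu_bar p d k"
    unfolding Gu_bar_def keep_above_mult_append_rows[OF D(8) Yc HB(1)] H
    using Yc Hc D(7) assoc_mult_mat_dim[of Y "Hm d (Suc k)" "Bm p k"] by simp
  show "Gx_bar p d0 k = keep_above (dim_vec (gv p k)) Y * Gx_bar p d k"
    unfolding Gx_bar_def keep_above_mult_append_rows[OF D(9) Yc HB(2)] H
    using Yc Hc D(6) assoc_mult_mat_dim[of Y "Hm d (Suc k)" "Am p k"] by simp
qed

text \<open>The rows of \<open>lower_rows\<close> of \<open>T\<^sub>L\<^sup>-\<^sup>1\<close> for the run \<open>d0\<close>, carried over to \<open>d\<close> by the factor of the later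
stage, annihilate the input part of the constraints of \<open>d\<close> and are therefore combinations of the
corresponding rows for \<open>d\<close>. The same combinations relate the state parts, which are the matrices \<open>H\<^sub>k\<close>.\<close>

lemma H_transfer_step:
  assumes s0: "completed_stage p d0 k" "Em d0 k = 0\<^sub>m (dim_row (Em d0 k)) (dim_col (Em d0 k))"
    and s: "completed_stage p d k" "Em d k = 0\<^sub>m (dim_row (Em d k)) (dim_col (Em d k))"
    and Y: "Y \<in> carrier_mat (dim_row (Hm d0 (Suc k))) (dim_row (Hm d (Suc k)))"
    and H: "Hm d0 (Suc k) = Y * Hm d (Suc k)"
  obtains Y' where "Y' \<in> carrier_mat (dim_row (Hm d0 k)) (dim_row (Hm d k))" "Hm d0 k = Y' * Hm d k"
    "msum Y' \<le> msum (lower_rows (rho d0 k) (inv_mat (TL d0 k))) * (real (dim_vec (gv p k)) + msum Y) * msum (TL d k)"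
proof -
  interpret a: completed_stage p d0 k by (rule s0(1))
  interpret b: completed_stage p d k by (rule s(1))
  define g where "g = dim_vec (gv p k)"
  define m0 where "m0 = g + dim_row (Hm d0 (Suc k))"
  define m where "m = g + dim_row (Hm d (Suc k))"
  let ?n = "nu p"
  have a: "Gu_bar p d0 k \<in> carrier_mat m0 ?n" "Gx_bar p d0 k \<in> carrier_mat m0 (nx p)"
    "inv_mat (TL d0 k) \<in> carrier_mat m0 m0" "Em d0 k = 0\<^sub>m (m0 - rho d0 k) (?n - rho d0 k)"
    "dim_row (Hm d0 k) = m0 - rho d0 k"
    using a.bar_carrier a.factors a.H_carrier s0(2) unfolding m0_def g_def by auto
  have b: "Gu_bar p d k \<in> carrier_mat m ?n" "Gx_bar p d k \<in> carrier_mat m (nx p)"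
    "inv_mat (TL d k) \<in> carrier_mat m m" "Em d k = 0\<^sub>m (m - rho d k) (?n - rho d k)"
    "dim_row (Hm d k) = m - rho d k"
    using b.bar_carrier b.factors b.H_carrier s(2) unfolding m_def g_def by auto
  let ?L = "keep_above g Y"
  let ?Na = "lower_rows (rho d0 k) (inv_mat (TL d0 k))"
  let ?N = "lower_rows (rho d k) (inv_mat (TL d k))"
  have L: "?L \<in> carrier_mat m0 m" unfolding m0_def m_def by (rule keep_above_carrier[OF Y])
  have N0: "?Na \<in> carrier_mat (m0 - rho d0 k) m0" using upper_lower_rows_carrier(2)[OF a(3)] .
  have N: "?N \<in> carrier_mat (m - rho d k) m" using upper_lower_rows_carrier(2)[OF b(3)] .
  note T = bar_transfer[OF a.stage_axioms b.stage_axioms Y H, folded g_def]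
  have F: "?Na * ?L \<in> carrier_mat (m0 - rho d0 k) m" using N0 L by simp
  have "?Na * ?L * Gu_bar p d k = ?Na * Gu_bar p d0 k"
    unfolding T(1) using assoc_mult_mat_dim[of ?Na ?L "Gu_bar p d k"] N0 L b(1) by simp
  also have "\<dots> = 0\<^sub>m (m0 - rho d0 k) ?n" by (rule lower_rows_annihilates[OF a(1) a.dec a(4)])
  finally obtain Y' where Y': "Y' \<in> carrier_mat (m0 - rho d0 k) (m - rho d k)" "?Na * ?L = Y' * ?N"
    "msum Y' \<le> msum (?Na * ?L) * msum (TL d k)"
    using left_annihilator_factor[OF b(1) b.dec b(4) F] by metis
  have "Hm d0 k = ?Na * Gx_bar p d0 k"
    unfolding a.H_exact[OF s0(2)] H_tilde_def using lower_rows_mult[OF a(3) a(2)] by simp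
  also have "\<dots> = (?Na * ?L) * Gx_bar p d k"
    unfolding T(2) using assoc_mult_mat_dim[of ?Na ?L "Gx_bar p d k"] N0 L b(2) by simp
  also have "\<dots> = Y' * (?N * Gx_bar p d k)"
    unfolding Y'(2) using assoc_mult_mat_dim[of Y' ?N "Gx_bar p d k"] Y'(1) N b(2) by simp
  also have "?N * Gx_bar p d k = Hm d k"
    unfolding b.H_exact[OF s(2)] H_tilde_def using lower_rows_mult[OF b(3) b(2)] by simp
  finally have HH: "Hm d0 k = Y' * Hm d k" .
  have "msum Y' \<le> msum ?Na * msum ?L * msum (TL d k)"
    using Y'(3) msum_mult[OF N0 L] msum_nonneg[of "TL d k"] by (meson mult_right_mono order_trans)
  then show ?thesis using that[OF _ HH] Y'(1) a(5) b(5) unfolding msum_keep_above g_def by simp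
qed

text \<open>The left factor involves \<open>T\<^sub>L\<^sup>-\<^sup>1\<close> of \<open>d0\<close>, on which there is no uniform bound, and of \<open>d\<close> only \<open>T\<^sub>L\<close>
itself. This is why the constant is chosen after \<open>d0\<close> but before \<open>d\<close>.\<close>

lemma uniform_H_transfer:
  assumes p: "lq_problem p" and k: "k \<le> hor p" and d0: "bounded_exact_tail p c k d0"
  shows "\<exists>C. \<forall>d. bounded_exact_tail p c k d \<longrightarrow>
    (\<exists>Y \<in> carrier_mat (dim_row (Hm d0 k)) (dim_row (Hm d k)). Hm d0 k = Y * Hm d k \<and> msum Y \<le> C)"
  using k d0
proof (induction k rule: inc_induct)
  case base
  have H: "Hm d (hor p) = GT p" if "bounded_exact_tail p c (hor p) d" for d
    using that unfolding bounded_exact_tail_def algorithm_run_def by auto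
  show ?case
  proof (intro exI allI impI)
    fix d assume "bounded_exact_tail p c (hor p) d"
    then show "\<exists>Y \<in> carrier_mat (dim_row (Hm d0 (hor p))) (dim_row (Hm d (hor p))).
      Hm d0 (hor p) = Y * Hm d (hor p) \<and> msum Y \<le> msum (1\<^sub>m (dim_row (GT p)))"
      using H[OF base] H[of d] by (intro bexI[of _ "1\<^sub>m (dim_row (GT p))"]) auto
  qed
next
  case (step k)
  from step.IH[OF bounded_exact_tail_Suc[OF step.prems]] obtain C where
    C: "\<And>d. bounded_exact_tail p c (Suc k) d \<Longrightarrow>
      \<exists>Y \<in> carrier_mat (dim_row (Hm d0 (Suc k))) (dim_row (Hm d (Suc k))). Hm d0 (Suc k) = Y * Hm d (Suc k) \<and> msum Y \<le> C"
    by blast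
  let ?Na = "lower_rows (rho d0 k) (inv_mat (TL d0 k))"
  let ?t = "real (constraint_count p k) * real (constraint_count p k) * max 0 c"
  let ?C = "msum ?Na * (real (dim_vec (gv p k)) + max 0 C) * ?t"
  have cs: "completed_stage p d k" "Em d k = 0\<^sub>m (dim_row (Em d k)) (dim_col (Em d k))"
    if "bounded_exact_tail p c k d" for d
    using bounded_exact_tail_stage(3)[OF p bounded_exact_tail_Suc[OF that] step.hyps(2) that] that step.hyps(2)
    unfolding bounded_exact_tail_def by auto
  show ?case
  proof (intro exI allI impI)
    fix d assume d: "bounded_exact_tail p c k d"
    note d' = bounded_exact_tail_Suc[OF d]
    from C[OF d'] obtain Y where Y: "Y \<in> carrier_mat (dim_row (Hm d0 (Suc k))) (dim_row (Hm d (Suc k)))"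
      "Hm d0 (Suc k) = Y * Hm d (Suc k)" "msum Y \<le> C" by auto
    from H_transfer_step[OF cs[OF step.prems] cs[OF d] Y(1,2)] obtain Y' where
      Y': "Y' \<in> carrier_mat (dim_row (Hm d0 k)) (dim_row (Hm d k))" "Hm d0 k = Y' * Hm d k"
      "msum Y' \<le> msum ?Na * (real (dim_vec (gv p k)) + msum Y) * msum (TL d k)" .
    have "msum ?Na * (real (dim_vec (gv p k)) + msum Y) * msum (TL d k) \<le> ?C"
      using Y(3) stage_factor_bounds(1)[OF p d' step.hyps(2)] msum_nonneg
      by (intro mult_mono mult_nonneg_nonneg add_nonneg_nonneg add_mono) auto
    then show "\<exists>Y \<in> carrier_mat (dim_row (Hm d0 k)) (dim_row (Hm d k)). Hm d0 k = Y * Hm d k \<and> msum Y \<le> ?C"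
      using Y' by (intro bexI[of _ Y'] conjI order.trans[OF Y'(3)])
  qed
qed

text \<open>Fix a reference run with constraint matrix \<open>M\<^sub>0\<close> and \<open>M\<^sub>0 N\<^sub>0 M\<^sub>0 = M\<^sub>0\<close>. For another run \<open>M = X M\<^sub>0\<close> and
\<open>M\<^sub>0 = Y M\<close> with \<open>Y\<close> bounded, so \<open>N\<^sub>0 Y\<close> is a generalized inverse of \<open>M\<close>:
\<open>M N\<^sub>0 Y M = X M\<^sub>0 N\<^sub>0 M\<^sub>0 = X M\<^sub>0 = M\<close>.\<close>

lemma uniform_generalized_inverse:
  assumes p: "lq_problem p" and k: "k < hor p"
  shows "\<exists>C. \<forall>d. bounded_exact_tail p c (Suc k) d \<longrightarrow>
    (\<exists>N \<in> carrier_mat (nu p) (dim_row (Gu_bar p d k)). Gu_bar p d k * N * Gu_bar p d k = Gu_bar p d k \<and> msum N \<le> C)"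
proof (cases "\<exists>d0. bounded_exact_tail p c (Suc k) d0")
  case True
  then obtain d0 where d0: "bounded_exact_tail p c (Suc k) d0" ..
  have k': "Suc k \<le> hor p" using k by simp
  note s0 = bounded_exact_tail_stage(1)[OF p d0 k]
  define M0 where "M0 = Gu_bar p d0 k"
  define g where "g = dim_vec (gv p k)"
  define m0 where "m0 = g + dim_row (Hm d0 (Suc k))"
  have M0: "M0 \<in> carrier_mat m0 (nu p)" using stage.bar_carrier(4)[OF s0] unfolding M0_def m0_def g_def .
  obtain N0 where N0: "N0 \<in> carrier_mat (nu p) m0" "M0 * N0 * M0 = M0"
    using generalized_inverse_exists[OF M0] .
  obtain C where C: "\<And>d. bounded_exact_tail p c (Suc k) d \<Longrightarrow>
      \<exists>Y \<in> carrier_mat (dim_row (Hm d0 (Suc k))) (dim_row (Hm d (Suc k))). Hm d0 (Suc k) = Y * Hm d (Suc k) \<and> msum Y \<le> C"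
    using uniform_H_transfer[OF p k' d0] by blast
  show ?thesis
  proof (intro exI allI impI)
    fix d assume d: "bounded_exact_tail p c (Suc k) d"
    note s = bounded_exact_tail_stage(1)[OF p d k]
    define M where "M = Gu_bar p d k"
    define m where "m = g + dim_row (Hm d (Suc k))"
    have M: "M \<in> carrier_mat m (nu p)" using stage.bar_carrier(4)[OF s] unfolding M_def m_def g_def .
    from C[OF d] obtain Y where Y: "Y \<in> carrier_mat (dim_row (Hm d0 (Suc k))) (dim_row (Hm d (Suc k)))"
      "Hm d0 (Suc k) = Y * Hm d (Suc k)" "msum Y \<le> C" by auto
    from uniform_H_transfer[OF p k' d] d0 obtain X where
      X: "X \<in> carrier_mat (dim_row (Hm d (Suc k))) (dim_row (Hm d0 (Suc k)))" "Hm d (Suc k) = X * Hm d0 (Suc k)" by blast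
    let ?LY = "keep_above g Y" and ?LX = "keep_above g X"
    have LY: "?LY \<in> carrier_mat m0 m" and LX: "?LX \<in> carrier_mat m m0"
      unfolding m0_def m_def using keep_above_carrier[OF Y(1)] keep_above_carrier[OF X(1)] by auto
    have MY: "M0 = ?LY * M" and MX: "M = ?LX * M0"
      unfolding M0_def M_def g_def using bar_transfer(1)[OF s0 s Y(1,2)] bar_transfer(1)[OF s s0 X(1,2)] by auto
    have N: "N0 * ?LY \<in> carrier_mat (nu p) m" using N0(1) LY by simp
    have "M * (N0 * ?LY) * M = M * N0 * (?LY * M)"
      using M N0(1) LY by (simp add: assoc_mult_mat_dim)
    also have "\<dots> = ?LX * (M0 * N0 * M0)"
      unfolding MY[symmetric] unfolding MX using M0 N0(1) LX by (simp add: assoc_mult_mat_dim)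
    also have "\<dots> = M" unfolding N0(2) MX[symmetric] ..
    finally have MNM: "M * (N0 * ?LY) * M = M" .
    have "msum (N0 * ?LY) \<le> msum N0 * (real g + msum Y)"
      using msum_mult[OF N0(1) LY] unfolding msum_keep_above .
    also have "\<dots> \<le> msum N0 * (real g + C)" using Y(3) msum_nonneg by (intro mult_left_mono) auto
    finally show "\<exists>N \<in> carrier_mat (nu p) (dim_row (Gu_bar p d k)). Gu_bar p d k * N * Gu_bar p d k = Gu_bar p d k \<and>
       msum N \<le> msum N0 * (real g + C)"
      using MNM N M unfolding M_def[symmetric] by (intro bexI[of _ "N0 * ?LY"]) auto
  qed
qed auto

lemma residual_vanishes:
  assumes p: "lq_problem p" and k: "k < hor p"
  shows "\<exists>\<epsilon>\<^sub>0 > 0. \<forall>\<epsilon> d. \<epsilon> \<le> \<epsilon>\<^sub>0 \<and> algorithm_run p \<epsilon> d \<and> bounded_exact_tail p c (Suc k) d \<longrightarrow>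
    Em d k = 0\<^sub>m (dim_row (Em d k)) (dim_col (Em d k))"
proof -
  obtain C where C: "\<And>d. bounded_exact_tail p c (Suc k) d \<Longrightarrow>
    \<exists>N \<in> carrier_mat (nu p) (dim_row (Gu_bar p d k)). Gu_bar p d k * N * Gu_bar p d k = Gu_bar p d k \<and> msum N \<le> C"
    using uniform_generalized_inverse[OF p k] by blast
  define r where "r = real (constraint_count p k)"
  define B where "B = (real (nu p) * real (nu p) * max 0 c) * max 0 C * (r * r * max 0 c)"
  \<comment> \<open>\<open>B\<close> bounds \<open>|T\<^sub>R| |N| |T\<^sub>L|\<close>, and a residual with at most \<open>r\<close> rows and \<open>nu p\<close> columns and entries up to
    \<open>\<epsilon>0\<close> has norm at most \<open>r * nu p * \<epsilon>0\<close>; the product of the two is below one.\<close>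
  define \<epsilon>0 where "\<epsilon>0 = 1 / (1 + r * real (nu p) * B)"
  have B0: "B \<ge> 0" unfolding B_def r_def by simp
  then have den: "1 + r * real (nu p) * B > 0" unfolding r_def by (simp add: add_pos_nonneg)
  show ?thesis
  proof (intro exI conjI allI impI)
    show "\<epsilon>0 > 0" unfolding \<epsilon>0_def using den by simp
    fix \<epsilon> d assume *: "\<epsilon> \<le> \<epsilon>0 \<and> algorithm_run p \<epsilon> d \<and> bounded_exact_tail p c (Suc k) d"
    then have d: "bounded_exact_tail p c (Suc k) d" by simp
    note sr = bounded_exact_tail_stage(1,2)[OF p d k] and bd = stage_factor_bounds[OF p d k]
    interpret stage p d k by (rule sr(1))
    have ent: "\<bar>Em d k $$ (i, j)\<bar> \<le> \<epsilon>0" if "i < dim_row (Em d k)" "j < dim_col (Em d k)" for i j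
    proof -
      have "thresholded_decomposition \<epsilon> (Gu_bar p d k) (TL d k) (rho d k) (Em d k) (TR d k)"
        using * k sr(2) unfolding algorithm_run_def by blast
      then have "\<bar>Em d k $$ (i, j)\<bar> < \<epsilon>" using that unfolding thresholded_decomposition_def by blast
      then show ?thesis using * by simp
    qed
    have "msum (Em d k) \<le> real (\<gamma> - rho d k) * real q * \<epsilon>0"
      by (rule msum_le_entries[OF factors(11)]) (use ent factors(11) in auto)
    also have "\<dots> \<le> r * real (nu p) * \<epsilon>0"
      using bd(3) \<open>\<epsilon>0 > 0\<close> unfolding r_def by (intro mult_right_mono mult_mono) auto
    finally have mE: "msum (Em d k) \<le> r * real (nu p) * \<epsilon>0" .
    obtain N where N: "N \<in> carrier_mat (nu p) \<gamma>" "Gu_bar p d k * N * Gu_bar p d k = Gu_bar p d k" "msum N \<le> C"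
      using C[OF d] bar_carrier(4) by auto
    have "msum (TR d k) * msum N * msum (TL d k) \<le> B"
      unfolding B_def r_def using bd(1,2) N(3) msum_nonneg by (intro mult_mono mult_nonneg_nonneg) auto
    then have "msum (Em d k) * (msum (TR d k) * msum N * msum (TL d k)) \<le> r * real (nu p) * \<epsilon>0 * B"
      using mE msum_nonneg \<open>\<epsilon>0 > 0\<close> by (intro mult_mono mult_nonneg_nonneg) (auto simp: r_def)
    also have "\<dots> < 1" using den unfolding \<epsilon>0_def by (simp add: field_simps)
    finally have "Em d k = 0\<^sub>m (\<gamma> - rho d k) q"
      by (rule small_residual_vanishes[OF bar_carrier(4) dec N(1,2)])
    then show "Em d k = 0\<^sub>m (dim_row (Em d k)) (dim_col (Em d k))" by simp
  qed
qed

lemma small_threshold_exact: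
  assumes p: "lq_problem p"
  shows "\<exists>\<epsilon>\<^sub>0 > 0. \<forall>\<epsilon> d. \<epsilon> \<le> \<epsilon>\<^sub>0 \<and> algorithm_run p \<epsilon> d \<and> bounded_factors p c d \<longrightarrow> exact_factors p d"
proof -
  obtain e where e: "\<And>k. k < hor p \<Longrightarrow> e k > (0::real)"
    "\<And>k \<epsilon> d. k < hor p \<Longrightarrow> \<epsilon> \<le> e k \<Longrightarrow> algorithm_run p \<epsilon> d \<Longrightarrow> bounded_exact_tail p c (Suc k) d \<Longrightarrow>
       Em d k = 0\<^sub>m (dim_row (Em d k)) (dim_col (Em d k))"
  proof -
    have "\<forall>k \<in> {..<hor p}. \<exists>e > 0. \<forall>\<epsilon> d. \<epsilon> \<le> e \<and> algorithm_run p \<epsilon> d \<and> bounded_exact_tail p c (Suc k) d \<longrightarrow>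
        Em d k = 0\<^sub>m (dim_row (Em d k)) (dim_col (Em d k))"
      using residual_vanishes[OF p] by blast
    from bchoice[OF this] show ?thesis using that by auto
  qed
  define \<epsilon>0 where "\<epsilon>0 = Min (e ` {..<hor p})"
  have ne: "e ` {..<hor p} \<noteq> {}" using p unfolding lq_problem_def by (auto simp: lessThan_empty_iff)
  show ?thesis
  proof (intro exI conjI allI impI)
    show "\<epsilon>0 > 0" unfolding \<epsilon>0_def using ne e(1) by (subst Min_gr_iff) auto
    fix \<epsilon> d assume *: "\<epsilon> \<le> \<epsilon>0 \<and> algorithm_run p \<epsilon> d \<and> bounded_factors p c d"
    have le: "\<epsilon> \<le> e k" if "k < hor p" for k
    proof -
      have "\<epsilon>0 \<le> e k" unfolding \<epsilon>0_def using that by (intro Min_le) auto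
      then show ?thesis using * by simp
    qed
    have tail: "bounded_exact_tail p c k d"
      if "k \<le> hor p" "\<And>j. k \<le> j \<Longrightarrow> j < hor p \<Longrightarrow> pos_def_mat (R_hat p d j)" for k
      using that
    proof (induction k rule: inc_induct)
      case base
      then show ?case using * unfolding bounded_exact_tail_def by auto
    next
      case (step k)
      then have t: "bounded_exact_tail p c (Suc k) d" by simp
      have "Em d k = 0\<^sub>m (dim_row (Em d k)) (dim_col (Em d k))"
        using e(2)[OF step.hyps(2) le[OF step.hyps(2)] _ t] * by simp
      with t step.prems step.hyps show ?case
        unfolding bounded_exact_tail_def by (metis le_antisym not_less_eq_eq)
    qed
    show "exact_factors p d" unfolding exact_factors_def
    proof (intro allI impI)
      fix k assume k: "k < hor p" and r: "stage_reached p d k"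
      have "bounded_exact_tail p c (Suc k) d"
        by (rule tail) (use k r in \<open>auto simp: stage_reached_def\<close>)
      then show "Em d k = 0\<^sub>m (dim_row (Em d k)) (dim_col (Em d k))" using e(2)[OF k le[OF k]] * by blast
    qed
  qed
qed

theorem mainTheorem1:
  fixes p :: lq_data and Z :: "real mat"
  assumes "lq_problem p"
    and "full_row_rank (constraint_mat p)"
    and "nullspace_basis_mat (constraint_mat p) Z"
  shows "(\<forall>\<epsilon> > 0. \<forall>d. algorithm_run p \<epsilon> d \<and> exact_factors p d \<longrightarrow>
            (pos_def_mat (reduced_hessian p Z) \<longleftrightarrow>
               (\<forall>k < hor p. pos_def_mat (R_hat p d k)) \<and> pos_def_mat (P_hat_I d))) \<and>
         (\<forall>c. \<exists>\<epsilon>\<^sub>0 > 0. \<forall>\<epsilon>. 0 < \<epsilon> \<and> \<epsilon> \<le> \<epsilon>\<^sub>0 \<longrightarrow>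
            (\<forall>d. algorithm_run p \<epsilon> d \<and> bounded_factors p c d \<longrightarrow>
               (pos_def_mat (reduced_hessian p Z) \<longleftrightarrow>
                  (\<forall>k < hor p. pos_def_mat (R_hat p d k)) \<and> pos_def_mat (P_hat_I d))))"
proof -
  note p = assms(1)
  have main: "pos_def_mat (reduced_hessian p Z) \<longleftrightarrow>
      (\<forall>k < hor p. pos_def_mat (R_hat p d k)) \<and> pos_def_mat (P_hat_I d)"
    if "algorithm_run p \<epsilon> d" "exact_factors p d" for \<epsilon> d
    unfolding reduced_hessian_pos_def_iff[OF p assms(3)] by (rule exact_run_correct[OF p that])
  then show ?thesis using small_threshold_exact[OF p] by (intro conjI allI impI) (blast, meson)
qed

end
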